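(* Let $\Omega$ be a non-empty closed discrete subset of $\mathbb C$ which is stable under addition. Suppose that $\tilde\varphi(z),\tilde\psi(z),\tilde\chi(z)\in\tilde{\mathscr R}_\Omega$ and that $\tilde\chi(z)$ has no constant term. Let $H(t)\in\mathbb C\{t\}$. Then $$\tilde\psi\circ(\mathrm{id}+\tilde\varphi)\in\tilde{\mathscr R}_\Omega,\qquad H\circ\tilde\chi\in\tilde{\mathscr R}_\Omega.$$
   Context: The formal Borel transform is $\mathcal B(a+\sum_{n\ge0}a_nz^{-n-1})=a\delta+\sum a_n\frac{\zeta^n}{n!}$, $\delta$ a symbol. A germ $\hat\varphi\in\mathbb C\{\zeta\}$ is $\Omega$-continuable if there exists $R>0$ not larger than its radius of convergence such that $\{0<|\zeta|<R\}\cap\Omega=\emptyset$ and $\hat\varphi$ admits analytic continuation along any path of $\mathbb C\setminus\Omega$ originating from any point of $\{0<|\zeta|<R\}$. $\hat{\mathscr R}_\Omega$ is the set of $\Omega$-continuable germs and $\tilde{\mathscr R}_\Omega=\mathcal B^{-1}(\mathbb C\delta\oplus\hat{\mathscr R}_\Omega)\subset\mathbb C[[z^{-1}]]$ is the set of $\Omega$-resurgent formal series. Composition: $\tilde\psi\circ(\mathrm{id}+\tilde\varphi)=\sum_{p\ge0}\frac1{p!}\tilde\varphi^p\partial^p\tilde\psi$ with $\partial=d/dz$, and $H\circ\tilde\chi=\sum_{p\ge0}h_p\tilde\chi^p$ for $H(t)=\sum h_pt^p$ (formally convergent series). *)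

theory Defs
  imports "HOL-Complex_Analysis.Complex_Analysis"
begin

text \<open>
  A formal series \<open>a + (\<Sum>n\<ge>0. a n * z^(-n-1))\<close> in \<open>\<complex>[[z\<^sup>-\<^sup>1]]\<close> is a \<open>complex fps\<close> whose
  indeterminate \<open>fps_X\<close> stands for \<open>z\<^sup>-\<^sup>1\<close>: \<open>a\<close> is the coefficient of index \<open>0\<close> and
  \<open>a n\<close> that of index \<open>Suc n\<close>.

  A pair \<open>(a, g)\<close> stands for the element \<open>a \<delta> + g\<close> of \<open>\<complex>\<delta> \<oplus> \<complex>[[\<zeta>]]\<close>.
\<close>

definition borel_transform :: "complex fps \<Rightarrow> complex \<times> complex fps" where
  "borel_transform f = (fps_nth f 0, Abs_fps (\<lambda>n. fps_nth f (Suc n) / fact n))"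

text \<open>
  Analytic continuation along \<open>\<gamma>\<close> of the germ of \<open>f\<close> at \<open>\<gamma> 0\<close>: there is a family of
  germs, \<open>F t\<close> being a germ at \<open>\<gamma> t\<close>, that starts with the germ of \<open>f\<close> and in which
  \<open>F s\<close>, for \<open>s\<close> close to \<open>t\<close>, is the germ at \<open>\<gamma> s\<close> of the function \<open>F t\<close>.
  Germs are represented by functions; only their values near the base point matter.
\<close>

definition continuable_along :: "(complex \<Rightarrow> complex) \<Rightarrow> (real \<Rightarrow> complex) \<Rightarrow> bool" where
  "continuable_along f \<gamma> \<longleftrightarrow>
     (\<exists>F :: real \<Rightarrow> complex \<Rightarrow> complex.
        (\<forall>t\<in>{0..1}. F t analytic_on {\<gamma> t}) \<and>
        (\<forall>\<^sub>F \<zeta> in nhds (\<gamma> 0). F 0 \<zeta> = f \<zeta>) \<and>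
        (\<forall>t\<in>{0..1}. \<forall>\<^sub>F s in at t within {0..1}. \<forall>\<^sub>F \<zeta> in nhds (\<gamma> s). F s \<zeta> = F t \<zeta>))"

text \<open>
  Since \<open>0 < R \<le> fps_conv_radius \<phi>\<close>, membership includes that \<open>\<phi>\<close> is a convergent power
  series, i.e. an element of \<open>\<complex>{\<zeta>}\<close>. The paths start where \<open>eval_fps \<phi>\<close> is holomorphic;
  they may pass through \<open>0\<close> if \<open>0 \<notin> \<Omega>\<close>.
\<close>

definition continuable_germs :: "complex set \<Rightarrow> complex fps set" where
  "continuable_germs \<Omega> =
     {\<phi>. \<exists>R>0. ereal R \<le> fps_conv_radius \<phi> \<and>
           {\<zeta>. 0 < norm \<zeta> \<and> norm \<zeta> < R} \<inter> \<Omega> = {} \<and>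
           (\<forall>\<gamma>. path \<gamma> \<and> path_image \<gamma> \<subseteq> - \<Omega> \<and>
                 0 < norm (pathstart \<gamma>) \<and> norm (pathstart \<gamma>) < R
                 \<longrightarrow> continuable_along (eval_fps \<phi>) \<gamma>)}"

definition resurgent_series :: "complex set \<Rightarrow> complex fps set" where
  "resurgent_series \<Omega> = borel_transform -` (UNIV \<times> continuable_germs \<Omega>)"

text \<open>The derivation \<open>d/dz\<close>, expressed in the variable \<open>X = z\<^sup>-\<^sup>1\<close>, is \<open>-X\<^sup>2 d/dX\<close>.\<close>

definition dz :: "complex fps \<Rightarrow> complex fps" where
  "dz f = - (fps_X\<^sup>2 * fps_deriv f)"

lemma dz_X_power: "dz (fps_X ^ n) = - (of_nat n * fps_X ^ Suc n)"
  by (cases n) (simp_all add: dz_def fps_deriv_power power2_eq_square power_commutes algebra_simps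
      flip: power_Suc fps_of_nat)

text \<open>
  \<open>\<psi> \<circ> (id + \<phi>)\<close>. The infinite sum is taken in the metric topology of \<open>fps\<close>, i.e. it is a sum
  of formal series; it always converges, see \<open>compose_id_plus_sums\<close> below.
\<close>

definition compose_id_plus :: "complex fps \<Rightarrow> complex fps \<Rightarrow> complex fps" where
  "compose_id_plus \<psi> \<phi> = (\<Sum>p. fps_const (1 / fact p) * \<phi> ^ p * (dz ^^ p) \<psi>)"

lemma fps_sums_formal:
  fixes f :: "nat \<Rightarrow> complex fps"
  assumes "\<And>p n. n < p \<Longrightarrow> fps_nth (f p) n = 0"
  shows "f sums Abs_fps (\<lambda>n. \<Sum>p\<le>n. fps_nth (f p) n)"
  unfolding sums_def tendsto_fps_iff
proof
  fix n
  have "fps_nth (\<Sum>p<N. f p) n = (\<Sum>p\<le>n. fps_nth (f p) n)" if "N > n" for N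
    unfolding fps_sum_nth using that assms by (intro sum.mono_neutral_right) auto
  then show "\<forall>\<^sub>F N in sequentially. fps_nth (\<Sum>p<N. f p) n
      = fps_nth (Abs_fps (\<lambda>n. \<Sum>p\<le>n. fps_nth (f p) n)) n"
    by (auto intro: eventually_mono[OF eventually_gt_at_top[of n]])
qed

lemma funpow_dz_nth_eq_0: "n < p \<Longrightarrow> fps_nth ((dz ^^ p) \<psi>) n = 0"
proof (induction p arbitrary: n)
  case (Suc p)
  then show ?case
    by (auto simp: dz_def fps_X_power_mult_nth)
qed simp

lemma compose_id_plus_sums:
  "(\<lambda>p. fps_const (1 / fact p) * \<phi> ^ p * (dz ^^ p) \<psi>) sums compose_id_plus \<psi> \<phi>"
proof -
  have "fps_nth (fps_const (1 / fact p) * \<phi> ^ p * (dz ^^ p) \<psi>) n = 0" if "n < p" for n p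
    unfolding fps_mult_nth[of _ "(dz ^^ p) \<psi>"]
    using that by (intro sum.neutral ballI) (simp add: funpow_dz_nth_eq_0)
  from sums_summable[OF fps_sums_formal[OF this]] show ?thesis
    unfolding compose_id_plus_def by (rule summable_sums)
qed

text \<open>For \<open>chi\<close> without constant term, \<open>H \<circ> chi\<close> is the library's \<open>H oo chi\<close>.\<close>

lemma fps_compose_sums:
  fixes H chi :: "complex fps"
  assumes "fps_nth chi 0 = 0"
  shows "(\<lambda>p. fps_const (fps_nth H p) * chi ^ p) sums (H oo chi)"
proof -
  have "fps_nth (fps_const (fps_nth H p) * chi ^ p) n = 0" if "n < p" for n p
    using startsby_zero_power_prefix[OF assms] that by simp
  from fps_sums_formal[OF this] show ?thesis
    by (simp add: fps_compose_def atLeast0AtMost)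
qed

end

theory Submission
  imports Defs
begin

text \<open>
  The Borel transform turns products into convolutions, so both series become sums of iterated
  convolutions, and one has to continue \<open>u * v\<close> along a path with bounds that survive iteration.
  Replace the path by a chain of small steps starting near \<open>0\<close>. If \<open>x\<close> and \<open>y\<close> are positions
  with \<open>x + y\<close> on the chain, let a step \<open>d\<close> of the chain move them by \<open>\<eta> x / (\<eta> x + \<eta> y) * d\<close>
  and \<open>\<eta> y / (\<eta> x + \<eta> y) * d\<close>, where \<open>\<eta>\<close> is essentially the distance to \<open>\<Omega>\<close>. Started on the
  segment from \<open>0\<close> to the first point, this deforms the contour of the convolution integral while
  avoiding \<open>\<Omega>\<close>. Since \<open>\<Omega>\<close> is stable under addition, \<open>\<eta>\<close> is subadditive; hence the relative
  step sizes \<open>d / \<eta>\<close> of the two parts do not exceed those of the whole chain. So chains with a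
  given number of steps of bounded relative size are closed under this splitting: a convolution
  on this class is bounded by the values of its factors on the same class, times the length of
  the deformed contour, and induction gives the factor \<open>1 / n!\<close> for \<open>n\<close>-fold convolutions.
\<close>

section \<open>Analytic continuation along paths\<close>

text \<open>This is a discrete form of the deformation of a contour by a flow: chains replace paths
  and finite sums of segments replace the moving contour, so no differential equation has to be
  solved. The obstacle is uniformity at 0. A chain may start arbitrarily close to 0, which may lie
  in \<Omega>, so its distance to \<Omega> has no positive lower bound on the class. But everything
  scales with the first point: in n steps \<eta> shrinks and the travelled length grows at most
  geometrically, so a chain is either still in the disc of convergence or its tip has a distance
  from \<Omega> bounded below in terms of n. This yields uniform discs and, by a finite net, uniform
  bounds. The factor 1 / n! comes from the first points: the part with parameter s starts at s x, if
  x is the first point of the chain, so a bound |x|^n / n! for one factor leads to the integral of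
  s^n over [0, 1]. For \<psi> \<circ> (id + \<phi>) the series itself contains 1 / p! and geometric
  bounds suffice; for H \<circ> \<chi> the factorial has to come from the convolutions. Lists that
  start at 0 must be allowed, since the part with s = 0 is one.\<close>

definition germ_eq :: "complex \<Rightarrow> (complex \<Rightarrow> complex) \<Rightarrow> (complex \<Rightarrow> complex) \<Rightarrow> bool" where
  "germ_eq z f g \<longleftrightarrow> (\<forall>\<^sub>F w in nhds z. f w = g w)"

lemma germ_eq_refl [simp]: "germ_eq z f f"
  by (simp add: germ_eq_def)

lemma germ_eq_sym: "germ_eq z f g \<Longrightarrow> germ_eq z g f"
  unfolding germ_eq_def by (auto elim: eventually_mono)

lemma germ_eq_trans: "germ_eq z f g \<Longrightarrow> germ_eq z g h \<Longrightarrow> germ_eq z f h"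
  unfolding germ_eq_def by (auto elim: eventually_elim2)

lemma germ_eq_at: "germ_eq z f g \<Longrightarrow> f z = g z"
  unfolding germ_eq_def by (rule eventually_nhds_x_imp_x)

lemma germ_eqI: "open S \<Longrightarrow> z \<in> S \<Longrightarrow> (\<And>w. w \<in> S \<Longrightarrow> f w = g w) \<Longrightarrow> germ_eq z f g"
  unfolding germ_eq_def by (rule eventually_nhds_in_open [THEN eventually_mono])

lemma germ_eq_ball: "germ_eq z f g \<longleftrightarrow> (\<exists>e>0. \<forall>w\<in>ball z e. f w = g w)"
  unfolding germ_eq_def eventually_nhds_metric by (auto simp: dist_commute)

lemma germ_eq_analytic: "germ_eq z f g \<Longrightarrow> f analytic_on {z} \<Longrightarrow> g analytic_on {z}"
  unfolding germ_eq_def using analytic_at_cong by blast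

lemma germ_eq_holomorphic_eq:
  assumes "germ_eq z f g" "f holomorphic_on S" "g holomorphic_on S" "open S" "connected S" "z \<in> S" "w \<in> S"
  shows "f w = g w"
proof -
  obtain e where e: "e > 0" "\<forall>w\<in>ball z e. f w = g w" using assms(1) germ_eq_ball by auto
  define T where "T = ball z e \<inter> S"
  have T: "open T" "z \<in> T" "T \<subseteq> S" using assms e by (auto simp: T_def)
  then have "T \<noteq> {}" by auto
  with T show ?thesis
    using analytic_continuation_open[of T S f g w] assms e by (auto simp: T_def)
qed

lemma germ_eq_convex:
  assumes "germ_eq z f g" "f holomorphic_on S" "g holomorphic_on T" "open S" "convex S" "open T" "convex T"
    "z \<in> S" "z \<in> T" "w \<in> S" "w \<in> T"
  shows "f w = g w"
  by (rule germ_eq_holomorphic_eq[of z f g "S \<inter> T"])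
     (use assms in \<open>auto intro: holomorphic_on_subset convex_connected convex_Int open_Int\<close>)

section \<open>Uniqueness and stability of continuation along a path\<close>

definition continuation :: "(real \<Rightarrow> complex \<Rightarrow> complex) \<Rightarrow> (real \<Rightarrow> complex) \<Rightarrow> bool" where
  "continuation F \<gamma> \<longleftrightarrow> (\<forall>t\<in>{0..1}. F t analytic_on {\<gamma> t}) \<and>
     (\<forall>t\<in>{0..1}. \<forall>\<^sub>F s in at t within {0..1}. germ_eq (\<gamma> s) (F s) (F t))"

lemma continuable_along_iff:
  "continuable_along f \<gamma> \<longleftrightarrow> (\<exists>F. continuation F \<gamma> \<and> germ_eq (\<gamma> 0) (F 0) f)"
  unfolding continuable_along_def continuation_def germ_eq_def by blast

lemma continuation_local:
  assumes "continuation F \<gamma>" "t \<in> {0..1}"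
  obtains d where "d > 0" "\<And>s. s \<in> {0..1} \<Longrightarrow> \<bar>s - t\<bar> < d \<Longrightarrow> germ_eq (\<gamma> s) (F s) (F t)"
proof -
  have "\<forall>\<^sub>F s in at t within {0..1}. germ_eq (\<gamma> s) (F s) (F t)"
    using assms by (auto simp: continuation_def)
  then obtain d where "d > 0" "\<And>s. s \<in> {0..1} \<Longrightarrow> s \<noteq> t \<Longrightarrow> dist s t < d \<Longrightarrow> germ_eq (\<gamma> s) (F s) (F t)"
    unfolding eventually_at by auto
  then show ?thesis
    by (intro that[of d]) (metis dist_real_def germ_eq_refl)+
qed

text \<open>Bolzano's bisection reduces this to short intervals around a parameter x. There every
  germ \<open>F s\<close> belongs to the one function \<open>F x\<close>, and the identity theorem
  on a ball around \<open>\<gamma> x\<close> carries agreement with \<open>G\<close> between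
  \<open>\<gamma> s\<close> and \<open>\<gamma> x\<close> in both directions.\<close>

lemma continuation_const:
  assumes F: "continuation F \<gamma>" and p: "path \<gamma>" and hol: "G holomorphic_on S" "open S"
    and ab: "0 \<le> a" "a \<le> b" "b \<le> 1" and im: "\<gamma> ` {a..b} \<subseteq> S"
  shows "germ_eq (\<gamma> a) (F a) G \<longleftrightarrow> germ_eq (\<gamma> b) (F b) G"
proof -
  have "a \<le> a \<longrightarrow> b \<le> b \<longrightarrow> (germ_eq (\<gamma> a) (F a) G \<longleftrightarrow> germ_eq (\<gamma> b) (F b) G)"
  proof (rule Bolzano[OF ab(2), where P = "\<lambda>x y. a \<le> x \<longrightarrow> y \<le> b \<longrightarrow> 
        (germ_eq (\<gamma> x) (F x) G \<longleftrightarrow> germ_eq (\<gamma> y) (F y) G)"])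
    show "a \<le> x \<longrightarrow> z \<le> b \<longrightarrow> (germ_eq (\<gamma> x) (F x) G \<longleftrightarrow> germ_eq (\<gamma> z) (F z) G)"
      if "a \<le> x \<longrightarrow> y \<le> b \<longrightarrow> (germ_eq (\<gamma> x) (F x) G \<longleftrightarrow> germ_eq (\<gamma> y) (F y) G)"
        "a \<le> y \<longrightarrow> z \<le> b \<longrightarrow> (germ_eq (\<gamma> y) (F y) G \<longleftrightarrow> germ_eq (\<gamma> z) (F z) G)"
        "x \<le> y" "y \<le> z" for x y z :: real
      using that by auto
  next
    fix x assume x: "a \<le> x" "x \<le> b"
    then have x01: "x \<in> {0..1}" using ab by auto
    obtain d1 where d1: "d1 > 0" "\<And>s. s \<in> {0..1} \<Longrightarrow> \<bar>s - x\<bar> < d1 \<Longrightarrow> germ_eq (\<gamma> s) (F s) (F x)"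
      using continuation_local[OF F x01] by blast
    have "F x analytic_on {\<gamma> x}" using F x01 by (auto simp: continuation_def)
    then obtain r1 where r1: "r1 > 0" "F x holomorphic_on ball (\<gamma> x) r1"
      by (auto simp: analytic_on_def)
    have "\<gamma> x \<in> S" using im x by auto
    then obtain r2 where r2: "r2 > 0" "ball (\<gamma> x) r2 \<subseteq> S"
      using hol(2) open_contains_ball by blast
    define r where "r = min r1 r2"
    have sub: "ball (\<gamma> x) r \<subseteq> ball (\<gamma> x) r1" "ball (\<gamma> x) r \<subseteq> S" using r2 by (auto simp: r_def)
    have r: "r > 0" "F x holomorphic_on ball (\<gamma> x) r" "G holomorphic_on ball (\<gamma> x) r"
      using r1 r2 holomorphic_on_subset[OF hol(1) sub(2)] holomorphic_on_subset[OF r1(2) sub(1)]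
      by (auto simp: r_def)
    have "continuous_on {0..1} \<gamma>" using p by (simp add: path_def)
    then obtain d2 where d2: "d2 > 0" "\<And>s. s \<in> {0..1} \<Longrightarrow> \<bar>s - x\<bar> < d2 \<Longrightarrow> dist (\<gamma> s) (\<gamma> x) < r"
      using x01 r(1) unfolding continuous_on_iff dist_real_def by metis
    have key: "germ_eq (\<gamma> s) (F s) G \<longleftrightarrow> germ_eq (\<gamma> x) (F x) G"
      if s: "s \<in> {0..1}" "\<bar>s - x\<bar> < min d1 d2" for s
    proof -
      have 1: "germ_eq (\<gamma> s) (F s) (F x)" using d1 s by auto
      have 2: "\<gamma> s \<in> ball (\<gamma> x) r" using d2(2)[of s] s by (auto simp: dist_commute)
      have 3: "\<gamma> x \<in> ball (\<gamma> x) r" using r by auto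
      have "germ_eq (\<gamma> s) (F x) G \<longleftrightarrow> germ_eq (\<gamma> x) (F x) G"
        using germ_eq_holomorphic_eq[OF _ r(2,3) open_ball connected_ball]
          germ_eqI[OF open_ball] 2 3 by metis
      then show ?thesis using 1 germ_eq_trans germ_eq_sym by meson
    qed
    show "\<exists>d>0. \<forall>u v. u \<le> x \<and> x \<le> v \<and> v - u < d \<longrightarrow> (a \<le> u \<longrightarrow> v \<le> b \<longrightarrow>
        (germ_eq (\<gamma> u) (F u) G \<longleftrightarrow> germ_eq (\<gamma> v) (F v) G))"
    proof (intro exI[of _ "min d1 d2"] conjI allI impI)
      fix u v assume uv: "u \<le> x \<and> x \<le> v \<and> v - u < min d1 d2" "a \<le> u" "v \<le> b"
      show "germ_eq (\<gamma> u) (F u) G \<longleftrightarrow> germ_eq (\<gamma> v) (F v) G"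
        using key[of u] key[of v] uv ab by auto
    qed (use d1 d2 in auto)
  qed
  then show ?thesis by auto
qed

text \<open>Tolerances of adjacent intervals combine to their minimum, so bisection reduces the
  claim to short intervals, on which one holomorphic function represents all germs of
  \<open>F\<close>. The lemma stands in for homotopy invariance and contains the uniqueness of
  continuation.\<close>

lemma continuation_tube:
  assumes F: "continuation F \<gamma>" and p: "path \<gamma>"
  obtains d where "d > 0"
    "\<And>F' \<gamma>'. continuation F' \<gamma>' \<Longrightarrow> path \<gamma>' \<Longrightarrow> (\<And>t. t \<in> {0..1} \<Longrightarrow> dist (\<gamma>' t) (\<gamma> t) < d) \<Longrightarrow>
       germ_eq (\<gamma>' 0) (F' 0) (F 0) \<Longrightarrow> germ_eq (\<gamma>' 1) (F' 1) (F 1)"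
proof -
  \<comment> \<open>The guards make \<open>P\<close> vacuous outside [0, 1]; Bolzano's principle
    quantifies over all short intervals around a point of [0, 1].\<close>
  define P where "P a b \<longleftrightarrow> (0 \<le> a \<longrightarrow> b \<le> 1 \<longrightarrow> (\<exists>d>0. \<forall>F' \<gamma>'. continuation F' \<gamma>' \<longrightarrow> path \<gamma>' \<longrightarrow>
      (\<forall>t\<in>{0..1}. dist (\<gamma>' t) (\<gamma> t) < d) \<longrightarrow>
       germ_eq (\<gamma>' a) (F' a) (F a) \<longrightarrow> germ_eq (\<gamma>' b) (F' b) (F b)))" for a b
  have "P 0 1"
  proof (rule Bolzano)
    fix a b c :: real assume H: "P a b" "P b c" "a \<le> b" "b \<le> c"
    show "P a c" unfolding P_def
    proof (intro impI)
      assume "0 \<le> a" "c \<le> 1"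
      then obtain d1 d2 where d: "d1 > 0" "d2 > 0"
        and d1: "\<And>F' \<gamma>'. continuation F' \<gamma>' \<Longrightarrow> path \<gamma>' \<Longrightarrow> \<forall>t\<in>{0..1}. dist (\<gamma>' t) (\<gamma> t) < d1 \<Longrightarrow>
           germ_eq (\<gamma>' a) (F' a) (F a) \<Longrightarrow> germ_eq (\<gamma>' b) (F' b) (F b)"
        and d2: "\<And>F' \<gamma>'. continuation F' \<gamma>' \<Longrightarrow> path \<gamma>' \<Longrightarrow> \<forall>t\<in>{0..1}. dist (\<gamma>' t) (\<gamma> t) < d2 \<Longrightarrow>
           germ_eq (\<gamma>' b) (F' b) (F b) \<Longrightarrow> germ_eq (\<gamma>' c) (F' c) (F c)"
        using H unfolding P_def by force
      show "\<exists>d>0. \<forall>F' \<gamma>'. continuation F' \<gamma>' \<longrightarrow> path \<gamma>' \<longrightarrow>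
        (\<forall>t\<in>{0..1}. dist (\<gamma>' t) (\<gamma> t) < d) \<longrightarrow>
         germ_eq (\<gamma>' a) (F' a) (F a) \<longrightarrow> germ_eq (\<gamma>' c) (F' c) (F c)"
        by (rule exI[of _ "min d1 d2"]) (use d d1 d2 in \<open>simp add: min_less_iff_conj\<close>)
    qed
  next
    fix x :: real assume "0 \<le> x" "x \<le> 1"
    then have x01: "x \<in> {0..1}" by auto
    obtain d1 where d1: "d1 > 0" "\<And>s. s \<in> {0..1} \<Longrightarrow> \<bar>s - x\<bar> < d1 \<Longrightarrow> germ_eq (\<gamma> s) (F s) (F x)"
      using continuation_local[OF F x01] by blast
    have "F x analytic_on {\<gamma> x}" using F x01 by (auto simp: continuation_def)
    then obtain r where r: "r > 0" "F x holomorphic_on ball (\<gamma> x) r"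
      by (auto simp: analytic_on_def)
    have "continuous_on {0..1} \<gamma>" using p by (simp add: path_def)
    then obtain d2 where d2: "d2 > 0" "\<And>s. s \<in> {0..1} \<Longrightarrow> \<bar>s - x\<bar> < d2 \<Longrightarrow> dist (\<gamma> s) (\<gamma> x) < r/2"
      using x01 r(1) unfolding continuous_on_iff dist_real_def by (metis half_gt_zero)
    show "\<exists>d>0. \<forall>a b. a \<le> x \<and> x \<le> b \<and> b - a < d \<longrightarrow> P a b"
    proof (intro exI[of _ "min d1 d2"] conjI allI impI)
      fix a b assume ab: "a \<le> x \<and> x \<le> b \<and> b - a < min d1 d2"
      show "P a b" unfolding P_def
      proof (intro impI)
        assume ab01: "0 \<le> a" "b \<le> 1"
        obtain ea where ea: "ea > 0" "\<forall>w\<in>ball (\<gamma> a) ea. F a w = F x w"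
          using d1(2)[of a] ab ab01 germ_eq_ball by auto
        obtain eb where eb: "eb > 0" "\<forall>w\<in>ball (\<gamma> b) eb. F b w = F x w"
          using d1(2)[of b] ab ab01 germ_eq_ball by auto
        \<comment> \<open>\<open>ea\<close> and \<open>eb\<close> keep the ends of \<gamma>' where
          \<open>F a\<close> and \<open>F b\<close> agree with \<open>F x\<close>; r/2 keeps
          \<gamma>' on [a, b] in the ball where \<open>F x\<close> is holomorphic.\<close>
        define d where "d = Min {ea, eb, r/2}"
        have d: "d > 0" "d \<le> ea" "d \<le> eb" "d \<le> r/2" using ea eb r by (auto simp: d_def)
        show "\<exists>d>0. \<forall>F' \<gamma>'. continuation F' \<gamma>' \<longrightarrow> path \<gamma>' \<longrightarrow>
          (\<forall>t\<in>{0..1}. dist (\<gamma>' t) (\<gamma> t) < d) \<longrightarrow>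
           germ_eq (\<gamma>' a) (F' a) (F a) \<longrightarrow> germ_eq (\<gamma>' b) (F' b) (F b)"
        proof (intro exI[of _ d] conjI allI impI)
          fix F' \<gamma>' assume F': "continuation F' \<gamma>'" "path \<gamma>'"
            and near: "\<forall>t\<in>{0..1}. dist (\<gamma>' t) (\<gamma> t) < d" and start: "germ_eq (\<gamma>' a) (F' a) (F a)"
          have "\<gamma>' a \<in> ball (\<gamma> a) ea" "\<gamma>' b \<in> ball (\<gamma> b) eb"
            using near[rule_format, of a] near[rule_format, of b] d ab ab01
            by (auto simp: dist_commute)
          then have 1: "germ_eq (\<gamma>' a) (F a) (F x)" "germ_eq (\<gamma>' b) (F b) (F x)"
            using ea eb by (auto intro: germ_eqI[OF open_ball])
          have im: "\<gamma>' ` {a..b} \<subseteq> ball (\<gamma> x) r"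
          proof
            fix y assume "y \<in> \<gamma>' ` {a..b}"
            then obtain s where s: "s \<in> {a..b}" "y = \<gamma>' s" by auto
            have "dist (\<gamma>' s) (\<gamma> s) < r/2" using near[rule_format, of s] s ab01 d by auto
            moreover have "dist (\<gamma> s) (\<gamma> x) < r/2" using d2(2)[of s] s ab ab01 by auto
            ultimately show "y \<in> ball (\<gamma> x) r"
              unfolding s mem_ball by (metis dist_commute dist_triangle_half_l)
          qed
          show "germ_eq (\<gamma>' b) (F' b) (F b)"
            using continuation_const[OF F' r(2) open_ball ab01(1) _ ab01(2) im] ab 1 start
            by (meson germ_eq_sym germ_eq_trans order_trans)
        qed (use d in auto)
      qed
    qed (use d1 d2 in auto)
  qed auto
  then show ?thesis using that unfolding P_def by fastforce
qed

lemma continuation_unique: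
  assumes "continuation F \<gamma>" "continuation F' \<gamma>" "path \<gamma>" "germ_eq (\<gamma> 0) (F' 0) (F 0)"
  shows "germ_eq (\<gamma> 1) (F' 1) (F 1)"
  using continuation_tube[OF assms(1,3)] assms by (metis dist_self)

lemma continuation_joinpaths:
  assumes F: "continuation F (\<gamma>1 +++ \<gamma>2)" and j: "pathfinish \<gamma>1 = pathstart \<gamma>2"
  shows "continuation (\<lambda>t. F (t/2)) \<gamma>1" "continuation (\<lambda>t. F ((1 + t)/2)) \<gamma>2"
proof -
  have 1: "(\<gamma>1 +++ \<gamma>2) (t/2) = \<gamma>1 t" if "t \<in> {0..1}" for t
    using that by (auto simp: joinpaths_def)
  have 2: "(\<gamma>1 +++ \<gamma>2) ((1+t)/2) = \<gamma>2 t" if "t \<in> {0..1}" for t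
    using that j by (cases "t = 0") (auto simp: joinpaths_def pathfinish_def pathstart_def field_simps)
  show "continuation (\<lambda>t. F (t/2)) \<gamma>1" unfolding continuation_def
  proof (intro conjI ballI)
    fix t :: real assume t: "t \<in> {0..1}"
    then have t': "t/2 \<in> {0..1}" by auto
    show "F (t/2) analytic_on {\<gamma>1 t}" using F t' 1[OF t] unfolding continuation_def by metis
    obtain d where d: "d > 0" "\<And>s. s \<in> {0..1} \<Longrightarrow> \<bar>s - t/2\<bar> < d \<Longrightarrow> germ_eq ((\<gamma>1 +++ \<gamma>2) s) (F s) (F (t/2))"
      using continuation_local[OF F t'] by blast
    have "germ_eq (\<gamma>1 s) (F (s/2)) (F (t/2))" if "s \<in> {0..1}" "\<bar>s - t\<bar> < d" for s
      using d(2)[of "s/2"] that 1[of s] by (auto simp: diff_divide_distrib[symmetric])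
    then show "\<forall>\<^sub>F s in at t within {0..1}. germ_eq (\<gamma>1 s) (F (s/2)) (F (t/2))"
      unfolding eventually_at dist_real_def using d(1) by blast
  qed
  show "continuation (\<lambda>t. F ((1+t)/2)) \<gamma>2" unfolding continuation_def
  proof (intro conjI ballI)
    fix t :: real assume t: "t \<in> {0..1}"
    then have t': "(1+t)/2 \<in> {0..1}" by auto
    show "F ((1+t)/2) analytic_on {\<gamma>2 t}" using F t' 2[OF t] unfolding continuation_def by metis
    obtain d where d: "d > 0" "\<And>s. s \<in> {0..1} \<Longrightarrow> \<bar>s - (1+t)/2\<bar> < d \<Longrightarrow> germ_eq ((\<gamma>1 +++ \<gamma>2) s) (F s) (F ((1+t)/2))"
      using continuation_local[OF F t'] by blast
    have "germ_eq (\<gamma>2 s) (F ((1+s)/2)) (F ((1+t)/2))" if "s \<in> {0..1}" "\<bar>s - t\<bar> < d" for s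
    proof -
      have "(1+s)/2 \<in> {0..1}" "\<bar>(1+s)/2 - (1+t)/2\<bar> < d"
        using that by (auto simp: diff_divide_distrib[symmetric])
      then show ?thesis using d(2)[of "(1+s)/2"] 2[OF that(1)] by metis
    qed
    then show "\<forall>\<^sub>F s in at t within {0..1}. germ_eq (\<gamma>2 s) (F ((1+s)/2)) (F ((1+t)/2))"
      unfolding eventually_at dist_real_def using d(1) by blast
  qed
qed

section \<open>Germs continuable along all paths that avoid a set\<close>

definition continuable_off :: "complex set \<Rightarrow> complex \<Rightarrow> (complex \<Rightarrow> complex) \<Rightarrow> bool" where
  "continuable_off \<Omega> z f \<longleftrightarrow> (\<forall>\<gamma>. path \<gamma> \<and> path_image \<gamma> \<subseteq> - \<Omega> \<and> pathstart \<gamma> = z \<longrightarrow> continuable_along f \<gamma>)"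

lemma continuable_off_cong: "germ_eq z f g \<Longrightarrow> continuable_off \<Omega> z f \<Longrightarrow> continuable_off \<Omega> z g"
  unfolding continuable_off_def continuable_along_iff pathstart_def by (metis germ_eq_trans)

text \<open>Continue \<open>f\<close> along \<gamma> followed by a further path; by uniqueness along
  \<gamma> the second half starts with the germ of \<open>F 1\<close>.\<close>

lemma continuable_off_transport:
  assumes ac: "continuable_off \<Omega> z f" and p: "path \<gamma>" "path_image \<gamma> \<subseteq> - \<Omega>" "pathstart \<gamma> = z"
    and F: "continuation F \<gamma>" "germ_eq z (F 0) f"
  shows "continuable_off \<Omega> (pathfinish \<gamma>) (F 1)"
  unfolding continuable_off_def
proof (intro allI impI)
  fix \<gamma>' assume g: "path \<gamma>' \<and> path_image \<gamma>' \<subseteq> - \<Omega> \<and> pathstart \<gamma>' = pathfinish \<gamma>"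
  then have "path (\<gamma> +++ \<gamma>')" "path_image (\<gamma> +++ \<gamma>') \<subseteq> - \<Omega>" "pathstart (\<gamma> +++ \<gamma>') = z"
    using p by (auto simp: path_image_join)
  then obtain G where G: "continuation G (\<gamma> +++ \<gamma>')" "germ_eq z (G 0) f"
    using ac unfolding continuable_off_def continuable_along_iff pathstart_def by metis
  note G12 = continuation_joinpaths[OF G(1), simplified g, simplified]
  have "germ_eq (\<gamma> 1) (G (1/2)) (F 1)"
    using continuation_unique[OF F(1) G12(1)] p G(2) F(2) germ_eq_trans germ_eq_sym
    by (metis div_0 pathstart_def)
  then show "continuable_along (F 1) \<gamma>'"
    unfolding continuable_along_iff using G12(2) g
    by (intro exI[of _ "\<lambda>t. G ((1+t)/2)"]) (auto simp: pathfinish_def pathstart_def)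
qed

text \<open>Monodromy for a disc: continue along all radii and take the end values. By the tube
  lemma the end germs for neighbouring radii belong to one function, which makes \<open>g\<close>
  holomorphic.\<close>

lemma continuable_off_ball:
  assumes ac: "continuable_off \<Omega> z f" and d: "ball z d \<subseteq> - \<Omega>" and "d > 0"
  obtains g where "g holomorphic_on ball z d" "germ_eq z g f"
    "\<And>w. w \<in> ball z d \<Longrightarrow> continuable_off \<Omega> w g"
proof -
  have "\<exists>F. continuation F (linepath z w) \<and> germ_eq z (F 0) f" if "w \<in> ball z d" for w
  proof -
    have "closed_segment z w \<subseteq> ball z d"
      using that \<open>d > 0\<close> by (intro closed_segment_subset) auto
    then have "continuable_along f (linepath z w)"
      using ac d unfolding continuable_off_def by auto
    then show ?thesis unfolding continuable_along_iff by (auto simp: linepath_def)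
  qed
  then obtain F where F: "\<And>w. w \<in> ball z d \<Longrightarrow> continuation (F w) (linepath z w)"
      "\<And>w. w \<in> ball z d \<Longrightarrow> germ_eq z (F w 0) f" by metis
  define g where "g w = F w 1 w" for w
  have g: "germ_eq w g (F w 1)" if w: "w \<in> ball z d" for w
  proof -
    obtain e where e: "e > 0" "\<And>F' \<gamma>'. continuation F' \<gamma>' \<Longrightarrow> path \<gamma>' \<Longrightarrow>
       (\<And>t. t \<in> {0..1} \<Longrightarrow> dist (\<gamma>' t) (linepath z w t) < e) \<Longrightarrow>
       germ_eq (\<gamma>' 0) (F' 0) (F w 0) \<Longrightarrow> germ_eq (\<gamma>' 1) (F' 1) (F w 1)"
      using continuation_tube[OF F(1)[OF w]] by blast
    have "g v = F w 1 v" if v: "v \<in> ball z d \<inter> ball w e" for v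
    proof -
      have v': "v \<in> ball z d" using v by auto
      have "dist (linepath z v t) (linepath z w t) < e" if "t \<in> {0..1}" for t
      proof -
        have "linepath z v t - linepath z w t = of_real t * (v - w)"
          by (simp add: linepath_def algebra_simps scaleR_conv_of_real)
        then have "dist (linepath z v t) (linepath z w t) = t * dist v w"
          using that by (simp add: dist_norm norm_mult)
        also have "\<dots> \<le> 1 * dist v w" using that by (intro mult_right_mono) auto
        also have "\<dots> < e" using v by (auto simp: dist_commute)
        finally show ?thesis .
      qed
      moreover have "germ_eq z (F v 0) (F w 0)"
        using F(2)[OF w] F(2)[OF v'] germ_eq_sym germ_eq_trans by meson
      ultimately have "germ_eq v (F v 1) (F w 1)"
        using e(2)[OF F(1)[OF v'] path_linepath] by (simp add: linepath_def)
      then show ?thesis by (auto simp: g_def dest: germ_eq_at)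
    qed
    then show ?thesis using w e by (intro germ_eqI[of "ball z d \<inter> ball w e"]) auto
  qed
  have an: "F w 1 analytic_on {w}" if "w \<in> ball z d" for w
    using F(1)[OF that] unfolding continuation_def
    by (metis atLeastAtMost_iff linepath_1' order_refl zero_le_one)
  have hol: "g holomorphic_on ball z d"
    using an g germ_eq_analytic germ_eq_sym analytic_on_analytic_at analytic_imp_holomorphic by metis
  have z: "z \<in> ball z d" using \<open>d > 0\<close> by auto
  have "continuable_off \<Omega> w g" if w: "w \<in> ball z d" for w
  proof -
    have "closed_segment z w \<subseteq> ball z d"
      using that \<open>d > 0\<close> by (intro closed_segment_subset) auto
    then have "continuable_off \<Omega> w (F w 1)"
      using continuable_off_transport[OF ac path_linepath _ _ F(1)[OF w] F(2)[OF w]] d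
      by auto
    then show ?thesis using g[OF w] continuable_off_cong germ_eq_sym by blast
  qed
  moreover have "germ_eq z g f"
  proof -
    \<comment> \<open>The radius to the centre is a constant path, along which the germ cannot
      change.\<close>
    have "germ_eq z (F z 1) (F z 0)"
      using continuation_const[OF F(1)[OF z], of "F z 0"] F(1)[OF z]
    proof -
      have "F z 0 analytic_on {z}" using F(1)[OF z] unfolding continuation_def
        by (metis atLeastAtMost_iff linepath_0' order_refl zero_le_one)
      then obtain r where r: "r > 0" "F z 0 holomorphic_on ball z r" by (auto simp: analytic_on_def)
      show ?thesis
        using continuation_const[OF F(1)[OF z] path_linepath r(2) open_ball, of 0 1] r(1)
        by (auto simp: linepath_refl image_subset_iff)
    qed
    then show ?thesis using g[OF z] F(2)[OF z] germ_eq_trans by meson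
  qed
  ultimately show ?thesis using that hol by blast
qed

section \<open>Convolution and the Borel transform\<close>

text \<open>Convolution sends \<zeta>^i and \<zeta>^j to i! j! / (i + j + 1)! \<zeta>^(i + j + 1).
  Hence the index n - 1, and the coefficient of index 0 vanishes.\<close>

definition fps_convolution :: "complex fps \<Rightarrow> complex fps \<Rightarrow> complex fps" where
  "fps_convolution u v = Abs_fps (\<lambda>n. (\<Sum>i<n. fact i * fact (n - 1 - i) * fps_nth u i * fps_nth v (n - 1 - i)) / fact n)"

text \<open>The induction on j splits off one factor 1 - t: t^i (1 - t)^(j + 1) = t^i (1 - t)^j -
  t^(i + 1) (1 - t)^j.\<close>

lemma has_integral_Beta_nat:
  "((\<lambda>t::real. t ^ i * (1 - t) ^ j) has_integral (fact i * fact j / fact (i + j + 1))) {0..1}"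
proof (induction j arbitrary: i)
  case 0
  have "((\<lambda>t::real. t ^ i) has_integral (1 ^ Suc i / real (Suc i) - 0 ^ Suc i / real (Suc i))) {0..1}"
  proof (rule fundamental_theorem_of_calculus)
    fix x :: real
    have "((\<lambda>t. t ^ Suc i / real (Suc i)) has_real_derivative x ^ i) (at x within {0..1})"
      by (rule derivative_eq_intros refl | simp)+
    then show "((\<lambda>t. t ^ Suc i / real (Suc i)) has_vector_derivative x ^ i) (at x within {0..1})"
      by (simp add: has_real_derivative_iff_has_vector_derivative)
  qed simp
  moreover have "fact i * fact 0 / fact (i + 0 + 1) = (1 / real (Suc i))"
    by (simp add: divide_simps)
  ultimately show ?case by simp
next
  case (Suc j)
  have "((\<lambda>t::real. t ^ i * (1 - t) ^ j - t ^ Suc i * (1 - t) ^ j) has_integral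
      (fact i * fact j / fact (i + j + 1) - fact (Suc i) * fact j / fact (Suc i + j + 1))) {0..1}"
    by (intro has_integral_diff Suc.IH)
  also have "(\<lambda>t::real. t ^ i * (1 - t) ^ j - t ^ Suc i * (1 - t) ^ j) = (\<lambda>t. t ^ i * (1 - t) ^ Suc j)"
    by (simp add: fun_eq_iff algebra_simps)
  also have "fact i * fact j / fact (i + j + 1) - fact (Suc i) * fact j / fact (Suc i + j + 1) =
     (fact i * fact (Suc j) / fact (i + Suc j + 1) :: real)"
  proof -
    have *: "(fact (i + j + 2) :: real) = (real i + real j + 2) * fact (i + j + 1)"
      using fact_Suc[of "i+j+1", where ?'a = real] by (simp add: algebra_simps)
    have "(fact (i + j + 1) :: real) > 0" "real i + real j + 2 > 0" by (simp_all del: fact_Suc)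
    then show ?thesis using * by (simp add: divide_simps del: fact_Suc) (simp add: algebra_simps)
  qed
  finally show ?case .
qed

text \<open>On the segment the integrand is the Cauchy product of the two series at t z and (1 - t)
  z. Its terms are dominated by \<open>M\<close>, uniformly in t, so it may be integrated term by
  term, which leaves Beta integrals.\<close>

lemma fps_convolution_sums:
  fixes u v :: "complex fps"
  assumes R: "ereal R \<le> fps_conv_radius u" "ereal R \<le> fps_conv_radius v" and z: "norm z < R"
  shows "(\<lambda>n. fps_nth (fps_convolution u v) n * z ^ n) sums
     contour_integral (linepath 0 z) (\<lambda>x. eval_fps u x * eval_fps v (z - x))"
proof -
  define c where "c n t = (\<Sum>i\<le>n. (fps_nth u i * (of_real t * z) ^ i) *
     (fps_nth v (n - i) * (of_real (1 - t) * z) ^ (n - i)))" for n and t :: real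
  define M where "M n = (\<Sum>i\<le>n. norm (fps_nth u i * z ^ i) * norm (fps_nth v (n - i) * z ^ (n - i)))" for n
  have abs_u: "summable (\<lambda>n. norm (fps_nth u n * w ^ n))" 
    and abs_v: "summable (\<lambda>n. norm (fps_nth v n * w ^ n))" if "norm w \<le> norm z" for w
    using that z R by (auto intro!: abs_summable_in_conv_radius simp flip: fps_conv_radius_def
      intro: less_le_trans[where y = "ereal R"])
  have small: "norm (of_real t * z) \<le> norm z" "norm (of_real (1 - t) * z) \<le> norm z"
    if "t \<in> {0..1}" for t :: real
    using that by (auto simp: norm_mult mult_left_le_one_le simp del: of_real_diff)
  have csums: "(\<lambda>n. c n t) sums (eval_fps u (of_real t * z) * eval_fps v (of_real (1 - t) * z))"
    if "t \<in> {0..1}" for t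
    unfolding c_def eval_fps_def
    using Cauchy_product_sums[OF abs_u[OF small(1)[OF that]] abs_v[OF small(2)[OF that]]] .
  have Msum: "summable M"
    unfolding M_def using summable_Cauchy_product[of "\<lambda>i. norm (fps_nth u i * z ^ i)" "\<lambda>i. norm (fps_nth v i * z ^ i)"]
    abs_u[of z] abs_v[of z] by simp
  have cM: "norm (c n t) \<le> M n" if "t \<in> {0..1}" for n t
    unfolding c_def M_def
  proof (rule order_trans[OF norm_sum], rule sum_mono)
    fix i
    have "norm ((of_real t * z) ^ i) \<le> norm (z ^ i)" "norm ((of_real (1 - t) * z) ^ (n - i)) \<le> norm (z ^ (n - i))"
      unfolding norm_power using small[OF that] by (auto intro: power_mono)
    then show "norm (fps_nth u i * (complex_of_real t * z) ^ i * (fps_nth v (n - i) * (complex_of_real (1 - t) * z) ^ (n - i)))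
       \<le> norm (fps_nth u i * z ^ i) * norm (fps_nth v (n - i) * z ^ (n - i))"
      unfolding norm_mult[of "fps_nth u i * _"] unfolding norm_mult[of "fps_nth u i"] norm_mult[of "fps_nth v (n - i)"]
      by (intro mult_mono mult_left_mono) auto
  qed
  have ul: "uniform_limit {0..1} (\<lambda>N t. \<Sum>n<N. c n t) (\<lambda>t. \<Sum>n. c n t) sequentially"
    by (rule Weierstrass_m_test[OF _ Msum]) (use cM in auto)
  have ci: "((\<lambda>t. c n t) has_integral (fps_nth (fps_convolution u v) (Suc n) * z ^ n)) {0..1}" for n
  proof -
    have "((\<lambda>t. \<Sum>i\<le>n. of_real (t ^ i * (1 - t) ^ (n - i)) * (fps_nth u i * fps_nth v (n - i) * z ^ n)) has_integral
       (\<Sum>i\<le>n. of_real (fact i * fact (n - i) / fact (i + (n - i) + 1)) * (fps_nth u i * fps_nth v (n - i) * z ^ n))) {0..1}"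
      by (intro has_integral_sum has_integral_mult_left has_integral_of_real has_integral_Beta_nat) auto
    also have "(\<lambda>t. \<Sum>i\<le>n. of_real (t ^ i * (1 - t) ^ (n - i)) * (fps_nth u i * fps_nth v (n - i) * z ^ n)) = c n"
      unfolding c_def
      by (intro ext sum.cong) (auto simp: power_mult_distrib simp flip: power_add)
    also have "(\<Sum>i\<le>n. of_real (fact i * fact (n - i) / fact (i + (n - i) + 1)) * (fps_nth u i * fps_nth v (n - i) * z ^ n))
       = fps_nth (fps_convolution u v) (Suc n) * z ^ n"
      unfolding fps_convolution_def fps_nth_Abs_fps sum_divide_distrib sum_distrib_right lessThan_Suc_atMost
      by (intro sum.cong) (auto simp del: fact_Suc)
    finally show ?thesis .
  qed
  obtain I J where I: "\<And>N. ((\<lambda>t. \<Sum>n<N. c n t) has_integral I N) {0..1}"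
    and J: "((\<lambda>t. \<Sum>n. c n t) has_integral J) {0..1}" and IJ: "I \<longlonglongrightarrow> J"
    using uniform_limit_integral[OF ul _ sequentially_bot]
  proof -
    have "continuous_on {0..1} (\<lambda>t. \<Sum>n<N. c n t)" for N unfolding c_def by (intro continuous_intros)
    then show ?thesis using uniform_limit_integral[OF ul _ sequentially_bot] that by metis
  qed
  have "I N = (\<Sum>n<N. fps_nth (fps_convolution u v) (Suc n) * z ^ n)" for N
    using has_integral_unique[OF I has_integral_sum[OF _ ci]] by auto
  then have "(\<lambda>n. fps_nth (fps_convolution u v) (Suc n) * z ^ n) sums J"
    using IJ unfolding sums_def by presburger
  then have "(\<lambda>n. fps_nth (fps_convolution u v) (Suc n) * z ^ n * z) sums (J * z)"
    by (rule sums_mult2)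
  then have "(\<lambda>n. fps_nth (fps_convolution u v) (Suc n) * z ^ Suc n) sums (J * z)"
    by (simp add: mult_ac)
  \<comment> \<open>The convolution has no constant term, so the series may be shifted by one
    index.\<close>
  then have 1: "(\<lambda>n. fps_nth (fps_convolution u v) n * z ^ n) sums (J * z)"
    by (subst (asm) sums_Suc_iff) (simp add: fps_convolution_def)
  have "((\<lambda>t. (\<Sum>n. c n t) * z) has_integral J * z) {0..1}"
    by (rule has_integral_mult_left[OF J])
  then have "((\<lambda>t. eval_fps u (linepath 0 z t) * eval_fps v (z - linepath 0 z t) * (z - 0)) has_integral J * z) {0..1}"
    by (rule has_integral_eq[rotated])
       (use csums in \<open>auto simp: sums_iff linepath_def scaleR_conv_of_real algebra_simps\<close>)
  then have "((\<lambda>x. eval_fps u x * eval_fps v (z - x)) has_contour_integral (J * z)) (linepath 0 z)"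
    unfolding has_contour_integral_linepath .
  then show ?thesis using 1 by (simp add: contour_integral_unique)
qed

lemma fps_conv_radius_convolution:
  assumes R: "ereal R \<le> fps_conv_radius u" "ereal R \<le> fps_conv_radius v"
  shows "ereal R \<le> fps_conv_radius (fps_convolution u v)"
  unfolding fps_conv_radius_def
proof (rule conv_radius_geI_ex')
  fix r assume "0 < r" "ereal r < ereal R"
  then show "summable (\<lambda>n. fps_nth (fps_convolution u v) n * of_real r ^ n)"
    using sums_summable[OF fps_convolution_sums[OF R, of "of_real r"]] by simp
qed

lemma eval_fps_convolution:
  assumes R: "ereal R \<le> fps_conv_radius u" "ereal R \<le> fps_conv_radius v" and z: "norm z < R"
  shows "eval_fps (fps_convolution u v) z = contour_integral (linepath 0 z) (\<lambda>x. eval_fps u x * eval_fps v (z - x))"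
  using fps_convolution_sums[OF assms] by (simp add: eval_fps_def sums_iff)

section \<open>The Borel transform without its multiple of \<delta>: products and
  derivatives\<close>

definition minor :: "complex fps \<Rightarrow> complex fps" where
  "minor f = snd (borel_transform f)"

lemma minor_nth [simp]: "fps_nth (minor f) n = fps_nth f (Suc n) / fact n"
  by (simp add: minor_def borel_transform_def)

lemma resurgent_iff: "f \<in> resurgent_series \<Omega> \<longleftrightarrow> minor f \<in> continuable_germs \<Omega>"
  by (auto simp: resurgent_series_def minor_def mem_Times_iff)

text \<open>\<delta> is the unit of convolution: expand (a \<delta> + u) * (b \<delta> + v) and drop
  the multiple of \<delta>.\<close>

lemma minor_mult:
  "minor (f * g) = fps_const (fps_nth f 0) * minor g + (fps_const (fps_nth g 0) * minor f +
     fps_convolution (minor f) (minor g))"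
proof (rule fps_ext)
  fix n
  have "(\<Sum>i\<le>Suc n. fps_nth f i * fps_nth g (Suc n - i)) =
    fps_nth f 0 * fps_nth g (Suc n) + (\<Sum>i<n. fps_nth f (Suc i) * fps_nth g (n - i)) + fps_nth f (Suc n) * fps_nth g 0"
    by (subst sum.atMost_Suc_shift) (simp add: lessThan_Suc_atMost[symmetric])
  also have "(\<Sum>i<n. fps_nth f (Suc i) * fps_nth g (n - i)) =
    (\<Sum>i<n. fact i * fact (n - 1 - i) * (fps_nth f (Suc i) / fact i) * (fps_nth g (Suc (n - 1 - i)) / fact (n - 1 - i)))"
    by (intro sum.cong) (auto simp: Suc_diff_Suc)
  finally show "fps_nth (minor (f * g)) n = fps_nth (fps_const (fps_nth f 0) * minor g + (fps_const (fps_nth g 0) * minor f +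
     fps_convolution (minor f) (minor g))) n"
    by (simp add: fps_mult_nth[of f g] fps_convolution_def atLeast0AtMost add_divide_distrib)
qed

lemma minor_dz: "minor (dz f) = - fps_X * minor f"
proof (rule fps_ext)
  fix n show "fps_nth (minor (dz f)) n = fps_nth (- fps_X * minor f) n"
    using of_nat_neq_0[of "n - 1", where 'a = complex]
    by (cases n) (auto simp: dz_def fps_X_power_mult_nth divide_simps)
qed

lemma minor_dz_power: "minor ((dz ^^ p) f) = (- fps_X) ^ p * minor f"
  by (induction p) (simp_all add: minor_dz mult.assoc)

section \<open>Chains and their splittings\<close>

text \<open>Chains are lists with the newest point first. They are thought of as starting at \<open>0\<close>,
  whence the value of \<open>tip []\<close>.\<close>

primrec tip :: "complex list \<Rightarrow> complex" where
  "tip [] = 0"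
| "tip (z # c) = z"

primrec travel :: "complex list \<Rightarrow> real" where
  "travel [] = 0"
| "travel (z # c) = travel c + norm (z - tip c)"

lemma travel_nonneg: "0 \<le> travel c"
  by (induction c) auto

lemma norm_tip_le_travel: "norm (tip c) \<le> travel c"
proof (induction c)
  case (Cons z c)
  have "norm z \<le> norm (tip c) + norm (z - tip c)" by (metis norm_triangle_sub add.commute)
  with Cons show ?case by simp
qed simp

lemma norm_last_le_travel: "c \<noteq> [] \<Longrightarrow> norm (last c) \<le> travel c"
  by (induction c) (auto simp: add_increasing2 travel_nonneg)

text \<open>\<open>R\<close> will be a radius that serves all three given series at once. Whether 0
  belongs to \<Omega> is left open.\<close>

locale additive_singularities =
  fixes \<Omega> :: "complex set" and R :: real
  assumes closed: "closed \<Omega>" and nonempty: "\<Omega> \<noteq> {}"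
    and add: "w \<in> \<Omega> \<Longrightarrow> w' \<in> \<Omega> \<Longrightarrow> w + w' \<in> \<Omega>"
    and R_pos: "R > 0" and R_le: "w \<in> \<Omega> \<Longrightarrow> w \<noteq> 0 \<Longrightarrow> R \<le> norm w"
begin

abbreviation D :: "complex \<Rightarrow> real" where "D z \<equiv> infdist z \<Omega>"

text \<open>Add the nearest points of \<Omega>; this is where its stability under addition
  enters.\<close>

lemma D_add: "D (a + b) \<le> D a + D b"
proof -
  obtain x y where "x \<in> \<Omega>" "D a = dist a x" "y \<in> \<Omega>" "D b = dist b y"
    using infdist_attains_inf[OF closed nonempty] by metis
  moreover have "D (a + b) \<le> dist (a + b) (x + y)"
    using \<open>x \<in> \<Omega>\<close> \<open>y \<in> \<Omega>\<close> by (intro infdist_le add)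
  ultimately show ?thesis
    using norm_triangle_ineq[of "a - x" "b - y"] by (simp add: dist_norm algebra_simps)
qed

lemma D_lipschitz: "D a \<le> D b + norm (a - b)"
  using infdist_triangle[of a \<Omega> b] by (simp add: dist_norm)

lemma D_pos_iff: "0 < D z \<longleftrightarrow> z \<notin> \<Omega>"
  using in_closed_iff_infdist_zero[OF closed nonempty, of z] infdist_nonneg[of z \<Omega>] by linarith

lemma ball_D: "ball z (D z) \<subseteq> - \<Omega>"
  by (auto dest: infdist_le[of _ \<Omega> z])

text \<open>The nearest point of \<Omega> is 0 or has norm at least \<open>R\<close>. Consequently
  \<open>eta [z]\<close> is the norm of z for small z, whether or not 0 lies in \<Omega>.\<close>

lemma norm_le_D: "norm z \<le> R/2 \<Longrightarrow> norm z \<le> D z"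
proof -
  assume z: "norm z \<le> R/2"
  obtain x where x: "x \<in> \<Omega>" "D z = dist z x" using infdist_attains_inf[OF closed nonempty] by metis
  show ?thesis
  proof (cases "x = 0")
    case False
    then have "R \<le> norm x" using R_le x by auto
    moreover have "norm x \<le> norm z + dist z x" by (metis dist_norm norm_minus_commute norm_triangle_sub)
    ultimately show ?thesis using z x by linarith
  qed (use x in auto)
qed

text \<open>The minimum with the travelled length keeps a part that starts at \<open>0\<close> at rest also when
  \<open>0 \<notin> \<Omega>\<close>, while chains that return to \<open>0\<close> later may still move there.\<close>

definition eta :: "complex list \<Rightarrow> real" where
  "eta c = min (D (tip c)) (travel c)"

lemma eta_nonneg: "0 \<le> eta c"
  by (simp add: eta_def travel_nonneg infdist_nonneg)

text \<open>\<open>eta []\<close> is 0, so the first step away from 0 needs its own bound. A quarter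
  of \<open>eta\<close> as step size gives the factors 3/4 and 5/4 in \<open>eta_step\<close> and
  leaves at least half of each disc of radius \<open>rho\<close> free.\<close>

primrec adm :: "complex list \<Rightarrow> bool" where
  "adm [] \<longleftrightarrow> True"
| "adm (z # c) \<longleftrightarrow> adm c \<and> norm (z - tip c) \<le> (if c = [] then R/4 else eta c / 4)"

text \<open>The parameter s marks a point of the initial segment: \<open>split c s\<close> and
  \<open>split c (1 - s)\<close> start at s x and (1 - s) x, where x is the first point of
  \<open>c\<close>. Both parts come from one recursion, so exchanging the two factors of a
  convolution means exchanging s and 1 - s.\<close>

primrec split :: "complex list \<Rightarrow> real \<Rightarrow> complex list" where
  "split [] s = []"
| "split (z # c) s = (tip (split c s) + of_real (if c = [] then s
     else eta (split c s) / (eta (split c s) + eta (split c (1 - s)))) * (z - tip c)) # split c s"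

lemma length_split [simp]: "length (split c s) = length c"
  by (induction c) auto

lemma split_eq_Nil [simp]: "split c s = [] \<longleftrightarrow> c = []"
  by (cases c) auto

lemma last_split: "c \<noteq> [] \<Longrightarrow> last (split c s) = of_real s * last c"
  by (induction c) auto

text \<open>The two minima on the right leave four combinations. The mixed ones hold since
  \<open>D\<close> is Lipschitz with constant 1 and a tip is no farther from 0 than its part has
  travelled.\<close>

lemma eta_subadditive:
  assumes "tip p + tip q = tip c" "travel p + travel q = travel c"
  shows "eta c \<le> eta p + eta q"
proof -
  have "D (tip c) \<le> D (tip p) + D (tip q)" using D_add assms by metis
  moreover have "D (tip c) \<le> D (tip p) + travel q" "D (tip c) \<le> travel p + D (tip q)"
    using D_lipschitz[of "tip c" "tip p"] D_lipschitz[of "tip c" "tip q"]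
      norm_tip_le_travel[of p] norm_tip_le_travel[of q] by (simp_all flip: assms)
  ultimately show ?thesis using assms unfolding eta_def by linarith
qed

text \<open>The induction covers all s at once, since each step uses s and 1 - s together. Travelled
  lengths add up because both parts move in the direction of the step, by nonnegative fractions with
  sum 1.\<close>

lemma split_props:
  assumes "adm c" "s \<in> {0..1}"
  shows "tip (split c s) + tip (split c (1 - s)) = tip c"
    and "travel (split c s) + travel (split c (1 - s)) = travel c"
    and "adm (split c s)"
proof -
  have "\<forall>s\<in>{0..1}. tip (split c s) + tip (split c (1 - s)) = tip c \<and>
     travel (split c s) + travel (split c (1 - s)) = travel c \<and> adm (split c s)"
    using assms(1)
  proof (induction c)
    case (Cons z c)
    show ?case
    proof
      fix s :: real assume s: "s \<in> {0..1}"
      then have s': "1 - s \<in> {0..1}" by auto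
      define \<theta> where "\<theta> s = (if c = [] then s
        else eta (split c s) / (eta (split c s) + eta (split c (1 - s))))" for s
      have sp: "split (z # c) s = (tip (split c s) + of_real (\<theta> s) * (z - tip c)) # split c s" for s
        by (simp add: \<theta>_def)
      have ad: "adm c" "norm (z - tip c) \<le> (if c = [] then R/4 else eta c / 4)"
        using Cons.prems by auto
      have IH: "tip (split c s) + tip (split c (1 - s)) = tip c"
        "travel (split c s) + travel (split c (1 - s)) = travel c"
        "adm (split c s)" "adm (split c (1 - s))" 
        using Cons.IH[OF ad(1)] s s' by auto
      have e: "eta c \<le> eta (split c s) + eta (split c (1 - s))"
        using eta_subadditive IH by blast
      have nn: "0 \<le> eta (split c s)" "0 \<le> eta (split c (1 - s))" by (auto simp: eta_nonneg)
      have \<theta>0: "0 \<le> \<theta> s" "0 \<le> \<theta> (1 - s)" using s by (auto simp: \<theta>_def eta_nonneg)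
      \<comment> \<open>The fractions add up to 1 unless the denominator vanishes; then
        \<open>eta c\<close> is 0 by subadditivity, and the chain does not move.\<close>
      have \<theta>1: "\<theta> s + \<theta> (1 - s) = 1 \<or> z = tip c"
      proof (cases "c \<noteq> [] \<and> eta (split c s) + eta (split c (1 - s)) = 0")
        case True
        then have "eta c \<le> 0" using e by auto
        moreover have "norm (z - tip c) \<le> eta c / 4" using ad(2) True by (simp del: norm_le_zero_iff)
        ultimately have "norm (z - tip c) \<le> 0" by linarith
        then show ?thesis by auto
      next
        case False
        then show ?thesis by (auto simp: \<theta>_def add.commute add_divide_distrib[symmetric])
      qed
      have step: "norm (of_real (\<theta> s) * (z - tip c)) \<le> (if split c s = [] then R/4 else eta (split c s) / 4)"
      proof (cases "c = []")
        case True
        then have "s * norm z \<le> 1 * (R/4)" using s ad by (intro mult_mono) auto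
        then show ?thesis using True s by (simp add: norm_mult \<theta>_def)
      next
        case False
        have "\<theta> s * norm (z - tip c) \<le> \<theta> s * (eta c / 4)"
          using ad False by (intro mult_left_mono \<theta>0) auto
        \<comment> \<open>Subadditivity produces the denominator of the weight, which then cancels:
          the part obeys the same relative bound on its step as the whole chain.\<close>
        also have "\<dots> \<le> \<theta> s * ((eta (split c s) + eta (split c (1 - s))) / 4)"
          using e by (intro mult_left_mono \<theta>0) auto
        also have "\<dots> \<le> eta (split c s) / 4"
          using False nn by (auto simp: \<theta>_def divide_simps)
        finally show ?thesis using False \<theta>0 by (simp add: norm_mult)
      qed
      have "of_real (\<theta> s) * (z - tip c) + of_real (\<theta> (1 - s)) * (z - tip c) = z - tip c"
        using \<theta>1 by (auto simp flip: distrib_right of_real_add)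
      then have "tip (split (z # c) s) + tip (split (z # c) (1 - s)) = z"
        using IH(1) add.assoc[of "tip (split c s)"] unfolding sp tip.simps
        by (simp only: add.assoc add.left_commute[of "complex_of_real (\<theta> s) * (z - tip c)"])
           (simp flip: add.assoc)
      moreover have "\<theta> s * norm (z - tip c) + \<theta> (1 - s) * norm (z - tip c) = norm (z - tip c)"
        using \<theta>1 by (auto simp flip: distrib_right)
      then have "travel (split (z # c) s) + travel (split (z # c) (1 - s)) = travel (z # c)"
        using IH(2) \<theta>0 unfolding sp by (simp add: norm_mult)
      moreover have "adm (split (z # c) s)"
        using IH(3) step unfolding sp by simp
      ultimately show "tip (split (z # c) s) + tip (split (z # c) (1 - s)) = tip (z # c) \<and>
         travel (split (z # c) s) + travel (split (z # c) (1 - s)) = travel (z # c) \<and> adm (split (z # c) s)"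
        by simp
    qed
  qed auto
  then show "tip (split c s) + tip (split c (1 - s)) = tip c"
    "travel (split c s) + travel (split c (1 - s)) = travel c" "adm (split c s)"
    using assms(2) by blast+
qed

lemma eta_split_ge:
  assumes "adm c" "s \<in> {0..1}"
  shows "eta c \<le> eta (split c s) + eta (split c (1 - s))"
  using eta_subadditive split_props[OF assms] by blast

lemma eta_step:
  assumes "adm (z # c)" "c \<noteq> []"
  shows "3/4 * eta c \<le> eta (z # c)" "travel (z # c) \<le> 5/4 * travel c"
proof -
  have *: "norm (z - tip c) \<le> eta c / 4" using assms by auto
  show "3/4 * eta c \<le> eta (z # c)"
  proof -
    have "eta c \<le> D (tip c)" "eta c \<le> travel c" by (auto simp: eta_def)
    then have "3/4 * eta c \<le> D z" "3/4 * eta c \<le> travel (z # c)"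
      using * D_lipschitz[of "tip c" z] eta_nonneg[of c] norm_ge_zero[of "z - tip c"]
      by (simp_all add: norm_minus_commute del: norm_ge_zero)
    then show ?thesis by (simp add: eta_def)
  qed
  show "travel (z # c) \<le> 5/4 * travel c" using * by (simp add: eta_def min_def split: if_splits)
qed

lemma eta_lower: "adm c \<Longrightarrow> c \<noteq> [] \<Longrightarrow> (3/4) ^ length c * norm (last c) \<le> eta c"
proof (induction c)
  case (Cons z c)
  show ?case
  proof (cases "c = []")
    case True
    then show ?thesis using Cons norm_le_D[of z] R_pos by (simp add: eta_def)
  next
    case False
    then show ?thesis using Cons eta_step(1)[OF Cons.prems(1) False] by auto
  qed
qed simp

lemma travel_upper: "adm c \<Longrightarrow> c \<noteq> [] \<Longrightarrow> travel c \<le> (5/4) ^ length c * norm (last c)"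
proof (induction c)
  case (Cons z c)
  show ?case
  proof (cases "c = []")
    case True
    then show ?thesis using Cons by simp
  next
    case False
    then have "travel (z # c) \<le> 5/4 * travel c" using eta_step(2)[OF Cons.prems(1) False] by auto
    also have "\<dots> \<le> 5/4 * ((5/4) ^ length c * norm (last c))"
      using Cons False by (intro mult_left_mono) auto
    finally show ?thesis using False by simp
  qed
qed simp

lemma norm_last_le: "adm c \<Longrightarrow> c \<noteq> [] \<Longrightarrow> norm (last c) \<le> R/4"
  by (induction c) (auto split: if_splits)

lemma eta_pos: "adm c \<Longrightarrow> c \<noteq> [] \<Longrightarrow> last c \<noteq> 0 \<Longrightarrow> 0 < eta c"
  by (rule less_le_trans[OF _ eta_lower]) auto

text \<open>Radius of a disc on which the continuation along \<open>c\<close> is known to be holomorphic; short chains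
  stay inside the initial disc of convergence.\<close>

definition rho :: "complex list \<Rightarrow> real" where
  "rho c = (if travel c < R/2 then R/2 else D (tip c))"

text \<open>3/5 is (3/4) / (5/4), the factor by which \<open>eta\<close> may shrink over the factor
  by which \<open>travel\<close> may grow in one step.\<close>

definition rho_min :: "nat \<Rightarrow> real" where
  "rho_min n = R/2 * (3/5) ^ n"

lemma rho_min_pos: "0 < rho_min n" and rho_min_Suc: "rho_min (Suc n) \<le> rho_min n" and rho_min_le: "rho_min n \<le> R/2"
  using R_pos by (auto simp: rho_min_def power_le_one)

lemma eta_le_rho: "eta c \<le> rho c"
  by (auto simp: eta_def rho_def)

text \<open>A list of n points that has travelled R/2 has a first point of norm at least (4/5)^n
  R/2, hence by \<open>eta_lower\<close> an \<open>eta\<close> of at least (3/5)^n R/2. One that has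
  travelled less is still inside the initial disc. So it does not matter how close to 0 the list
  starts.\<close>

lemma rho_min_le_rho:
  assumes "adm c" shows "rho_min (length c) \<le> rho c"
proof (cases "travel c < R/2")
  case True
  then show ?thesis using rho_min_le by (simp add: rho_def)
next
  case False
  then have ne: "c \<noteq> []" using R_pos by auto
  have "R/2 \<le> (5/4) ^ length c * norm (last c)" using travel_upper[OF assms ne] False by linarith
  then have "(3/5) ^ length c * (R/2) \<le> (3/5) ^ length c * ((5/4) ^ length c * norm (last c))"
    by (intro mult_left_mono) auto
  also have "\<dots> = (3/4) ^ length c * norm (last c)"
    by (simp add: power_mult_distrib[symmetric] mult.assoc[symmetric])
  also have "\<dots> \<le> eta c" using eta_lower[OF assms ne] .
  also have "\<dots> \<le> rho c" by (rule eta_le_rho)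
  finally show ?thesis by (simp add: rho_min_def mult.commute)
qed

lemma rho_pos: "adm c \<Longrightarrow> 0 < rho c"
  using rho_min_le_rho rho_min_pos less_le_trans by blast

text \<open>Keeping to half of the radius leaves room for perturbing the chain in
  \<open>ext_close\<close>.\<close>

lemma norm_step_lt_rho:
  assumes "adm (z # c)"
  shows "norm (z - tip c) \<le> rho c / 2"
proof (cases "c = []")
  case True then show ?thesis using assms R_pos by (auto simp: rho_def)
next
  case False
  then show ?thesis using assms eta_le_rho[of c] eta_nonneg[of c] by auto
qed

lemma eta_lipschitz:
  assumes "norm (tip a - tip b) \<le> d" "\<bar>travel a - travel b\<bar> \<le> d"
  shows "\<bar>eta a - eta b\<bar> \<le> d"
  using D_lipschitz[of "tip a" "tip b"] D_lipschitz[of "tip b" "tip a"] assms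
  unfolding eta_def by (auto simp: norm_minus_commute min_def)

text \<open>One step multiplies the Lipschitz constant in s by 5/4: a weight varies at a rate of
  about 1 / eta, and it multiplies a step of size at most eta / 4. Initially the part is at s x,
  with constant |x|. This bounds the length of the deformed contour and, for a fine subdivision, the
  distance of neighbouring parts.\<close>

lemma split_lipschitz:
  assumes "adm c" "c \<noteq> []" "last c \<noteq> 0" "s \<in> {0..1}" "t \<in> {0..1}"
  shows "norm (tip (split c s) - tip (split c t)) \<le> (5/4) ^ (length c - 1) * norm (last c) * \<bar>s - t\<bar>"
    "\<bar>travel (split c s) - travel (split c t)\<bar> \<le> (5/4) ^ (length c - 1) * norm (last c) * \<bar>s - t\<bar>"
proof -
  define L where "L c s t = (5/4) ^ (length c - 1) * norm (last c :: complex) * \<bar>s - t\<bar>" for c and s t :: real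
  have "\<forall>s\<in>{0..1}. \<forall>t\<in>{0..1}. norm (tip (split c s) - tip (split c t)) \<le> L c s t \<and>
     \<bar>travel (split c s) - travel (split c t)\<bar> \<le> L c s t"
    using assms(1-3)
  proof (induction c)
    case (Cons z c)
    show ?case
    proof (intro ballI)
      fix s t :: real assume st: "s \<in> {0..1}" "t \<in> {0..1}"
      then have st': "1 - s \<in> {0..1}" "1 - t \<in> {0..1}" by auto
      show "norm (tip (split (z # c) s) - tip (split (z # c) t)) \<le> L (z # c) s t \<and>
         \<bar>travel (split (z # c) s) - travel (split (z # c) t)\<bar> \<le> L (z # c) s t"
      proof (cases "c = []")
        case True
        have "norm (of_real s * z - of_real t * z) = norm z * \<bar>s - t\<bar>"
          by (metis left_diff_distrib norm_mult norm_of_real of_real_diff mult.commute)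
        moreover have "\<bar>norm (of_real s * z) - norm (of_real t * z)\<bar> = norm z * \<bar>s - t\<bar>"
          using st by (simp add: norm_mult flip: left_diff_distrib) (simp add: abs_mult mult.commute)
        ultimately show ?thesis using True by (simp add: L_def)
      next
        case False
        define a b where "a s = eta (split c s)" and "b s = eta (split c (1 - s))" for s
        define \<theta> where "\<theta> s = a s / (a s + b s)" for s
        have sp: "split (z # c) s = (tip (split c s) + of_real (\<theta> s) * (z - tip c)) # split c s" for s
          using False by (simp add: \<theta>_def a_def b_def)
        have ad: "adm c" "norm (z - tip c) \<le> eta c / 4" "last c \<noteq> 0"
          using Cons.prems False by auto
        define d where "d = L c s t"
        have IH: "norm (tip (split c s) - tip (split c t)) \<le> d" "\<bar>travel (split c s) - travel (split c t)\<bar> \<le> d"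
           "norm (tip (split c (1 - s)) - tip (split c (1 - t))) \<le> d"
           "\<bar>travel (split c (1 - s)) - travel (split c (1 - t))\<bar> \<le> d"
          using Cons.IH[OF ad(1) False ad(3), rule_format, OF st]
            Cons.IH[OF ad(1) False ad(3), rule_format, OF st'] by (simp_all add: d_def L_def abs_minus_commute)
        have ab: "\<bar>a s - a t\<bar> \<le> d" "\<bar>b s - b t\<bar> \<le> d"
          unfolding a_def b_def using IH by (auto intro!: eta_lipschitz)
        have nn: "0 \<le> a s" "0 \<le> b s" "0 \<le> a t" "0 \<le> b t" by (auto simp: a_def b_def eta_nonneg)
        have e: "eta c \<le> a s + b s" "eta c \<le> a t + b t" "0 < eta c"
          unfolding a_def b_def using eta_split_ge ad st eta_pos False by auto
        \<comment> \<open>Written this way, the factor \<open>a s + b s\<close> cancels in the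
          estimate; what remains is \<open>a t + b t\<close>, which dominates
          \<open>eta c\<close>.\<close>
        have "\<theta> s - \<theta> t = (a s * (b t - b s) + b s * (a s - a t)) / ((a s + b s) * (a t + b t))"
          using e unfolding \<theta>_def by (simp add: field_simps)
        then have "\<bar>\<theta> s - \<theta> t\<bar> = \<bar>a s * (b t - b s) + b s * (a s - a t)\<bar> / ((a s + b s) * (a t + b t))"
          using nn by simp
        also have "\<dots> \<le> ((a s + b s) * d) / ((a s + b s) * (a t + b t))"
        proof (rule divide_right_mono)
          have "\<bar>a s * (b t - b s) + b s * (a s - a t)\<bar> \<le> a s * \<bar>b t - b s\<bar> + b s * \<bar>a s - a t\<bar>"
            using nn by (intro order_trans[OF abs_triangle_ineq]) (simp add: abs_mult)
          also have "\<dots> \<le> a s * d + b s * d"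
            using nn ab by (intro add_mono mult_left_mono) (auto simp: abs_minus_commute)
          finally show "\<bar>a s * (b t - b s) + b s * (a s - a t)\<bar> \<le> (a s + b s) * d"
            by (simp add: algebra_simps)
        qed (use nn in auto)
        also have "\<dots> = d / (a t + b t)" using e by simp
        finally have \<theta>: "\<bar>\<theta> s - \<theta> t\<bar> \<le> d / (a t + b t)" .
        have "\<bar>\<theta> s - \<theta> t\<bar> * norm (z - tip c) \<le> d / (a t + b t) * ((a t + b t) / 4)"
          using \<theta> ad e nn by (intro mult_mono) auto
        also have "\<dots> = d / 4" using e by simp
        finally have \<theta>': "\<bar>\<theta> s - \<theta> t\<bar> * norm (z - tip c) \<le> d / 4" .
        have "tip (split (z # c) s) - tip (split (z # c) t) =
            (tip (split c s) - tip (split c t)) + of_real (\<theta> s - \<theta> t) * (z - tip c)"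
          unfolding sp by (simp add: algebra_simps)
        then have "norm (tip (split (z # c) s) - tip (split (z # c) t)) \<le> d + d/4"
          using norm_triangle_ineq[of "tip (split c s) - tip (split c t)" "of_real (\<theta> s - \<theta> t) * (z - tip c)"] \<theta>' IH(1)
          by (simp add: norm_mult del: of_real_diff split.simps)
        moreover
        have t0: "0 \<le> \<theta> s" "0 \<le> \<theta> t" using nn by (auto simp: \<theta>_def)
        have "travel (split (z # c) s) - travel (split (z # c) t) =
            (travel (split c s) - travel (split c t)) + (\<theta> s - \<theta> t) * norm (z - tip c)"
          unfolding sp using t0 by (simp add: norm_mult left_diff_distrib)
        then have "\<bar>travel (split (z # c) s) - travel (split (z # c) t)\<bar> \<le> d + d/4"
          using \<theta>' IH(2) abs_triangle_ineq[of "travel (split c s) - travel (split c t)" "(\<theta> s - \<theta> t) * norm (z - tip c)"]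
          by (simp add: abs_mult del: split.simps)
        moreover have "L (z # c) s t = d + d / 4"
          using False by (cases c) (auto simp: L_def d_def)
        ultimately show ?thesis by simp
      qed
    qed
  qed auto
  then show "norm (tip (split c s) - tip (split c t)) \<le> (5/4) ^ (length c - 1) * norm (last c) * \<bar>s - t\<bar>"
    "\<bar>travel (split c s) - travel (split c t)\<bar> \<le> (5/4) ^ (length c - 1) * norm (last c) * \<bar>s - t\<bar>"
    using assms unfolding L_def by blast+
qed


section \<open>Continuation along chains\<close>

text \<open>The radius is fixed to that of the locale, so that combinations and convolutions stay in
  one set.\<close>

definition germs :: "complex fps set" where
  "germs = {u. ereal R \<le> fps_conv_radius u \<and>
     (\<forall>z. 0 < norm z \<and> norm z < R \<longrightarrow> continuable_off \<Omega> z (eval_fps u))}"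

lemma germs_holomorphic: "u \<in> germs \<Longrightarrow> S \<subseteq> ball 0 R \<Longrightarrow> eval_fps u holomorphic_on S"
  by (rule holomorphic_on_eval_fps)
     (force simp: germs_def eball_def dist_norm intro: less_le_trans[of _ "ereal R"])

text \<open>The start 0, which \<open>germs\<close> does not mention, is reached from a nearby point
  z: a disc around z free of \<Omega> contains 0, and the function found there coincides with the
  power series.\<close>

lemma continuable_off_0:
  assumes "u \<in> germs" "0 \<notin> \<Omega>" shows "continuable_off \<Omega> 0 (eval_fps u)"
proof -
  have D0: "D 0 > 0" using assms D_pos_iff by auto
  \<comment> \<open>With at most a quarter of \<open>D 0\<close>, the Lipschitz bound gives
    \<open>D z \<ge> 3 * norm z\<close>, so 0 lies in the disc of radius \<open>D z\<close> about
    z.\<close>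
  define z where "z = complex_of_real (min (D 0) R / 4)"
  have nz: "norm z = min (D 0) R / 4" "norm z > 0" using D0 R_pos by (auto simp: z_def)
  then have z: "0 < norm z" "norm z < R" using R_pos by auto
  have "D 0 \<le> D z + norm z" using D_lipschitz[of 0 z] by simp
  then have Dz: "norm z < D z" using nz D0 by auto
  have cz: "continuable_off \<Omega> z (eval_fps u)" "0 < D z"
    using assms z Dz order_le_less_trans[OF norm_ge_zero Dz] by (simp_all add: germs_def)
  note Dz = Dz cz(2)
  then obtain g where g: "g holomorphic_on ball z (D z)" "germ_eq z g (eval_fps u)"
    "\<And>w. w \<in> ball z (D z) \<Longrightarrow> continuable_off \<Omega> w g"
    using continuable_off_ball[OF cz(1) ball_D cz(2)] by blast
  have "germ_eq 0 g (eval_fps u)"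
  proof (rule germ_eqI[of "ball z (D z) \<inter> ball 0 R"])
    show "g w = eval_fps u w" if "w \<in> ball z (D z) \<inter> ball 0 R" for w
      using that z Dz by (intro germ_eq_convex[OF g(2,1) germs_holomorphic[OF assms(1) order_refl]]) auto
  qed (use Dz R_pos in auto)
  moreover have "continuable_off \<Omega> 0 g" using g(3) Dz by auto
  ultimately show ?thesis using continuable_off_cong by blast
qed

text \<open>If 0 lies in \<Omega>, the discs of radius \<open>D z\<close> shrink to nothing near 0,
  so the power series itself is kept while the travelled length is small. The last conjunct of the
  choice lets the continuation go on from any point of the new disc.\<close>

primrec ext :: "complex fps \<Rightarrow> complex list \<Rightarrow> complex \<Rightarrow> complex" where
  "ext u [] = eval_fps u"
| "ext u (z # c) = (if travel (z # c) < R/2 then eval_fps u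
     else SOME g. g holomorphic_on ball z (D z) \<and> germ_eq z g (ext u c) \<and>
       (\<forall>w\<in>ball z (D z). continuable_off \<Omega> w g))"

lemma ext_near: "travel c < R/2 \<Longrightarrow> ext u c = eval_fps u"
  by (cases c) auto

lemma last_nonzero: "adm c \<Longrightarrow> R/2 \<le> travel c \<Longrightarrow> c \<noteq> [] \<and> last c \<noteq> 0"
  using travel_upper[of c] R_pos by (cases "c = []") auto

text \<open>The claims need each other: the next point lies in the current disc, and continuability
  there is what makes the choice in \<open>ext\<close> possible.\<close>

lemma ext_props:
  assumes u: "u \<in> germs" and "adm c"
  shows "ext u c holomorphic_on ball (tip c) (rho c)"
    and "w \<in> ball (tip c) (rho c) \<Longrightarrow> w \<notin> \<Omega> \<Longrightarrow> continuable_off \<Omega> w (ext u c)"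
    and "c = z # c' \<Longrightarrow> germ_eq z (ext u c) (ext u c')"
proof -
  have "ext u c holomorphic_on ball (tip c) (rho c) \<and>
    (\<forall>w\<in>ball (tip c) (rho c) - \<Omega>. continuable_off \<Omega> w (ext u c)) \<and>
    (\<forall>z c'. c = z # c' \<longrightarrow> germ_eq z (ext u c) (ext u c'))"
    using \<open>adm c\<close>
  proof (induction c)
    case Nil
    have "continuable_off \<Omega> w (eval_fps u)" if "w \<in> ball 0 (R/2)" "w \<notin> \<Omega>" for w
      using that u continuable_off_0[OF u] R_pos by (cases "w = 0") (auto simp: germs_def)
    then show ?case using R_pos by (auto simp: rho_def intro!: germs_holomorphic[OF u])
  next
    case (Cons z c)
    show ?case
    proof (cases "travel (z # c) < R/2")
      case True
      have "travel c < R/2" using True norm_ge_zero[of "z - tip c"] by (simp del: norm_ge_zero)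
      then have e: "ext u (z # c) = eval_fps u" "ext u c = eval_fps u"
        using True by (simp_all only: ext_near)
      have "norm z < R/2" using norm_tip_le_travel[of "z # c"] True by simp
      then have sub: "ball z (R/2) \<subseteq> ball 0 R"
        by (auto simp: dist_norm) (smt (verit) norm_triangle_sub norm_minus_commute field_sum_of_halves)
      have "continuable_off \<Omega> w (eval_fps u)" if "w \<in> ball z (R/2)" "w \<notin> \<Omega>" for w
        using that u continuable_off_0[OF u] sub by (cases "w = 0") (auto simp: germs_def)
      then show ?thesis using True e germs_holomorphic[OF u sub] by (auto simp: rho_def simp del: travel.simps ext.simps)
    next
      case False
      have ad: "adm c" using Cons.prems by auto
      have "last (z # c) \<noteq> 0" using last_nonzero[OF Cons.prems] False by auto
      then have "0 < eta (z # c)" using eta_pos Cons.prems by blast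
      then have Dz: "0 < D z" by (simp add: eta_def)
      then have zO: "z \<notin> \<Omega>" using D_pos_iff by auto
      have "z \<in> ball (tip c) (rho c)"
        using norm_step_lt_rho[OF Cons.prems] rho_pos[OF ad] by (simp add: dist_norm norm_minus_commute)
      then have "continuable_off \<Omega> z (ext u c)"
        using Cons.IH[OF ad] zO by auto
      then have "\<exists>g. g holomorphic_on ball z (D z) \<and> germ_eq z g (ext u c) \<and>
         (\<forall>w\<in>ball z (D z). continuable_off \<Omega> w g)"
        using continuable_off_ball[OF _ ball_D Dz] by metis
      from someI_ex[OF this] False show ?thesis
        by (simp add: rho_def)
    qed
  qed
  then show "ext u c holomorphic_on ball (tip c) (rho c)"
    "w \<in> ball (tip c) (rho c) \<Longrightarrow> w \<notin> \<Omega> \<Longrightarrow> continuable_off \<Omega> w (ext u c)"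
    "c = z # c' \<Longrightarrow> germ_eq z (ext u c) (ext u c')"
    by auto
qed

lemmas ext_holomorphic = ext_props(1)

lemma ext_step: "u \<in> germs \<Longrightarrow> adm (z # c) \<Longrightarrow> germ_eq z (ext u (z # c)) (ext u c)"
  using ext_props(3) by blast

lemma tip_in_ball: "adm c \<Longrightarrow> tip c \<in> ball (tip c) (rho c)"
  using rho_pos by simp

lemma step_in_ball: "adm (z # c) \<Longrightarrow> z \<in> ball (tip c) (rho c)"
  using norm_step_lt_rho[of z c] rho_pos[of c] by (simp add: dist_norm norm_minus_commute)

lemma ext_step_eq:
  assumes u: "u \<in> germs" and ad: "adm (z # c)" and w: "w \<in> ball z (rho (z # c))" "w \<in> ball (tip c) (rho c)"
  shows "ext u (z # c) w = ext u c w"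
proof (rule germ_eq_convex[OF ext_step[OF u ad]])
  show "ext u (z # c) holomorphic_on ball z (rho (z # c))" "ext u c holomorphic_on ball (tip c) (rho c)"
    using ext_holomorphic[OF u] ad by fastforce+
  show "z \<in> ball z (rho (z # c))" using tip_in_ball[OF ad] by simp
qed (use w step_in_ball[OF ad] in auto)

text \<open>The identity theorem, applied step by step, replaces the arbitrary choices in
  \<open>ext\<close> by explicitly given functions, as in \<open>ext_linear\<close>.\<close>

lemma ext_unique:
  assumes u: "u \<in> germs" 
    and hol: "\<And>c. adm c \<Longrightarrow> G c holomorphic_on ball (tip c) (rho c)"
    and start: "germ_eq 0 (G []) (eval_fps u)"
    and step: "\<And>z c. adm (z # c) \<Longrightarrow> germ_eq z (G (z # c)) (G c)"
    and "adm c" "w \<in> ball (tip c) (rho c)"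
  shows "G c w = ext u c w"
  using assms(5,6)
proof (induction c arbitrary: w)
  case Nil
  then show ?case
    using germ_eq_convex[OF start hol[of "[]"] ext_holomorphic[OF u, of "[]", simplified], of w] R_pos
    by (auto simp: rho_def)
next
  case (Cons z c)
  then have ad: "adm c" by auto
  have "germ_eq z (G c) (ext u c)"
    by (rule germ_eqI[OF open_ball step_in_ball[OF Cons.prems(1)]]) (use Cons.IH[OF ad] in auto)
  then have "germ_eq z (G (z # c)) (ext u (z # c))"
    using step[OF Cons.prems(1)] ext_step[OF u Cons.prems(1)] germ_eq_trans germ_eq_sym by meson
  from germ_eq_convex[OF this hol[OF Cons.prems(1)] ext_holomorphic[OF u Cons.prems(1)]]
  show ?case using Cons.prems(2) tip_in_ball[OF Cons.prems(1)] by auto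
qed

section \<open>Nearby chains and uniform bounds\<close>

definition close :: "real \<Rightarrow> complex list \<Rightarrow> complex list \<Rightarrow> bool" where
  "close d a b \<longleftrightarrow> list_all2 (\<lambda>x y. norm (x - y) < d) a b"

lemma close_Nil [simp]: "close d [] b \<longleftrightarrow> b = []"
  by (simp add: close_def)

lemma close_Nil2 [simp]: "close d a [] \<longleftrightarrow> a = []"
  by (simp add: close_def)

lemma close_Cons [simp]: "close d (x # a) (y # b) \<longleftrightarrow> norm (x - y) < d \<and> close d a b"
  by (simp add: close_def)

lemma close_refl: "d > 0 \<Longrightarrow> close d a a"
  by (induction a) auto

lemma close_length: "close d a b \<Longrightarrow> length a = length b"
  by (auto simp: close_def dest: list_all2_lengthD)

lemma close_tip: "close d a b \<Longrightarrow> d > 0 \<Longrightarrow> norm (tip a - tip b) < d"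
  by (cases a; cases b) auto

text \<open>Discrete counterpart of \<open>continuation_tube\<close>. The tolerance, half of
  \<open>rho_min\<close>, is what \<open>norm_step_lt_rho\<close> leaves free, so the new point of
  one chain also lies in the discs of the other.\<close>

lemma ext_close:
  assumes u: "u \<in> germs" and "close d a b" "adm a" "adm b" "d \<le> rho_min (length a) / 2"
    "w \<in> ball (tip a) (rho a)" "w \<in> ball (tip b) (rho b)"
  shows "ext u a w = ext u b w"
  using assms(2-)
proof (induction a arbitrary: b w)
  case (Cons z a b' w)
  then obtain z' b where b': "b' = z' # b" by (cases b') (auto dest: close_length)
  note P = Cons.prems[unfolded b']
  have ad: "adm a" "adm b" and cl: "norm (z - z') < d" "close d a b" using P by auto
  have d: "d \<le> rho_min (length a) / 2" using P(4) rho_min_Suc[of "length a"] by simp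
  have ll: "length b = length a" using close_length[OF cl(2)] by simp
  have r: "d \<le> rho b / 2" using rho_min_le_rho[OF ad(2)] d ll by simp
  have r': "rho_min (Suc (length a)) \<le> rho (z' # b)" using rho_min_le_rho[of "z' # b"] P(3) ll by simp
  have z1: "z \<in> ball (tip a) (rho a)" using step_in_ball P by blast
  have "norm (z - tip b) \<le> norm (z - z') + norm (z' - tip b)" by (rule norm_diff_triangle_le) auto
  then have z2: "z \<in> ball (tip b) (rho b)"
    using cl r norm_step_lt_rho[OF P(3)] by (simp add: dist_norm norm_minus_commute)
  have z3: "z \<in> ball z' (rho (z' # b))"
    using cl r' P(4) rho_min_pos[of "Suc (length a)"] by (simp add: dist_norm norm_minus_commute)
  have "germ_eq z (ext u (z' # b)) (ext u b)"
    by (rule germ_eqI[of "ball z' (rho (z' # b)) \<inter> ball (tip b) (rho b)"])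
       (use z2 z3 ext_step_eq[OF u P(3)] in auto)
  moreover have "germ_eq z (ext u a) (ext u b)"
    by (rule germ_eqI[of "ball (tip a) (rho a) \<inter> ball (tip b) (rho b)"])
       (use z1 z2 Cons.IH[OF cl(2) ad d] in auto)
  moreover have "germ_eq z (ext u (z # a)) (ext u a)" using ext_step[OF u P(2)] .
  ultimately have "germ_eq z (ext u (z # a)) (ext u (z' # b))"
    using germ_eq_trans germ_eq_sym by meson
  from germ_eq_convex[OF this ext_holomorphic[OF u P(2)] ext_holomorphic[OF u P(3)]]
  show ?case using P(5,6) z3 tip_in_ball[OF P(2)] unfolding b' by auto
qed auto

lemma norm_le_travel: "x \<in> set c \<Longrightarrow> norm x \<le> travel c"
proof (induction c)
  case (Cons z c)
  then show ?case using norm_tip_le_travel[of "z # c"] norm_ge_zero[of "z - tip c"]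
    by (auto simp del: norm_ge_zero)
qed simp

text \<open>The points of all admissible lists of length n lie in a fixed disc. A finite net there
  sorts the lists into finitely many classes of mutually close ones; by \<open>ext_close\<close> a
  class takes its values from the branch of one representative on a compact disc.\<close>

lemma ext_bounded:
  assumes u: "u \<in> germs"
  obtains M where "M \<ge> 0" "\<And>c. adm c \<Longrightarrow> length c = n \<Longrightarrow> norm (ext u c (tip c)) \<le> M"
proof -
  define d where "d = rho_min n / 2"
  have d: "d > 0" using rho_min_pos by (simp add: d_def)
  define L where "L = (5/4) ^ n * (R/4)"
  have inL: "x \<in> cball 0 L" if "adm c" "length c = n" "x \<in> set c" for c x
  proof -
    have ne: "c \<noteq> []" using that by auto
    have "norm x \<le> (5/4) ^ length c * norm (last c)"
      using norm_le_travel[OF that(3)] travel_upper[OF that(1) ne] by linarith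
    also have "\<dots> \<le> L" unfolding L_def that(2) using norm_last_le[OF that(1) ne] by (intro mult_left_mono) auto
    finally show ?thesis by simp
  qed
  obtain X :: "complex set" where X: "finite X" "cball 0 L \<subseteq> (\<Union>x\<in>X. ball x (d/2))"
  proof (rule compactE_image[OF compact_cball[of "0 :: complex" L], of "cball 0 L" "\<lambda>x. ball x (d/2)"])
    show "cball 0 L \<subseteq> (\<Union>x\<in>cball 0 L. ball x (d/2) :: complex set)" using d by auto
  qed (use that in auto)
  define h where "h z = (SOME x. x \<in> X \<and> dist x z < d/2)" for z
  have h: "h z \<in> X \<and> dist (h z) z < d/2" if "z \<in> cball 0 L" for z
    unfolding h_def by (rule someI_ex) (use that X in \<open>auto simp: subset_iff\<close>)
  define T where "T = {l. set l \<subseteq> X \<and> length l = n}"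
  have "finite T" unfolding T_def by (rule finite_lists_length_eq[OF X(1)])
  \<comment> \<open>Net points need not form an admissible list, so a class is represented by one of
    its own members.\<close>
  define pick where "pick l = (SOME b. adm b \<and> length b = n \<and> map h b = l)" for l
  have "\<exists>B. \<forall>w\<in>cball (tip (pick l)) d. norm (ext u (pick l) w) \<le> B" if "adm (pick l)" "length (pick l) = n" for l
  proof -
    have "cball (tip (pick l)) d \<subseteq> ball (tip (pick l)) (rho (pick l))"
      using rho_min_le_rho[OF that(1)] rho_min_pos[of n] that(2) by (auto simp: d_def)
    then have "continuous_on (cball (tip (pick l)) d) (ext u (pick l))"
      using ext_holomorphic[OF u that(1)] holomorphic_on_imp_continuous_on continuous_on_subset by blast
    then have "bounded (ext u (pick l) ` cball (tip (pick l)) d)"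
      by (intro compact_imp_bounded compact_continuous_image) auto
    then show ?thesis by (auto simp: bounded_iff)
  qed
  then obtain B where B: "\<And>l w. adm (pick l) \<Longrightarrow> length (pick l) = n \<Longrightarrow> w \<in> cball (tip (pick l)) d \<Longrightarrow>
     norm (ext u (pick l) w) \<le> B l"
    by metis
  define M where "M = Max (insert 0 (B ` T))"
  show ?thesis
  proof
    show "M \<ge> 0" unfolding M_def using \<open>finite T\<close> by (intro Max_ge) auto
    fix c assume c: "adm c" "length c = n"
    define l where "l = map h c"
    have hc: "h x \<in> X \<and> dist (h x) x < d/2" if "x \<in> set c" for x
      using h inL[OF c that] by blast
    have l: "l \<in> T" unfolding T_def l_def using hc c by auto
    have pick: "adm (pick l) \<and> length (pick l) = n \<and> map h (pick l) = l"
      unfolding pick_def by (rule someI[of _ c]) (use c in \<open>auto simp: l_def\<close>)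
    have "close d c (pick l)"
      unfolding close_def list_all2_conv_all_nth
    proof (intro conjI allI impI)
      fix i assume i: "i < length c"
      then have "h (pick l ! i) = h (c ! i)" using pick c
        unfolding l_def by (metis nth_map)
      moreover have "dist (h (pick l ! i)) (pick l ! i) < d/2"
        using h[OF inL, of "pick l" "pick l ! i"] pick i c by auto
      moreover have "dist (h (c ! i)) (c ! i) < d/2" using hc i by auto
      ultimately have "dist (c ! i) (pick l ! i) < d" by (metis dist_triangle_half_r)
      then show "norm (c ! i - pick l ! i) < d" by (simp add: dist_norm)
    qed (use pick c in auto)
    note cl = this
    have t: "tip c \<in> cball (tip (pick l)) d"
      using close_tip[OF cl d] by (simp add: dist_norm norm_minus_commute)
    have "tip c \<in> ball (tip (pick l)) (rho (pick l))"
      using t rho_min_le_rho[of "pick l"] rho_min_pos[of n] pick by (simp add: d_def)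
    then have "ext u c (tip c) = ext u (pick l) (tip c)"
      using pick c tip_in_ball by (intro ext_close[OF u cl]) (auto simp: d_def)
    then have "norm (ext u c (tip c)) \<le> B l" using B pick t by auto
    also have "\<dots> \<le> M" unfolding M_def using l \<open>finite T\<close> by (intro Max_ge) auto
    finally show "norm (ext u c (tip c)) \<le> M" .
  qed
qed

text \<open>An entire coefficient can be multiplied onto the germs at every point of a path. The
  coefficients used are constants and the powers of - X that come from
  \<open>minor_dz\<close>.\<close>

lemma germs_linear:
  assumes u: "u \<in> germs" "v \<in> germs" and A: "fps_conv_radius A = \<infinity>"
  shows "A * u + v \<in> germs"
proof -
  have r: "ereal R \<le> fps_conv_radius (A * u)"
    using fps_conv_radius_mult[of A u] u A by (auto simp: germs_def intro: order_trans)
  have r2: "ereal R \<le> fps_conv_radius (A * u + v)"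
    using fps_conv_radius_add[of "A * u" v] r u by (auto simp: germs_def min_def intro: order_trans split: if_splits)
  have ev: "eval_fps (A * u + v) w = eval_fps A w * eval_fps u w + eval_fps v w" if "norm w < R" for w
  proof -
    have w: "ereal (norm w) < ereal R" using that by simp
    show ?thesis using less_le_trans[OF w r] less_le_trans[OF w] u A
      by (simp add: eval_fps_add eval_fps_mult germs_def)
  qed
  have "continuable_off \<Omega> z (eval_fps (A * u + v))" if z: "0 < norm z" "norm z < R" for z
    unfolding continuable_off_def
  proof (intro allI impI)
    fix \<gamma> assume g: "path \<gamma> \<and> path_image \<gamma> \<subseteq> - \<Omega> \<and> pathstart \<gamma> = z"
    then obtain F G where F: "continuation F \<gamma>" "germ_eq z (F 0) (eval_fps u)"
      and G: "continuation G \<gamma>" "germ_eq z (G 0) (eval_fps v)"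
      using u z unfolding germs_def continuable_off_def continuable_along_iff pathstart_def by blast
    have "eval_fps A analytic_on UNIV" using A by (intro analytic_on_eval_fps) auto
    then have Aan: "eval_fps A analytic_on {w}" for w by (rule analytic_on_subset) auto
    have "continuation (\<lambda>t w. eval_fps A w * F t w + G t w) \<gamma>"
      unfolding continuation_def
    proof (intro conjI ballI)
      fix t :: real assume t: "t \<in> {0..1}"
      show "(\<lambda>w. eval_fps A w * F t w + G t w) analytic_on {\<gamma> t}"
        using F(1) G(1) t unfolding continuation_def by (intro analytic_intros Aan) auto
      have "\<forall>\<^sub>F s in at t within {0..1}. germ_eq (\<gamma> s) (F s) (F t)" 
        "\<forall>\<^sub>F s in at t within {0..1}. germ_eq (\<gamma> s) (G s) (G t)"
        using F(1) G(1) t by (auto simp: continuation_def)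
      then show "\<forall>\<^sub>F s in at t within {0..1}. germ_eq (\<gamma> s) (\<lambda>w. eval_fps A w * F s w + G s w)
          (\<lambda>w. eval_fps A w * F t w + G t w)"
      proof eventually_elim
        case (elim s)
        then show ?case unfolding germ_eq_def by eventually_elim simp
      qed
    qed
    moreover have "germ_eq z (\<lambda>w. eval_fps A w * F 0 w + G 0 w) (eval_fps (A * u + v))"
    proof -
      have "\<forall>\<^sub>F w in nhds z. w \<in> ball 0 R" using z by (intro eventually_nhds_in_open) auto
      with F(2) G(2) show ?thesis unfolding germ_eq_def
        by eventually_elim (simp add: ev)
    qed
    ultimately show "continuable_along (eval_fps (A * u + v)) \<gamma>"
      unfolding continuable_along_iff using g by (auto simp: pathstart_def)
  qed
  then show ?thesis using r2 by (simp add: germs_def)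
qed

lemma ext_linear:
  assumes u: "u \<in> germs" "v \<in> germs" and A: "fps_conv_radius A = \<infinity>"
    and c: "adm c" "w \<in> ball (tip c) (rho c)"
  shows "ext (A * u + v) c w = eval_fps A w * ext u c w + ext v c w"
proof (rule ext_unique[OF germs_linear[OF u A], symmetric, where G = "\<lambda>c w. eval_fps A w * ext u c w + ext v c w"])
  have A': "eval_fps A holomorphic_on S" for S using A by (intro holomorphic_on_eval_fps) auto
  show "(\<lambda>w. eval_fps A w * ext u c w + ext v c w) holomorphic_on ball (tip c) (rho c)" if "adm c" for c
    using that ext_holomorphic u by (intro holomorphic_intros A') auto
  have r: "ereal R \<le> fps_conv_radius u" "ereal R \<le> fps_conv_radius v" using u by (auto simp: germs_def)
  show "germ_eq 0 (\<lambda>w. eval_fps A w * ext u [] w + ext v [] w) (eval_fps (A * u + v))"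
  proof (rule germ_eqI[of "ball 0 R"])
    fix w :: complex assume "w \<in> ball 0 R"
    then have w: "ereal (norm w) < ereal R" by simp
    then have "ereal (norm w) < fps_conv_radius (A * u)"
      using fps_conv_radius_mult[of A u] A r(1) by (simp add: less_le_trans[OF w] order_trans)
    then show "eval_fps A w * ext u [] w + ext v [] w = eval_fps (A * u + v) w"
      using less_le_trans[OF w r(1)] less_le_trans[OF w r(2)] A by (simp add: eval_fps_add eval_fps_mult)
  qed (use R_pos in auto)
  show "germ_eq z (\<lambda>w. eval_fps A w * ext u (z # c) w + ext v (z # c) w) (\<lambda>w. eval_fps A w * ext u c w + ext v c w)"
    if "adm (z # c)" for z c
    using ext_step[OF u(1) that] ext_step[OF u(2) that] unfolding germ_eq_def
    by eventually_elim simp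
qed (use c in auto)

end

section \<open>Deformation of the convolution integral\<close>

text \<open>Affine arguments cover both kinds of pieces in \<open>conv_sum\<close>: fixed segments,
  where z enters only the second factor, and the last segment, where it moves the end point.\<close>

lemma integral_product_holomorphic:
  fixes \<alpha> \<beta> \<gamma> \<delta> :: "real \<Rightarrow> complex"
  assumes f: "f holomorphic_on S" "open S" and g: "g holomorphic_on T" "open T" and U: "convex U" "open U"
    and cont: "continuous_on {0..1} \<alpha>" "continuous_on {0..1} \<beta>" "continuous_on {0..1} \<gamma>" "continuous_on {0..1} \<delta>"
    and inS: "\<And>z t. z \<in> U \<Longrightarrow> t \<in> {0..1} \<Longrightarrow> \<alpha> t + \<beta> t * z \<in> S"
    and inT: "\<And>z t. z \<in> U \<Longrightarrow> t \<in> {0..1} \<Longrightarrow> \<gamma> t + \<delta> t * z \<in> T"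
  shows "(\<lambda>z. integral {0..1} (\<lambda>t. f (\<alpha> t + \<beta> t * z) * g (\<gamma> t + \<delta> t * z))) holomorphic_on U"
proof -
  have cf: "continuous_on S f" "continuous_on S (deriv f)" "continuous_on T g" "continuous_on T (deriv g)"
    using f g by (auto intro: holomorphic_on_imp_continuous_on holomorphic_deriv)
  have "(\<lambda>z. integral (cbox 0 1) (\<lambda>t. f (\<alpha> t + \<beta> t * z) * g (\<gamma> t + \<delta> t * z))) holomorphic_on U"
  proof (rule leibniz_rule_holomorphic[where fx = "\<lambda>z t. deriv f (\<alpha> t + \<beta> t * z) * \<beta> t * g (\<gamma> t + \<delta> t * z) +
        f (\<alpha> t + \<beta> t * z) * (deriv g (\<gamma> t + \<delta> t * z) * \<delta> t)"])
    fix z and t :: real assume z: "z \<in> U" and t: "t \<in> cbox 0 1"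
    have lin: "((\<lambda>z. a + b * z) has_field_derivative b) (at z)" for a b :: complex
      by (auto intro!: derivative_eq_intros)
    have *: "\<alpha> t + \<beta> t * z \<in> S" "\<gamma> t + \<delta> t * z \<in> T" using inS inT z t by auto
    have "(f has_field_derivative deriv f (\<alpha> t + \<beta> t * z)) (at (\<alpha> t + \<beta> t * z))"
      "(g has_field_derivative deriv g (\<gamma> t + \<delta> t * z)) (at (\<gamma> t + \<delta> t * z))"
      using * f g by (auto intro!: holomorphic_derivI)
    from DERIV_chain2[where f = f and g = "\<lambda>z. \<alpha> t + \<beta> t * z" and x = z and s = UNIV, OF this(1) lin]
      DERIV_chain2[where f = g and g = "\<lambda>z. \<gamma> t + \<delta> t * z" and x = z and s = UNIV, OF this(2) lin]
    have "((\<lambda>z. f (\<alpha> t + \<beta> t * z)) has_field_derivative deriv f (\<alpha> t + \<beta> t * z) * \<beta> t) (at z)"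
      "((\<lambda>z. g (\<gamma> t + \<delta> t * z)) has_field_derivative deriv g (\<gamma> t + \<delta> t * z) * \<delta> t) (at z)"
      by auto
    from DERIV_mult[OF this] show "((\<lambda>z. f (\<alpha> t + \<beta> t * z) * g (\<gamma> t + \<delta> t * z)) has_field_derivative
       deriv f (\<alpha> t + \<beta> t * z) * \<beta> t * g (\<gamma> t + \<delta> t * z) +
        f (\<alpha> t + \<beta> t * z) * (deriv g (\<gamma> t + \<delta> t * z) * \<delta> t)) (at z within U)"
      by (simp add: add.commute mult.commute has_field_derivative_at_within)
  next
    fix z assume z: "z \<in> U"
    show "(\<lambda>t. f (\<alpha> t + \<beta> t * z) * g (\<gamma> t + \<delta> t * z)) integrable_on cbox 0 1"
      unfolding cbox_interval using z inS inT
      by (intro integrable_continuous_interval continuous_intros cont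
          continuous_on_compose2[OF cf(1)] continuous_on_compose2[OF cf(3)]) auto
  next
    have c: "continuous_on (U \<times> cbox 0 1) (\<lambda>x. h (snd x))" if "continuous_on {0..1} h" for h :: "real \<Rightarrow> complex"
      by (rule continuous_on_compose2[OF that continuous_on_snd[OF continuous_on_id]]) auto
    show "continuous_on (U \<times> cbox 0 1) (\<lambda>(z, t). deriv f (\<alpha> t + \<beta> t * z) * \<beta> t * g (\<gamma> t + \<delta> t * z) +
        f (\<alpha> t + \<beta> t * z) * (deriv g (\<gamma> t + \<delta> t * z) * \<delta> t))"
      unfolding case_prod_beta
      by (intro continuous_intros c cont continuous_on_compose2[OF cf(1)] continuous_on_compose2[OF cf(2)]
          continuous_on_compose2[OF cf(3)] continuous_on_compose2[OF cf(4)])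
         (use inS inT in auto)
  qed (use U in auto)
  then show ?thesis by (simp add: cbox_interval)
qed

text \<open>With a primitive, Cauchy's theorem for polygons becomes a cancellation of end point
  values.\<close>

lemma convex_contour_integral_primitive:
  assumes "q holomorphic_on S" "open S" "convex S"
  obtains P where "\<And>a b. a \<in> S \<Longrightarrow> b \<in> S \<Longrightarrow> contour_integral (linepath a b) q = P b - P a"
proof -
  obtain P where P: "\<And>x. x \<in> S \<Longrightarrow> (P has_field_derivative q x) (at x within S)"
    using holomorphic_convex_primitive'[OF assms(3,2,1)] by blast
  have "contour_integral (linepath a b) q = P b - P a" if "a \<in> S" "b \<in> S" for a b
    using contour_integral_primitive[OF P valid_path_linepath, of a b] that assms(3)
    by (intro contour_integral_unique) (simp add: closed_segment_subset)
  then show ?thesis by (rule that)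
qed

text \<open>The factors \<open>f j\<close> and \<open>g j\<close> are branches valid near \<open>p j\<close> and \<open>p J - p j\<close>. The last
  integral prolongs the contour to \<open>z\<close>, so that the sum is a germ at \<open>p J\<close>.\<close>

definition conv_sum :: "nat \<Rightarrow> (nat \<Rightarrow> complex) \<Rightarrow> (nat \<Rightarrow> complex \<Rightarrow> complex) \<Rightarrow> (nat \<Rightarrow> complex \<Rightarrow> complex)
    \<Rightarrow> complex \<Rightarrow> complex" where
  "conv_sum J p f g z = (\<Sum>j<J. contour_integral (linepath (p j) (p (Suc j))) (\<lambda>x. f j x * g j (z - x))) +
     contour_integral (linepath (p J) z) (\<lambda>x. f J x * g J (z - x))"

lemma norm_triangle3: "norm (a + b + c) \<le> norm a + norm b + norm (c :: complex)"
  by (metis norm_triangle_ineq norm_triangle_le add_mono order_refl)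

text \<open>The nodes end at possibly different points w and w', but both sums are evaluated at the
  same z, to which their last segments lead. With a common start, the prolonged contours have the
  same end points.\<close>

lemma conv_sum_homotopy:
  fixes p p' :: "nat \<Rightarrow> complex"
  assumes e: "e > 0"
    and hf: "\<And>j. j \<le> J \<Longrightarrow> f j holomorphic_on ball (p j) (10*e)"
    and hg: "\<And>j. j \<le> J \<Longrightarrow> g j holomorphic_on ball (w - p j) (10*e)"
    and step: "\<And>j. j < J \<Longrightarrow> norm (p (Suc j) - p j) < e" "\<And>j. j < J \<Longrightarrow> norm (p' (Suc j) - p' j) < e"
    and near: "\<And>j. j \<le> J \<Longrightarrow> norm (p' j - p j) < e" "norm (w' - w) < e"
    and ff: "\<And>j x. j < J \<Longrightarrow> x \<in> ball (p j) (10*e) \<Longrightarrow> x \<in> ball (p (Suc j)) (10*e) \<Longrightarrow> f j x = f (Suc j) x"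
    and gg: "\<And>j x. j < J \<Longrightarrow> x \<in> ball (w - p j) (10*e) \<Longrightarrow> x \<in> ball (w - p (Suc j)) (10*e) \<Longrightarrow> g j x = g (Suc j) x"
    and ff': "\<And>j x. j \<le> J \<Longrightarrow> x \<in> ball (p j) (10*e) \<Longrightarrow> x \<in> ball (p' j) (10*e) \<Longrightarrow> f j x = f' j x"
    and gg': "\<And>j x. j \<le> J \<Longrightarrow> x \<in> ball (w - p j) (10*e) \<Longrightarrow> x \<in> ball (w' - p' j) (10*e) \<Longrightarrow> g j x = g' j x"
    and ends: "p 0 = p' 0" "p J = w" "p' J = w'" and z: "norm (z - w) < e"
  shows "conv_sum J p f g z = conv_sum J p' f' g' z"
proof -
  define q where "q j x = f j x * g j (z - x)" for j x
  define q' where "q' j x = f' j x * g' j (z - x)" for j x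
  \<comment> \<open>The radius 10 e leaves room: for x in \<open>S j\<close> the point z - x is
    within 6 e of \<open>w - p j\<close>; passing to the next node costs e, to the other contour 2
    e.\<close>
  define S where "S j = ball (p j) (5*e)" for j
  have T1: "norm ((w - p j) - (z - x)) < 6*e" if "x \<in> S j" for x j
    using that z norm_triangle_ineq[of "w - z" "x - p j"]
    by (simp add: S_def dist_norm norm_minus_commute algebra_simps)
  have xS: "x \<in> ball (p j) (10*e)" "z - x \<in> ball (w - p j) (10*e)" if "x \<in> S j" for x j
    using that T1[OF that] e by (auto simp: S_def dist_norm)
  have xS1: "x \<in> ball (p (Suc j)) (10*e)" "z - x \<in> ball (w - p (Suc j)) (10*e)" if "x \<in> S j" "j < J" for x j
  proof -
    have "norm (p (Suc j) - x) \<le> norm (p (Suc j) - p j) + norm (p j - x)" by (rule norm_diff_triangle_le) auto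
    then show "x \<in> ball (p (Suc j)) (10*e)" using that step(1)[OF that(2)] e by (auto simp: S_def dist_norm)
    have "norm ((w - p (Suc j)) - (z - x)) \<le> norm (p j - p (Suc j)) + norm ((w - p j) - (z - x))"
      using norm_triangle_ineq[of "p j - p (Suc j)" "(w - p j) - (z - x)"] by (simp add: algebra_simps)
    then show "z - x \<in> ball (w - p (Suc j)) (10*e)"
      using T1[OF that(1)] step(1)[OF that(2)] e by (simp add: dist_norm norm_minus_commute)
  qed
  have xS': "x \<in> ball (p' j) (10*e)" "z - x \<in> ball (w' - p' j) (10*e)" if "x \<in> S j" "j \<le> J" for x j
  proof -
    have "norm (p' j - x) \<le> norm (p' j - p j) + norm (p j - x)" by (rule norm_diff_triangle_le) auto
    then show "x \<in> ball (p' j) (10*e)" using that near(1)[OF that(2)] e by (auto simp: S_def dist_norm)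
    have "norm ((w' - p' j) - (z - x)) \<le> norm (p j - p' j) + norm (w' - w) + norm ((w - p j) - (z - x))"
      using norm_triangle3[of "p j - p' j" "w' - w" "(w - p j) - (z - x)"] by (simp add: algebra_simps)
    then show "z - x \<in> ball (w' - p' j) (10*e)"
      using T1[OF that(1)] near(1)[OF that(2)] near(2) e by (simp add: dist_norm norm_minus_commute)
  qed
  have qhol: "q j holomorphic_on S j" if "j \<le> J" for j
  proof -
    have "(\<lambda>x. g j (z - x)) holomorphic_on S j"
      by (rule holomorphic_on_compose_gen[OF _ hg[OF that], unfolded o_def])
         (use xS(2) in \<open>auto intro!: holomorphic_intros\<close>)
    moreover have "f j holomorphic_on S j"
      by (rule holomorphic_on_subset[OF hf[OF that]]) (use xS(1) in auto)
    ultimately show ?thesis unfolding q_def by (intro holomorphic_intros)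
  qed
  have qq: "q j x = q (Suc j) x" if "x \<in> S j" "j < J" for x j
    unfolding q_def using that xS[OF that(1)] xS1[OF that] by (simp add: ff gg)
  have qq': "q j x = q' j x" if "x \<in> S j" "j \<le> J" for x j
    unfolding q_def q'_def using that xS[OF that(1)] xS'[OF that] by (simp add: ff' gg')
  have inS: "p j \<in> S j" for j using e by (auto simp: S_def)
  have inS1: "p (Suc j) \<in> S j" if "j < J" for j
    using step(1)[OF that] e by (auto simp: S_def dist_norm norm_minus_commute)
  have inS': "p' j \<in> S j" if "j \<le> J" for j
    using near(1)[OF that] e by (auto simp: S_def dist_norm norm_minus_commute)
  have inS1': "p' (Suc j) \<in> S j" if "j < J" for j
  proof -
    have "norm (p' (Suc j) - p j) \<le> norm (p' (Suc j) - p' j) + norm (p' j - p j)" by (rule norm_diff_triangle_le) auto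
    then show ?thesis using step(2)[OF that] near(1)[of j] that e by (auto simp: S_def dist_norm norm_minus_commute)
  qed
  have cvx: "closed_segment a b \<subseteq> S j" if "a \<in> S j" "b \<in> S j" for a b j
    using that by (simp add: S_def closed_segment_subset)
  have eq': "contour_integral (linepath a b) (q' j) = contour_integral (linepath a b) (q j)"
    if "a \<in> S j" "b \<in> S j" "j \<le> J" for a b j
    using cvx[OF that(1,2)] qq' that by (intro contour_integral_eq) (auto simp: subset_iff)
  have rearrange: "s + a + x' = s' + a'" if "a + x' = x + a'" "s + x = s'" for a a' x x' s s' :: complex
    using that by (metis add.assoc)
  \<comment> \<open>Cauchy's theorem on the quadrilateral \<open>p j\<close>, \<open>p (Suc j)\<close>, \<open>p' (Suc j)\<close>, \<open>p' j\<close>; the transversal sides telescope\<close>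
  define X where "X j = contour_integral (linepath (p j) (p' j)) (q j)" for j
  have tel: "(\<Sum>j<k. contour_integral (linepath (p j) (p (Suc j))) (q j)) + X k =
     (\<Sum>j<k. contour_integral (linepath (p' j) (p' (Suc j))) (q' j))" if "k \<le> J" for k
    using that
  proof (induction k)
    case 0
    then show ?case using ends by (simp add: X_def)
  next
    case (Suc k)
    then have k: "k < J" "k \<le> J" by auto
    obtain P where P: "\<And>a b. a \<in> S k \<Longrightarrow> b \<in> S k \<Longrightarrow> contour_integral (linepath a b) (q k) = P b - P a"
      using convex_contour_integral_primitive[OF qhol[OF k(2)]] by (auto simp: S_def)
    have "X (Suc k) = contour_integral (linepath (p (Suc k)) (p' (Suc k))) (q k)"
      unfolding X_def using cvx[OF inS1[OF k(1)] inS1'[OF k(1)]] qq k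
      by (intro contour_integral_eq) (auto simp: subset_iff)
    then have "contour_integral (linepath (p k) (p (Suc k))) (q k) + X (Suc k) =
       X k + contour_integral (linepath (p' k) (p' (Suc k))) (q' k)"
      using k by (simp add: eq' X_def P inS inS1 inS' inS1')
    then show ?case using Suc.IH[OF k(2)] unfolding sum.lessThan_Suc by (rule rearrange)
  qed
  obtain P where P: "\<And>a b. a \<in> S J \<Longrightarrow> b \<in> S J \<Longrightarrow> contour_integral (linepath a b) (q J) = P b - P a"
    using convex_contour_integral_primitive[OF qhol[OF order_refl]] by (auto simp: S_def)
  have zS: "z \<in> S J" using z ends e by (auto simp: S_def dist_norm norm_minus_commute)
  have "contour_integral (linepath (p J) z) (q J) = X J + contour_integral (linepath (p' J) z) (q' J)"
    by (simp add: eq' inS' zS X_def P inS)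
  then show ?thesis using tel[OF order_refl] unfolding conv_sum_def q_def[symmetric] q'_def[symmetric] by simp
qed

lemma conv_sum_holomorphic:
  fixes p :: "nat \<Rightarrow> complex"
  assumes e: "e > 0"
    and hf: "\<And>j. j \<le> J \<Longrightarrow> f j holomorphic_on ball (p j) (10*e)"
    and hg: "\<And>j. j \<le> J \<Longrightarrow> g j holomorphic_on ball (w - p j) (10*e)"
    and step: "\<And>j. j < J \<Longrightarrow> norm (p (Suc j) - p j) < e"
    and ends: "p J = w"
  shows "conv_sum J p f g holomorphic_on ball w e"
proof -
  have integral: "contour_integral (linepath a b) h = integral {0..1} (\<lambda>t. h (linepath a b t)) * (b - a)" for a b h
    by (simp add: contour_integral_integral)
  have "(\<lambda>z. integral {0..1} (\<lambda>t. f j (linepath (p j) (p (Suc j)) t + 0 * z) *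
      g j (- linepath (p j) (p (Suc j)) t + 1 * z))) holomorphic_on ball w e" if j: "j < J" for j
  proof (rule integral_product_holomorphic[OF hf open_ball hg open_ball])
    fix z and t :: real assume z: "z \<in> ball w e" and t: "t \<in> {0..1}"
    have "linepath (p j) (p (Suc j)) t - p j = of_real t * (p (Suc j) - p j)"
      by (simp add: linepath_def scaleR_conv_of_real algebra_simps)
    then have "norm (linepath (p j) (p (Suc j)) t - p j) = t * norm (p (Suc j) - p j)"
      using t by (simp add: norm_mult)
    also have "\<dots> \<le> 1 * e" using t step[OF j] by (intro mult_mono) auto
    finally have l: "norm (linepath (p j) (p (Suc j)) t - p j) \<le> e" by simp
    show "linepath (p j) (p (Suc j)) t + 0 * z \<in> ball (p j) (10*e)" 
      using l e by (simp add: dist_norm norm_minus_commute)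
    show "- linepath (p j) (p (Suc j)) t + 1 * z \<in> ball (w - p j) (10*e)"
      using l e z norm_triangle_ineq[of "linepath (p j) (p (Suc j)) t - p j" "w - z"]
      by (simp add: dist_norm norm_minus_commute algebra_simps)
  qed (use j in \<open>auto intro!: continuous_intros\<close>)
  then have 1: "(\<lambda>z. contour_integral (linepath (p j) (p (Suc j))) (\<lambda>x. f j x * g j (z - x))) holomorphic_on ball w e"
    if "j < J" for j
    using that by (auto simp: integral intro!: holomorphic_intros)
  have "(\<lambda>z. integral {0..1} (\<lambda>t. f J (of_real (1 - t) * w + of_real t * z) *
      g J (- of_real (1 - t) * w + of_real (1 - t) * z))) holomorphic_on ball w e"
  proof (rule integral_product_holomorphic[OF hf open_ball hg open_ball])
    fix z and t :: real assume z: "z \<in> ball w e" and t: "t \<in> {0..1}"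
    have n: "norm (z - w) < e" using z by (simp add: dist_norm norm_minus_commute)
    have "of_real (1 - t) * w + of_real t * z - w = of_real t * (z - w)" by (simp add: algebra_simps)
    then have "norm (of_real (1 - t) * w + of_real t * z - w) = t * norm (z - w)" using t by (simp add: norm_mult)
    also have "\<dots> \<le> 1 * e" using t n by (intro mult_mono) auto
    finally show "of_real (1 - t) * w + of_real t * z \<in> ball (p J) (10*e)"
      using e ends by (simp add: dist_norm norm_minus_commute)
    have "- of_real (1 - t) * w + of_real (1 - t) * z = of_real (1 - t) * (z - w)" by (simp add: algebra_simps)
    then have "norm (- of_real (1 - t) * w + of_real (1 - t) * z) = (1 - t) * norm (z - w)"
      using t by (simp add: norm_mult del: of_real_diff)
    also have "\<dots> \<le> 1 * e" using t n by (intro mult_mono) auto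
    finally have "norm (- of_real (1 - t) * w + of_real (1 - t) * z) < 10 * e" using e by linarith
    then show "- of_real (1 - t) * w + of_real (1 - t) * z \<in> ball (w - p J) (10*e)"
      unfolding ends by (simp only: diff_self mem_ball_0)
  qed (auto intro!: continuous_intros)
  moreover have "contour_integral (linepath (p J) z) (\<lambda>x. f J x * g J (z - x)) =
    integral {0..1} (\<lambda>t. f J (of_real (1 - t) * w + of_real t * z) *
      g J (- of_real (1 - t) * w + of_real (1 - t) * z)) * (z - w)" for z
    unfolding integral ends
    by (intro arg_cong2[where f = times] integral_cong) (simp_all add: linepath_def scaleR_conv_of_real algebra_simps)
  ultimately have 2: "(\<lambda>z. contour_integral (linepath (p J) z) (\<lambda>x. f J x * g J (z - x))) holomorphic_on ball w e"
    by (simp only:) (intro holomorphic_intros)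
  show ?thesis unfolding conv_sum_def[abs_def] using 1 2 by (intro holomorphic_intros) auto
qed

section \<open>From local families on chains to continuation along paths\<close>

context additive_singularities
begin

text \<open>The part \<open>split c 0\<close> of a chain never leaves \<open>0\<close>, which may lie in \<open>\<Omega>\<close>; such lists are
  admissible but are not paths in the complement of \<open>\<Omega>\<close>.\<close>

definition chain :: "complex list \<Rightarrow> bool" where
  "chain c \<longleftrightarrow> adm c \<and> c \<noteq> [] \<and> last c \<noteq> 0"

lemma chain_Cons: "c \<noteq> [] \<Longrightarrow> chain (z # c) \<longleftrightarrow> chain c \<and> norm (z - tip c) \<le> eta c / 4"
  by (auto simp: chain_def)

lemma chain_single: "chain [z] \<longleftrightarrow> z \<noteq> 0 \<and> norm z \<le> R/4"
  by (auto simp: chain_def)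

lemma chain_tip: "chain c \<Longrightarrow> chain (tip c # c)"
  by (auto simp: chain_def eta_nonneg)

text \<open>Germs that are locally constant along chains with at most \<open>N\<close> points, starting with the germ
  of \<open>f\<close>. Bounding \<open>N\<close> allows the mesh of the contour to be fixed in advance.\<close>

definition local_family :: "nat \<Rightarrow> real \<Rightarrow> (complex \<Rightarrow> complex) \<Rightarrow> (complex list \<Rightarrow> complex \<Rightarrow> complex) \<Rightarrow> bool" where
  "local_family N r f I \<longleftrightarrow>
     (\<forall>c. chain c \<and> length c \<le> N \<longrightarrow> I c analytic_on {tip c}) \<and>
     (\<forall>z. chain [z] \<and> norm z < r \<longrightarrow> germ_eq z (I [z]) f) \<and>
     (\<forall>c. chain c \<and> length c < N \<longrightarrow> germ_eq (tip c) (I (tip c # c)) (I c)) \<and>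
     (\<forall>z c. c \<noteq> [] \<and> chain (z # c) \<and> length c < N \<longrightarrow>
       (\<exists>k>0. \<forall>z'. norm (z' - z) < k \<and> chain (z' # c) \<longrightarrow> germ_eq z' (I (z' # c)) (I (z # c))))"

text \<open>Moving the newest point back along its step gives shorter, hence admissible, steps. So
  the last clause of \<open>local_family\<close> turns into continuation along the segment.\<close>

lemma local_family_segment:
  assumes I: "local_family N r f I" and c: "chain (z # c)" "c \<noteq> []" "length c < N"
  shows "continuation (\<lambda>t. I (linepath (tip c) z t # c)) (linepath (tip c) z)"
    and "t \<in> {0..1} \<Longrightarrow> chain (linepath (tip c) z t # c)"
proof -
  have ch: "chain (linepath (tip c) z t # c)" if "t \<in> {0..1}" for t
  proof -
    have "linepath (tip c) z t - tip c = of_real t * (z - tip c)"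
      by (simp add: linepath_def scaleR_conv_of_real algebra_simps)
    then have "norm (linepath (tip c) z t - tip c) = t * norm (z - tip c)"
      using that by (simp add: norm_mult)
    also have "\<dots> \<le> 1 * (eta c / 4)" using c that by (intro mult_mono) (auto simp: chain_Cons)
    finally show ?thesis using c by (simp add: chain_Cons)
  qed
  then show "t \<in> {0..1} \<Longrightarrow> chain (linepath (tip c) z t # c)" .
  show "continuation (\<lambda>t. I (linepath (tip c) z t # c)) (linepath (tip c) z)"
    unfolding continuation_def
  proof (intro conjI ballI)
    fix t :: real assume t: "t \<in> {0..1}"
    show "I (linepath (tip c) z t # c) analytic_on {linepath (tip c) z t}"
      using I ch[OF t] c(3) unfolding local_family_def by (metis Suc_leI length_Cons tip.simps(2))
    obtain k where k: "k > 0" "\<And>z'. norm (z' - linepath (tip c) z t) < k \<Longrightarrow> chain (z' # c) \<Longrightarrow>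
       germ_eq z' (I (z' # c)) (I (linepath (tip c) z t # c))"
      using I ch[OF t] c(2,3) unfolding local_family_def by meson
    have "((linepath (tip c) z) \<longlongrightarrow> linepath (tip c) z t) (at t within {0..1})"
      using t continuous_on_linepath[of "{0..1}" "tip c" z] by (simp add: continuous_on_def)
    then have "\<forall>\<^sub>F s in at t within {0..1}. dist (linepath (tip c) z s) (linepath (tip c) z t) < k"
      using k(1) by (rule tendstoD)
    moreover have "\<forall>\<^sub>F s in at t within {0..1}. s \<in> {0..1}" by (simp add: eventually_at_filter)
    ultimately show "\<forall>\<^sub>F s in at t within {0..1}. germ_eq (linepath (tip c) z s)
        (I (linepath (tip c) z s # c)) (I (linepath (tip c) z t # c))"
      by eventually_elim (use k(2) ch in \<open>auto simp: dist_norm\<close>)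
  qed
qed

text \<open>This is how \<open>ext\<close> of a convolution gets computed. The condition on r covers
  all first points, whose norm is at most R/4.\<close>

lemma ext_eq_local_family:
  assumes u: "u \<in> germs" and I: "local_family N r (eval_fps u) I" and r: "r > R/4"
    and c: "chain c" "length c \<le> N"
  shows "germ_eq (tip c) (ext u c) (I c)"
  using c
proof (induction c)
  case Nil
  then show ?case by (simp add: chain_def)
next
  case (Cons z c)
  show ?case
  proof (cases "c = []")
    case True
    then have z: "z \<noteq> 0" "norm z \<le> R/4" using Cons.prems by (auto simp: chain_single)
    then have "ext u [z] = eval_fps u" using R_pos by (simp add: ext_near)
    moreover have "chain [z] \<and> norm z < r" using z r by (auto simp: chain_single)
    then have "germ_eq z (I [z]) (eval_fps u)" using I unfolding local_family_def by blast
    ultimately show ?thesis using True germ_eq_sym by simp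
  next
    case False
    note seg = local_family_segment[OF I Cons.prems(1) False]
    have c: "chain c" "length c \<le> N" "length c < N" using Cons.prems False by (auto simp: chain_Cons)
    have ad: "adm (z # c)" "adm c" using Cons.prems(1) by (auto simp: chain_def)
    let ?l = "linepath (tip c) z"
    have "germ_eq (?l 0) (I (?l 0 # c)) (ext u c)"
      using Cons.IH[OF c(1,2)] I c germ_eq_trans germ_eq_sym
      unfolding local_family_def linepath_0' by meson
    then have "germ_eq (?l 1) (I (?l 1 # c)) (ext u c)"
      using continuation_const[OF seg(1)[OF c(3)] path_linepath ext_holomorphic[OF u ad(2)] open_ball, of 0 1]
        closed_segment_subset[OF tip_in_ball[OF ad(2)] step_in_ball[OF ad(1)] convex_ball]
      by (simp add: linepath_image_01)
    then show ?thesis using ext_step[OF u ad(1)] germ_eq_sym germ_eq_trans by (metis linepath_1' tip.simps(2))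
  qed
qed

text \<open>Subdivide the path so finely that its nodes form a chain, and let a moving point prolong
  the chain of the nodes already passed.\<close>

lemma continuable_off_local_families:
  assumes I: "\<And>N. \<exists>I. local_family N r f I" and z: "0 < norm z" "norm z < r" and r: "r \<le> R/4"
  shows "continuable_off \<Omega> z f"
  unfolding continuable_off_def
proof (intro allI impI)
  fix \<gamma> assume g: "path \<gamma> \<and> path_image \<gamma> \<subseteq> - \<Omega> \<and> pathstart \<gamma> = z"
  then have cont: "continuous_on {0..1} \<gamma>" and \<gamma>0: "\<gamma> 0 = z" by (auto simp: path_def pathstart_def)
  have "compact (path_image \<gamma>)" "path_image \<gamma> \<noteq> {}" using g by auto
  moreover have "path_image \<gamma> \<inter> \<Omega> = {}" using g by auto
  ultimately obtain d where d: "d > 0" "\<And>x y. x \<in> path_image \<gamma> \<Longrightarrow> y \<in> \<Omega> \<Longrightarrow> d \<le> dist x y"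
    using separate_compact_closed closed by metis
  have Dd: "d \<le> D (\<gamma> t)" if "t \<in> {0..1}" for t
  proof -
    have "\<gamma> t \<in> path_image \<gamma>" using that by (auto simp: path_image_def)
    then show ?thesis using infdist_attains_inf[OF closed nonempty, of "\<gamma> t"] d(2) by metis
  qed
  \<comment> \<open>This bounds \<open>eta\<close> from below at all nodes: \<open>D\<close> is at
    least d on the path, and a chain starting at z has travelled at least
    \<open>norm z\<close>.\<close>
  define e where "e = min d (norm z)"
  have e: "e > 0" "e \<le> d" "e \<le> norm z" using d z by (auto simp: e_def)
  obtain k where k: "k > 0" "\<And>s t. s \<in> {0..1} \<Longrightarrow> t \<in> {0..1} \<Longrightarrow> \<bar>s - t\<bar> < k \<Longrightarrow> norm (\<gamma> s - \<gamma> t) < e/4"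
    using compact_uniformly_continuous[OF cont] e(1) unfolding uniformly_continuous_on_def dist_norm real_norm_def
    by (metis compact_Icc divide_pos_pos zero_less_numeral)
  obtain n :: nat where n: "1/k < real n" using reals_Archimedean2 by blast
  then have n0: "n > 0" using k by (metis divide_pos_pos less_trans of_nat_0_less_iff zero_less_one)
  have nk: "1 / real n < k" using n n0 k by (simp add: field_simps)
  define C where "C i = rec_nat [\<gamma> 0] (\<lambda>i c. \<gamma> (real (Suc i) / real n) # c) i" for i
  have C0: "C 0 = [\<gamma> 0]" and CS: "C (Suc i) = \<gamma> (real (Suc i) / real n) # C i" for i
    by (auto simp: C_def)
  have len: "length (C i) = Suc i" for i by (induction i) (auto simp: C0 CS)
  have ne: "C i \<noteq> []" for i using len[of i] by auto
  have lst: "last (C i) = z" for i using ne by (induction i) (auto simp: C0 CS \<gamma>0)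
  have tipC: "tip (C i) = \<gamma> (real i / real n)" for i by (cases i) (auto simp: C0 CS)
  have in01: "real i / real n \<in> {0..1}" if "i \<le> n" for i using that n0 by (auto simp: divide_simps)
  have etaC: "e \<le> eta (C i)" if "i \<le> n" for i
    using norm_last_le_travel[OF ne, of i] Dd[OF in01[OF that]] e by (simp add: eta_def tipC lst)
  have chain_next: "chain (\<gamma> t # C i)" if "chain (C i)" "i \<le> n" "t \<in> {0..1}" "\<bar>t - real i / real n\<bar> \<le> 1 / real n" for t i
  proof -
    have "norm (\<gamma> t - tip (C i)) < e / 4" unfolding tipC using that in01 nk by (intro k(2)) auto
    then show ?thesis using etaC[OF that(2)] that(1) ne by (simp add: chain_Cons)
  qed
  have chC: "chain (C i)" if "i \<le> n" for i
    using that
  proof (induction i)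
    case 0
    then show ?case using z r by (auto simp: C0 \<gamma>0 chain_single)
  next
    case (Suc i)
    then show ?case unfolding CS by (intro chain_next in01) (auto simp: diff_divide_distrib[symmetric])
  qed
  \<comment> \<open>A chain of nodes has at most n + 1 points, and the moving point is one
    more.\<close>
  obtain I where I: "local_family (n + 2) r f I" using I by blast
  have an: "I c analytic_on {tip c}" if "chain c" "length c \<le> n + 2" for c using I that unfolding local_family_def by blast
  have rep: "germ_eq (tip c) (I (tip c # c)) (I c)" if "chain c" "length c < n + 2" for c using I that unfolding local_family_def by blast
  define fl where "fl t = nat \<lfloor>real n * t\<rfloor>" for t :: real
  have fl: "fl t \<le> n" "real (fl t) \<le> real n * t" "real n * t < real (fl t) + 1" if "t \<in> {0..1}" for t
  proof -
    have "0 \<le> real n * t" "real n * t \<le> real n * 1" using that by (auto intro!: mult_left_mono simp del: mult_1_right)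
    then show "fl t \<le> n" "real (fl t) \<le> real n * t" "real n * t < real (fl t) + 1"
      unfolding fl_def by linarith+
  qed
  have flI: "fl t = i" if "real i \<le> real n * t" "real n * t < real i + 1" for i t
    using that unfolding fl_def by linarith
  have fldist: "\<bar>t - real (fl t) / real n\<bar> \<le> 1 / real n" if "t \<in> {0..1}" for t
  proof -
    have "t - real (fl t) / real n = (real n * t - real (fl t)) / real n"
      using n0 by (simp add: diff_divide_distrib)
    then show ?thesis using fl[OF that] n0 by (simp add: divide_right_mono)
  qed
  define F where "F t = I (\<gamma> t # C (fl t))" for t
  have chF: "chain (\<gamma> t # C (fl t))" if "t \<in> {0..1}" for t
    using that fl(1) chC by (intro chain_next fldist) auto
  have tend: "\<forall>\<^sub>F s in at t within {0..1}. norm (\<gamma> s - \<gamma> t) < k'" if "t \<in> {0..1}" "k' > 0" for t k'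
    using cont that unfolding continuous_on_def by (auto dest!: tendstoD simp: dist_norm)
  have loc: "\<forall>\<^sub>F s in at t within {0..1}. chain (\<gamma> s # C i) \<longrightarrow> germ_eq (\<gamma> s) (I (\<gamma> s # C i)) (I (\<gamma> t # C i))"
    if h: "t \<in> {0..1}" "chain (\<gamma> t # C i)" "i \<le> n" for t i
  proof -
    have "length (C i) < n + 2" using h by (simp add: len)
    then obtain k' where "k' > 0" "\<And>z'. norm (z' - \<gamma> t) < k' \<Longrightarrow> chain (z' # C i) \<Longrightarrow> germ_eq z' (I (z' # C i)) (I (\<gamma> t # C i))"
      using I h(2) ne unfolding local_family_def by meson
    then show ?thesis using tend[OF h(1), of k'] by (auto elim: eventually_mono)
  qed
  have "continuation F \<gamma>" unfolding continuation_def
  proof (intro conjI ballI)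
    fix t :: real assume t: "t \<in> {0..1}"
    show "F t analytic_on {\<gamma> t}"
      unfolding F_def using an[OF chF[OF t]] fl(1)[OF t] by (simp add: len)
    have ev01: "\<forall>\<^sub>F s in at t within {0..1}. s \<in> {0..1}" by (simp add: eventually_at_filter)
    note L1 = loc[OF t chF[OF t] fl(1)[OF t]]
    show "\<forall>\<^sub>F s in at t within {0..1}. germ_eq (\<gamma> s) (F s) (F t)"
    \<comment> \<open>Away from the nodes the chain behind the moving point is locally constant. At
      a node, earlier times still use the previous chain, and the clause of
      \<open>local_family\<close> on repeated points joins the two; t = 0 has no earlier
      times.\<close>
    proof (cases "real (fl t) = real n * t \<and> fl t > 0")
      case False
      have "\<forall>\<^sub>F s in at t within {0..1}. fl s = fl t"
      proof -
        have "\<forall>\<^sub>F s in at t within {0..1}. real n * s < real (fl t) + 1"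
          using fl(3)[OF t] by (intro order_tendstoD(2)) (auto intro!: tendsto_intros)
        moreover have "\<forall>\<^sub>F s in at t within {0..1}. real (fl t) \<le> real n * s"
        proof (cases "fl t = 0")
          case True
          then show ?thesis using ev01 by (auto elim: eventually_mono)
        next
          case F': False
          then have "real (fl t) < real n * t" using False fl(2)[OF t] by auto
          then have "\<forall>\<^sub>F s in at t within {0..1}. real (fl t) < real n * s"
            by (intro order_tendstoD(1)) (auto intro!: tendsto_intros)
          then show ?thesis by (auto elim: eventually_mono)
        qed
        ultimately show ?thesis by eventually_elim (rule flI)
      qed
      with L1 ev01 show ?thesis
      proof eventually_elim
        case (elim s)
        then show ?case using chF[of s] unfolding F_def by auto
      qed
    next
      case True
      then obtain i where i: "fl t = Suc i" by (cases "fl t") auto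
      have ti: "t = real (Suc i) / real n" using True i n0 by (simp add: field_simps)
      have it: "i \<le> n" "Suc i \<le> n" using fl(1)[OF t] i by auto
      have CSt: "C (Suc i) = \<gamma> t # C i" by (simp only: CS ti)
      have chS: "chain (\<gamma> t # C i)" using chC[OF it(2)] CSt by simp
      note L2 = loc[OF t chS it(1)]
      have "germ_eq (\<gamma> t) (I (\<gamma> t # C (Suc i))) (I (C (Suc i)))"
        using rep[OF chC[OF it(2)]] it by (simp add: len tipC ti)
      then obtain k' where k': "k' > 0" "\<And>w. w \<in> ball (\<gamma> t) k' \<Longrightarrow> I (\<gamma> t # C (Suc i)) w = I (C (Suc i)) w"
        using germ_eq_ball by blast
      have near: "\<forall>\<^sub>F s in at t within {0..1}. \<gamma> s \<in> ball (\<gamma> t) k'"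
        using tend[OF t k'(1)] by (auto elim: eventually_mono simp: dist_norm norm_minus_commute)
      have a: "\<forall>\<^sub>F s in at t within {0..1}. real i < real n * s"
        using ti n0 by (intro order_tendstoD(1)) (auto intro!: tendsto_intros)
      have b: "\<forall>\<^sub>F s in at t within {0..1}. real n * s < real (fl t) + 1"
        using fl(3)[OF t] by (intro order_tendstoD(2)) (auto intro!: tendsto_intros)
      from L1 L2 near a b ev01 show ?thesis
      proof eventually_elim
        case (elim s)
        consider "fl s = Suc i" | "fl s = i" using elim i flI[of "Suc i" s] flI[of i s] by force
        then show ?case
        proof cases
          case 1
          then show ?thesis using elim(1) chF[OF elim(6)] i unfolding F_def by auto
        next
          case 2
          then have "germ_eq (\<gamma> s) (F s) (I (C (Suc i)))"
            using elim(2) chF[OF elim(6)] unfolding F_def CSt by auto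
          moreover have "germ_eq (\<gamma> s) (I (\<gamma> t # C (Suc i))) (I (C (Suc i)))"
            by (rule germ_eqI[OF open_ball elim(3)]) (rule k'(2))
          ultimately show ?thesis unfolding F_def[of t] i using germ_eq_trans germ_eq_sym by blast
        qed
      qed
    qed
  qed
  moreover have "germ_eq (\<gamma> 0) (F 0) f"
  proof -
    have "F 0 = I (\<gamma> 0 # [\<gamma> 0])" by (simp add: F_def fl_def C0)
    moreover have "germ_eq (\<gamma> 0) (I (\<gamma> 0 # [\<gamma> 0])) (I [\<gamma> 0])" using rep[OF chC[of 0]] by (simp add: C0)
    moreover have "germ_eq (\<gamma> 0) (I [\<gamma> 0]) f" using I z \<gamma>0 chC[of 0] C0 unfolding local_family_def by simp
    ultimately show ?thesis using germ_eq_trans by metis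
  qed
  ultimately show "continuable_along f \<gamma>" unfolding continuable_along_iff by blast
qed

text \<open>The segment from a point near 0 radially outwards avoids 0 and stays in the disc of
  radius \<open>R\<close>, hence misses \<Omega>; along it the power series continues
  itself.\<close>

lemma germsI:
  assumes rad: "ereal R \<le> fps_conv_radius u" and r: "0 < r" "r \<le> R"
    and small: "\<And>z. 0 < norm z \<Longrightarrow> norm z < r \<Longrightarrow> continuable_off \<Omega> z (eval_fps u)"
  shows "u \<in> germs"
proof -
  have hol: "eval_fps u holomorphic_on ball 0 R"
    by (rule holomorphic_on_eval_fps) (use rad in \<open>force simp: eball_def dist_norm intro: less_le_trans[of _ "ereal R"]\<close>)
  have "continuable_off \<Omega> z (eval_fps u)" if z: "0 < norm z" "norm z < R" for z
  proof -
    define a where "a = min 1 (r / (2 * norm z))"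
    have a: "0 < a" "a \<le> 1" "a * norm z < r" using z r by (auto simp: a_def min_def field_simps)
    have sm: "continuable_off \<Omega> (of_real a * z) (eval_fps u)" using a z by (intro small) (auto simp: norm_mult)
    let ?l = "linepath (of_real a * z) z"
    have l: "?l t = of_real ((1 - t) * a + t) * z" for t by (simp add: linepath_def scaleR_conv_of_real algebra_simps)
    have ln: "0 < norm (?l t)" "norm (?l t) < R" if "t \<in> {0..1}" for t
    proof -
      have "0 < (1 - t) * a + t" using a that by (cases "t = 0") (auto intro: add_nonneg_pos)
      moreover have "(1 - t) * a \<le> (1 - t) * 1" using a that by (intro mult_left_mono) auto
      ultimately have b: "0 < (1 - t) * a + t" "(1 - t) * a + t \<le> 1" by auto
      then show "0 < norm (?l t)" unfolding l using z by (simp add: norm_mult del: of_real_add of_real_mult of_real_diff)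
      have "norm (?l t) = ((1 - t) * a + t) * norm z" unfolding l norm_mult norm_of_real using b by simp
      also have "\<dots> \<le> norm z" using b by (intro mult_left_le_one_le) auto
      finally show "norm (?l t) < R" using z by simp
    qed
    have im: "path_image ?l \<subseteq> - \<Omega>"
      using ln R_le unfolding path_image_def by force
    have "continuation (\<lambda>t. eval_fps u) ?l"
      unfolding continuation_def
    proof (intro conjI ballI)
      fix t :: real assume "t \<in> {0..1}"
      then show "eval_fps u analytic_on {?l t}"
        using ln hol analytic_on_open[OF open_ball] analytic_on_subset[of "eval_fps u" "ball 0 R" "{?l t}"] by auto
    qed auto
    from continuable_off_transport[OF sm path_linepath im pathstart_linepath this]
    show ?thesis by simp
  qed
  then show ?thesis using rad by (simp add: germs_def)
qed

end

text \<open>This bounds left Riemann sums of (n + 1) s^n on [0, 1] by 1 and produces the next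
  factorial in \<open>ext_convolution_bound_chain\<close>. \<open>step\<close> keeps the two leading
  terms of the binomial expansion.\<close>

lemma sum_power_le: "real (Suc n) * (\<Sum>j<J. real j ^ n) \<le> real J ^ Suc n"
proof -
  have step: "real (Suc n) * x ^ n + x ^ Suc n \<le> (x + 1) ^ Suc n" if "x \<ge> 0" for x :: real
  proof (induction n)
    case (Suc n)
    have "real (Suc (Suc n)) * x ^ Suc n + x ^ Suc (Suc n) \<le> (x + 1) * (real (Suc n) * x ^ n + x ^ Suc n)"
      using that by (simp add: algebra_simps)
    also have "\<dots> \<le> (x + 1) * (x + 1) ^ Suc n" using Suc that by (intro mult_left_mono) auto
    finally show ?case by simp
  qed simp
  show ?thesis
  proof (induction J)
    case (Suc J)
    then show ?case using step[of "real J"] by (simp add: algebra_simps)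
  qed simp
qed

section \<open>Convolutions along chains and their bounds\<close>

context additive_singularities
begin

text \<open>The bound by \<open>rho_min\<close> puts the discs of \<open>conv_sum_homotopy\<close>
  into those of radius \<open>rho\<close>; the last one makes neighbouring nodes closer than e, by
  \<open>split_lipschitz\<close> and \<open>norm_last_le\<close>. Both then serve all chains of
  length at most n.\<close>

definition mesh :: "real \<Rightarrow> nat \<Rightarrow> nat \<Rightarrow> bool" where
  "mesh e J n \<longleftrightarrow> 0 < e \<and> 10 * e \<le> rho_min n \<and> 0 < J \<and> (5/4) ^ n * (R/4) < e * real J"

lemma rho_min_mono: "m \<le> n \<Longrightarrow> rho_min n \<le> rho_min m"
  by (rule lift_Suc_antimono_le[of rho_min]) (auto intro: rho_min_Suc)

lemma mesh_mono: "mesh e J n \<Longrightarrow> m \<le> n \<Longrightarrow> mesh e J m"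
proof -
  assume f: "mesh e J n" "m \<le> n"
  then have "(5/4) ^ m * (R/4) \<le> (5/4) ^ n * (R/4)"
    using R_pos by (intro mult_right_mono power_increasing) auto
  then show "mesh e J m" using f rho_min_mono[of m n] unfolding mesh_def by linarith
qed

lemma mesh_exists: obtains e J where "mesh e J n" "J0 \<le> J"
proof -
  define e where "e = rho_min n / 10"
  have e: "e > 0" using rho_min_pos by (simp add: e_def)
  obtain J :: nat where J: "(5/4) ^ n * (R/4) / e < real J" using reals_Archimedean2 by blast
  have "(5/4) ^ n * (R/4) < e * real J" using J e by (simp add: field_simps)
  also have "\<dots> \<le> e * real (max (Suc J0) J)" using e by (intro mult_left_mono) auto
  finally have "mesh e (max (Suc J0) J) n" unfolding mesh_def using e by (simp add: e_def)
  then show ?thesis by (rule that) simp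
qed

lemma chain_adm: "chain c \<Longrightarrow> adm c"
  by (simp add: chain_def)

lemma split_close:
  assumes "chain c" "s \<in> {0..1}" "t \<in> {0..1}" "(5/4) ^ length c * (R/4) * \<bar>s - t\<bar> < d"
  shows "close d (split c s) (split c t)"
  using assms(1,4)
proof (induction c)
  case Nil
  then show ?case by (simp add: chain_def)
next
  case (Cons z c)
  have "norm (tip (split (z # c) s) - tip (split (z # c) t)) \<le> (5/4) ^ length c * norm (last (z # c)) * \<bar>s - t\<bar>"
    using split_lipschitz(1)[of "z # c" s t] Cons.prems(1) assms(2,3) by (simp add: chain_def del: split.simps)
  also have "\<dots> \<le> (5/4) ^ length c * (R/4) * \<bar>s - t\<bar>"
    using norm_last_le[of "z # c"] Cons.prems(1) by (intro mult_right_mono mult_left_mono) (auto simp: chain_def)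
  also have le: "\<dots> \<le> (5/4) ^ length (z # c) * (R/4) * \<bar>s - t\<bar>"
    using R_pos by (intro mult_right_mono power_increasing) auto
  finally have hd: "norm (tip (split (z # c) s) - tip (split (z # c) t)) < d" using Cons.prems(2) by linarith
  have tl: "close d (split c s) (split c t)"
  proof (cases "c = []")
    case False
    moreover have "(5/4) ^ length c * (R/4) * \<bar>s - t\<bar> < d" using le Cons.prems(2) by linarith
    ultimately show ?thesis using Cons by (auto simp: chain_Cons)
  qed simp
  show ?case using hd tl by simp
qed

lemma ball_subset_rho:
  assumes "adm c" "10 * e \<le> rho_min (length c)"
  shows "ball (tip c) (10 * e) \<subseteq> ball (tip c) (rho c)"
  using rho_min_le_rho[OF assms(1)] assms(2) by auto

lemma ext_split_holomorphic:
  assumes "u \<in> germs" "chain c" "mesh e J (length c)" "s \<in> {0..1}"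
  shows "ext u (split c s) holomorphic_on ball (tip (split c s)) (10 * e)"
proof -
  have ad: "adm (split c s)" using assms split_props(3) chain_adm by blast
  show ?thesis
    by (rule holomorphic_on_subset[OF ext_holomorphic[OF assms(1) ad] ball_subset_rho[OF ad]])
       (use assms in \<open>auto simp: mesh_def\<close>)
qed

lemma ext_split_close:
  assumes "u \<in> germs" "chain c" "mesh e J (length c)" "s \<in> {0..1}" "t \<in> {0..1}" "\<bar>s - t\<bar> \<le> 1 / real J"
  shows "norm (tip (split c s) - tip (split c t)) < e"
    and "x \<in> ball (tip (split c s)) (10 * e) \<Longrightarrow> x \<in> ball (tip (split c t)) (10 * e) \<Longrightarrow>
      ext u (split c s) x = ext u (split c t) x"
proof -
  have e: "0 < e" "10 * e \<le> rho_min (length c)" "0 < J" "(5/4) ^ length c * (R/4) < e * real J"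
    using assms(3) by (auto simp: mesh_def)
  have "(5/4) ^ length c * (R/4) * \<bar>s - t\<bar> \<le> (5/4) ^ length c * (R/4) * (1 / real J)"
    using assms(6) R_pos by (intro mult_left_mono) auto
  also have "\<dots> < e" using e(3,4) by (simp add: pos_divide_less_eq del: times_divide_eq_left)
  finally have cl: "close e (split c s) (split c t)" using split_close assms by blast
  show "norm (tip (split c s) - tip (split c t)) < e" using close_tip[OF cl] e by blast
  have ad: "adm (split c s)" "adm (split c t)" using assms split_props(3) chain_adm by blast+
  show "ext u (split c s) x = ext u (split c t) x"
    if "x \<in> ball (tip (split c s)) (10 * e)" "x \<in> ball (tip (split c t)) (10 * e)"
    using subsetD[OF ball_subset_rho[OF ad(1), of e] that(1)] subsetD[OF ball_subset_rho[OF ad(2), of e] that(2)] e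
    by (intro ext_close[OF assms(1) cl ad]) simp_all
qed

lemma tip_split_minus: "chain c \<Longrightarrow> s \<in> {0..1} \<Longrightarrow> tip (split c (1 - s)) = tip c - tip (split c s)"
  using split_props(1)[of c s] chain_adm by (simp add: eq_diff_eq add.commute)

text \<open>A part that has not travelled has \<open>eta\<close> 0 and thus weight 0, also when the
  weight is 0 / 0. Hence the deformed contour always starts at 0.\<close>

lemma tip_split_0: "tip (split c 0) = 0"
proof -
  have "tip (split c 0) = 0 \<and> travel (split c 0) = 0"
  proof (induction c)
    case (Cons z c)
    then have "eta (split c 0) = 0" using infdist_nonneg[of 0 \<Omega>] by (simp add: eta_def)
    then show ?case using Cons by simp
  qed simp
  then show ?thesis by simp
qed

lemma tip_split_1: "chain c \<Longrightarrow> tip (split c 1) = tip c"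
  using tip_split_minus[of c 0] tip_split_0[of c] by simp

text \<open>The contour that \<open>tip (split c s)\<close> describes for s from 0 to 1 is replaced
  by the polygon through J + 1 nodes. Each factor is continued along its own part, so that the
  branches at neighbouring nodes match.\<close>

definition conv_chain :: "complex fps \<Rightarrow> complex fps \<Rightarrow> nat \<Rightarrow> complex list \<Rightarrow> complex \<Rightarrow> complex" where
  "conv_chain u v J c = conv_sum J (\<lambda>j. tip (split c (real j / real J))) (\<lambda>j. ext u (split c (real j / real J)))
     (\<lambda>j. ext v (split c (1 - real j / real J)))"

lemma node_in: "j \<le> J \<Longrightarrow> real j / real J \<in> {0..1}"
  by (auto simp: divide_simps)

lemma one_minus_in: "s \<in> {0..1} \<Longrightarrow> 1 - s \<in> {0..1 :: real}"
  by auto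

lemma node_step: "J > 0 \<Longrightarrow> \<bar>real j / real J - real (Suc j) / real J\<bar> \<le> 1 / real J"
  by (simp flip: diff_divide_distrib)

text \<open>Collects what \<open>conv_sum_holomorphic\<close> and \<open>conv_sum_homotopy\<close>
  ask of a single polygon.\<close>

lemma conv_chain_cells:
  assumes u: "u \<in> germs" "v \<in> germs" and c: "chain c" "mesh e J (length c)"
  shows "j \<le> J \<Longrightarrow> ext u (split c (real j / real J)) holomorphic_on ball (tip (split c (real j / real J))) (10*e)"
    and "j \<le> J \<Longrightarrow> ext v (split c (1 - real j / real J)) holomorphic_on ball (tip c - tip (split c (real j / real J))) (10*e)"
    and "j < J \<Longrightarrow> norm (tip (split c (real (Suc j) / real J)) - tip (split c (real j / real J))) < e"
    and "J > 0" "e > 0"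
    and "tip (split c (real 0 / real J)) = 0" "tip (split c (real J / real J)) = tip c"
proof -
  show J: "J > 0" and e: "e > 0" using c by (auto simp: mesh_def)
  show "ext u (split c (real j / real J)) holomorphic_on ball (tip (split c (real j / real J))) (10*e)" if "j \<le> J"
    using ext_split_holomorphic[OF u(1) c node_in[OF that]] .
  show "ext v (split c (1 - real j / real J)) holomorphic_on ball (tip c - tip (split c (real j / real J))) (10*e)" if "j \<le> J"
    using ext_split_holomorphic[OF u(2) c one_minus_in[OF node_in[OF that]]] tip_split_minus[OF c(1) node_in[OF that]] by simp
  show "norm (tip (split c (real (Suc j) / real J)) - tip (split c (real j / real J))) < e" if "j < J"
    using ext_split_close(1)[OF u(1) c node_in[of j J] node_in[of "Suc j" J] node_step[OF J, of j]] that
    by (simp add: norm_minus_commute)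
  show "tip (split c (real 0 / real J)) = 0" by (simp add: tip_split_0)
  show "tip (split c (real J / real J)) = tip c" using J c by (simp add: tip_split_1)
qed

lemma conv_chain_holomorphic:
  assumes u: "u \<in> germs" "v \<in> germs" and c: "chain c" "mesh e J (length c)"
  shows "conv_chain u v J c holomorphic_on ball (tip c) e"
  unfolding conv_chain_def
  using conv_chain_cells[OF assms] by (intro conv_sum_holomorphic) auto

text \<open>\<open>agree\<close> is asked for every germ and every s because it serves
  \<open>u\<close> at a node s and \<open>v\<close> at 1 - s.\<close>

lemma conv_chain_homotopy:
  assumes u: "u \<in> germs" "v \<in> germs" and c: "chain c" "mesh e J (length c)"
    and c': "chain c'" "mesh e J (length c')"
    and near: "\<And>s. s \<in> {0..1} \<Longrightarrow> norm (tip (split c' s) - tip (split c s)) < e"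
    and agree: "\<And>u s x. u \<in> germs \<Longrightarrow> s \<in> {0..1} \<Longrightarrow> x \<in> ball (tip (split c s)) (10*e) \<Longrightarrow>
      x \<in> ball (tip (split c' s)) (10*e) \<Longrightarrow> ext u (split c s) x = ext u (split c' s) x"
    and z: "norm (z - tip c) < e"
  shows "conv_chain u v J c z = conv_chain u v J c' z"
proof -
  note C = conv_chain_cells[OF u c] and C' = conv_chain_cells[OF u c']
  note tm = tip_split_minus[OF c(1)] and tm' = tip_split_minus[OF c'(1)]
  show ?thesis
    unfolding conv_chain_def
  proof (rule conv_sum_homotopy[where w = "tip c" and w' = "tip c'" and e = e])
    show "ext u (split c (real j / real J)) x = ext u (split c (real (Suc j) / real J)) x"
      if "j < J" "x \<in> ball (tip (split c (real j / real J))) (10*e)" "x \<in> ball (tip (split c (real (Suc j) / real J))) (10*e)" for j x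
      using ext_split_close(2)[OF u(1) c node_in node_in node_step] that C(4) by auto
    show "ext v (split c (1 - real j / real J)) x = ext v (split c (1 - real (Suc j) / real J)) x"
      if "j < J" "x \<in> ball (tip c - tip (split c (real j / real J))) (10*e)"
        "x \<in> ball (tip c - tip (split c (real (Suc j) / real J))) (10*e)" for j x
    proof -
      have j: "real j / real J \<in> {0..1}" "real (Suc j) / real J \<in> {0..1}" using node_in that(1) by (metis less_imp_le, metis Suc_leI)
      have "\<bar>(1 - real j / real J) - (1 - real (Suc j) / real J)\<bar> \<le> 1 / real J"
        using node_step[OF C(4), of j] by (simp add: abs_minus_commute)
      from ext_split_close(2)[OF u(2) c one_minus_in[OF j(1)] one_minus_in[OF j(2)] this]
      show ?thesis using that tm[OF j(1)] tm[OF j(2)] by simp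
    qed
    show "ext u (split c (real j / real J)) x = ext u (split c' (real j / real J)) x"
      if "j \<le> J" "x \<in> ball (tip (split c (real j / real J))) (10*e)" "x \<in> ball (tip (split c' (real j / real J))) (10*e)" for j x
      using agree[OF u(1) node_in] that by auto
    show "ext v (split c (1 - real j / real J)) x = ext v (split c' (1 - real j / real J)) x"
      if "j \<le> J" "x \<in> ball (tip c - tip (split c (real j / real J))) (10*e)" "x \<in> ball (tip c' - tip (split c' (real j / real J))) (10*e)" for j x
      using agree[OF u(2) one_minus_in[OF node_in[OF that(1)]], of x] that tm[OF node_in] tm'[OF node_in] by simp
    show "norm (tip (split c' (real j / real J)) - tip (split c (real j / real J))) < e" if "j \<le> J" for j
      using near[OF node_in[OF that]] .
    show "norm (tip c' - tip c) < e" using near[of 1] tip_split_1 c c' by auto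
    show "tip (split c (real 0 / real J)) = tip (split c' (real 0 / real J))" using C(6) C'(6) by simp
  qed (use C C' z in auto)
qed

text \<open>For one point the contour is still straight and all branches are the power series, so a
  primitive on a convex set makes the sum telescope to the segment from 0 to \<zeta>.\<close>

lemma conv_chain_single:
  assumes u: "u \<in> germs" "v \<in> germs" and z: "chain [z]" and J: "J > 0"
  shows "germ_eq z (conv_chain u v J [z]) (eval_fps (fps_convolution u v))"
proof (rule germ_eqI[of "ball z (R/4)"])
  fix \<zeta> assume "\<zeta> \<in> ball z (R/4)"
  have z4: "norm z \<le> R/4" using z by (simp add: chain_single)
  have "norm \<zeta> \<le> norm z + norm (\<zeta> - z)" by (metis norm_triangle_sub)
  then have zeta: "norm \<zeta> < R/2" using \<open>\<zeta> \<in> ball z (R/4)\<close> z4 by (simp add: dist_norm norm_minus_commute)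
  have R: "ereal R \<le> fps_conv_radius u" "ereal R \<le> fps_conv_radius v" using u by (auto simp: germs_def)
  define q where "q x = eval_fps u x * eval_fps v (\<zeta> - x)" for x
  define S where "S = ball 0 R \<inter> ball \<zeta> R"
  have "(\<lambda>x. eval_fps v (\<zeta> - x)) holomorphic_on S"
    by (rule holomorphic_on_compose_gen[OF _ germs_holomorphic[OF u(2) order_refl], unfolded o_def])
       (auto simp: S_def dist_norm norm_minus_commute intro!: holomorphic_intros)
  from holomorphic_on_mult[OF germs_holomorphic[OF u(1), of S] this]
  have "q holomorphic_on S"
    unfolding q_def by (simp add: S_def)
  then obtain P where P: "\<And>a b. a \<in> S \<Longrightarrow> b \<in> S \<Longrightarrow> contour_integral (linepath a b) q = P b - P a"
    using convex_contour_integral_primitive[of q S] by (auto simp: S_def convex_Int open_Int)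
  have sz: "of_real s * z \<in> S \<and> norm (of_real s * z) \<le> R/4" if "s \<in> {0..1}" for s :: real
  proof -
    have "s * norm z \<le> 1 * norm z" using that by (intro mult_right_mono) auto
    then have n: "norm (of_real s * z) \<le> R/4" using that z4 by (simp add: norm_mult)
    have "norm (\<zeta> - of_real s * z) \<le> norm \<zeta> + norm (of_real s * z)" by (rule norm_triangle_ineq4)
    then show ?thesis using n zeta R_pos by (simp add: S_def dist_norm)
  qed
  have S: "\<zeta> \<in> S" "0 \<in> S" using zeta R_pos by (auto simp: S_def)
  have ext1: "ext w [of_real s * z] = eval_fps w" if "s \<in> {0..1}" for s w
    using sz[OF that] R_pos by (intro ext_near) (simp del: ext.simps)
  have node: "ext u (split [z] (real j / real J)) = eval_fps u" "ext v (split [z] (1 - real j / real J)) = eval_fps v"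
    "tip (split [z] (real j / real J)) \<in> S" if "j \<le> J" for j
    using ext1[OF node_in[OF that]] ext1[OF one_minus_in[OF node_in[OF that]]] sz[OF node_in[OF that]]
    by (simp_all del: ext.simps)
  have "conv_chain u v J [z] \<zeta> = (\<Sum>j<J. P (tip (split [z] (real (Suc j) / real J))) - P (tip (split [z] (real j / real J))))
     + (P \<zeta> - P (tip (split [z] (real J / real J))))"
  proof -
    have cell: "(\<lambda>x. ext u (split [z] (real j / real J)) x * ext v (split [z] (1 - real j / real J)) (\<zeta> - x)) = q"
      if "j \<le> J" for j
      unfolding node(1,2)[OF that] q_def ..
    have seg: "contour_integral (linepath (tip (split [z] (real j / real J))) (tip (split [z] (real (Suc j) / real J))))
       (\<lambda>x. ext u (split [z] (real j / real J)) x * ext v (split [z] (1 - real j / real J)) (\<zeta> - x)) =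
       P (tip (split [z] (real (Suc j) / real J))) - P (tip (split [z] (real j / real J)))" if "j < J" for j
      unfolding cell[OF less_imp_le[OF that]] by (rule P[OF node(3) node(3)]) (use that in auto)
    show ?thesis
      unfolding conv_chain_def conv_sum_def cell[OF order_refl] P[OF node(3)[OF order_refl] S(1)]
      by (intro arg_cong2[where f = "(+)"] sum.cong refl seg) auto
  qed
  also have "\<dots> = P \<zeta> - P (tip (split [z] (real 0 / real J)))"
    by (subst sum_lessThan_telescope) simp
  also have "\<dots> = contour_integral (linepath 0 \<zeta>) q" using S P by simp
  also have "\<dots> = eval_fps (fps_convolution u v) \<zeta>"
    unfolding q_def[abs_def] using zeta R_pos by (intro eval_fps_convolution[OF R, symmetric]) auto
  finally show "conv_chain u v J [z] \<zeta> = eval_fps (fps_convolution u v) \<zeta>" .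
qed (use R_pos in auto)

lemma fraction_le_1: "0 \<le> a \<Longrightarrow> 0 \<le> b \<Longrightarrow> 0 \<le> a / (a + b) \<and> a / (a + b) \<le> (1 :: real)"
  by (auto simp: divide_simps)

text \<open>A point appended to a nonempty \<open>c\<close> moves the parts with weights determined
  by \<open>c\<close> alone. So a repeated tip leaves the polygon in place, and moving the newest
  point by less than e moves each node by less than e; the homotopy lemma applies to both.\<close>

lemma local_family_conv_chain:
  assumes u: "u \<in> germs" "v \<in> germs" and f: "mesh e J N" and r: "r \<le> R"
  shows "local_family N r (eval_fps (fps_convolution u v)) (conv_chain u v J)"
  unfolding local_family_def
proof (intro conjI allI impI)
  have e: "e > 0" "J > 0" using f by (auto simp: mesh_def)
  show "conv_chain u v J c analytic_on {tip c}" if "chain c \<and> length c \<le> N" for c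
  proof -
    have "conv_chain u v J c holomorphic_on ball (tip c) e"
      using conv_chain_holomorphic[OF u] mesh_mono[OF f] that by blast
    then show ?thesis using e analytic_at_ball by blast
  qed
  show "germ_eq z (conv_chain u v J [z]) (eval_fps (fps_convolution u v))" if "chain [z] \<and> norm z < r" for z
    using conv_chain_single[OF u] that e by blast
  show "germ_eq (tip c) (conv_chain u v J (tip c # c)) (conv_chain u v J c)" if h: "chain c \<and> length c < N" for c
  proof (rule germ_eq_sym, rule germ_eqI[of "ball (tip c) e"])
    have f': "mesh e J (length c)" "mesh e J (length (tip c # c))" using mesh_mono[OF f] h by auto
    have sp: "split (tip c # c) s = tip (split c s) # split c s" for s by simp
    fix z assume z: "z \<in> ball (tip c) e"
    show "conv_chain u v J c z = conv_chain u v J (tip c # c) z"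
    proof (rule conv_chain_homotopy[OF u conjunct1[OF h] f'(1) chain_tip[OF conjunct1[OF h]] f'(2)])
      fix u s x assume us: "u \<in> germs" "s \<in> {0..1}" and x: "x \<in> ball (tip (split c s)) (10*e)"
        "x \<in> ball (tip (split (tip c # c) s)) (10*e)"
      have ad: "adm (split c s)" "adm (split (tip c # c) s)"
        using split_props(3) chain_adm chain_tip h us by blast+
      have "x \<in> ball (tip (split (tip c # c) s)) (rho (split (tip c # c) s))"
        using ball_subset_rho[OF ad(2), of e] f'(2) x(2) unfolding mesh_def length_split by blast
      moreover have "x \<in> ball (tip (split c s)) (rho (split c s))"
        using ball_subset_rho[OF ad(1), of e] f'(1) x(1) unfolding mesh_def length_split by blast
      ultimately show "ext u (split c s) x = ext u (split (tip c # c) s) x"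
        using ext_step_eq[OF us(1) ad(2)[unfolded sp]] unfolding sp tip.simps by metis
    qed (use e z in \<open>auto simp: sp dist_norm norm_minus_commute\<close>)
  qed (use e in auto)
  show "\<exists>k>0. \<forall>z'. norm (z' - z) < k \<and> chain (z' # c) \<longrightarrow> germ_eq z' (conv_chain u v J (z' # c)) (conv_chain u v J (z # c))"
    if h: "c \<noteq> [] \<and> chain (z # c) \<and> length c < N" for z c
  proof (intro exI[of _ e] conjI allI impI)
    fix z' assume z': "norm (z' - z) < e \<and> chain (z' # c)"
    have f': "mesh e J (length (z # c))" "mesh e J (length (z' # c))" using mesh_mono[OF f] h by auto
    have ch: "chain (z # c)" "chain (z' # c)" using h z' by auto
    have near: "norm (tip (split (z # c) s) - tip (split (z' # c) s)) < e" if s: "s \<in> {0..1}" for s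
    proof -
      define \<theta> where "\<theta> = (if c = [] then s else eta (split c s) / (eta (split c s) + eta (split c (1 - s))))"
      have \<theta>: "0 \<le> \<theta>" "\<theta> \<le> 1" unfolding \<theta>_def using s fraction_le_1[OF eta_nonneg eta_nonneg] by auto
      have "tip (split (z # c) s) - tip (split (z' # c) s) = of_real \<theta> * (z - z')"
        unfolding split.simps tip.simps \<theta>_def[symmetric] by (simp add: algebra_simps)
      then have "norm (tip (split (z # c) s) - tip (split (z' # c) s)) = \<theta> * norm (z - z')"
        using \<theta> by (simp add: norm_mult)
      also have "\<dots> \<le> norm (z - z')" using \<theta> by (intro mult_left_le_one_le) auto
      finally show ?thesis using z' by (simp add: norm_minus_commute)
    qed
    have cl: "close e (split (z' # c) s) (split (z # c) s)" if "s \<in> {0..1}" for s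
      using near[OF that] close_refl[OF e(1)] by (simp add: norm_minus_commute)
    show "germ_eq z' (conv_chain u v J (z' # c)) (conv_chain u v J (z # c))"
    proof (rule germ_eqI[of "ball z' e"])
      fix w assume w: "w \<in> ball z' e"
      show "conv_chain u v J (z' # c) w = conv_chain u v J (z # c) w"
      proof (rule conv_chain_homotopy[OF u ch(2) f'(2) ch(1) f'(1) near])
        fix u s x assume us: "u \<in> germs" "s \<in> {0..1}" and x: "x \<in> ball (tip (split (z' # c) s)) (10*e)"
          "x \<in> ball (tip (split (z # c) s)) (10*e)"
        have ad: "adm (split (z' # c) s)" "adm (split (z # c) s)"
          using split_props(3) chain_adm ch us by blast+
        show "ext u (split (z' # c) s) x = ext u (split (z # c) s) x"
        proof (rule ext_close[OF us(1) cl[OF us(2)] ad])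
          show "e \<le> rho_min (length (split (z' # c) s)) / 2" using f'(2) e unfolding mesh_def length_split by linarith
          show "x \<in> ball (tip (split (z' # c) s)) (rho (split (z' # c) s))"
            using ball_subset_rho[OF ad(1), of e] f'(2) x(1) unfolding mesh_def length_split by blast
          show "x \<in> ball (tip (split (z # c) s)) (rho (split (z # c) s))"
            using ball_subset_rho[OF ad(2), of e] f'(1) x(2) unfolding mesh_def length_split by blast
        qed
      qed (use w in \<open>auto simp: dist_norm norm_minus_commute\<close>)
    qed (use e in auto)
  qed (use e in auto)
qed

lemma germs_convolution:
  assumes u: "u \<in> germs" "v \<in> germs"
  shows "fps_convolution u v \<in> germs"
proof (rule germsI[of _ "R/4"])
  show "ereal R \<le> fps_conv_radius (fps_convolution u v)"
    using u by (intro fps_conv_radius_convolution) (auto simp: germs_def)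
  fix z :: complex assume z: "0 < norm z" "norm z < R/4"
  show "continuable_off \<Omega> z (eval_fps (fps_convolution u v))"
  proof (rule continuable_off_local_families[OF _ z order_refl])
    fix N
    obtain e J where "mesh e J N" using mesh_exists by blast
    then show "\<exists>I. local_family N (R/4) (eval_fps (fps_convolution u v)) I"
      using local_family_conv_chain[OF u, of e J N "R/4"] R_pos by auto
  qed
qed (use R_pos in auto)

lemma ext_convolution:
  assumes u: "u \<in> germs" "v \<in> germs" and c: "chain c" "mesh e J (length c)"
  shows "ext (fps_convolution u v) c (tip c) = conv_chain u v J c (tip c)"
  using ext_eq_local_family[OF germs_convolution[OF u] local_family_conv_chain[OF u c(2) order_refl] _ c(1)] R_pos
  by (auto dest: germ_eq_at)


text \<open>Bounds are known only at tips, but the contour runs between nodes. Each part is close to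
  one of finitely many, those with s = j/J, and shares its branch, so uniform continuity on finitely
  many compact discs gives one \<delta> for all s.\<close>

lemma ext_split_equicontinuous:
  assumes u: "u \<in> germs" and c: "chain c" and "\<epsilon> > 0"
  obtains \<delta> where "\<delta> > 0" "\<And>s x. s \<in> {0..1} \<Longrightarrow> norm (x - tip (split c s)) < \<delta> \<Longrightarrow>
     norm (ext u (split c s) x - ext u (split c s) (tip (split c s))) < \<epsilon>"
proof -
  obtain e J where f: "mesh e J (length c)" using mesh_exists by blast
  then have e: "e > 0" "J > 0" by (auto simp: mesh_def)
  define p where "p j = tip (split c (real j / real J))" for j
  have "\<exists>d>0. \<forall>x\<in>cball (p j) (5*e). \<forall>y\<in>cball (p j) (5*e). norm (x - y) < d \<longrightarrow>
      norm (ext u (split c (real j / real J)) x - ext u (split c (real j / real J)) y) < \<epsilon>" if "j \<le> J" for j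
  proof -
    have "continuous_on (cball (p j) (5*e)) (ext u (split c (real j / real J)))"
      by (rule continuous_on_subset[OF holomorphic_on_imp_continuous_on[OF ext_split_holomorphic[OF u c f node_in[OF that]]]])
         (use e in \<open>auto simp: p_def\<close>)
    from compact_uniformly_continuous[OF this compact_cball] \<open>\<epsilon> > 0\<close> show ?thesis
      unfolding uniformly_continuous_on_def dist_norm by (metis norm_minus_commute)
  qed
  then obtain d where d: "\<And>j. j \<le> J \<Longrightarrow> d j > 0"
    "\<And>j x y. j \<le> J \<Longrightarrow> x \<in> cball (p j) (5*e) \<Longrightarrow> y \<in> cball (p j) (5*e) \<Longrightarrow> norm (x - y) < d j \<Longrightarrow>
      norm (ext u (split c (real j / real J)) x - ext u (split c (real j / real J)) y) < \<epsilon>"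
    by metis
  define \<delta> where "\<delta> = Min (insert e (d ` {..J}))"
  have \<delta>: "\<delta> > 0" "\<delta> \<le> e" "\<And>j. j \<le> J \<Longrightarrow> \<delta> \<le> d j"
  proof -
    show "\<delta> > 0" unfolding \<delta>_def using d(1) e by (subst Min_gr_iff) auto
    show "\<delta> \<le> e" "\<And>j. j \<le> J \<Longrightarrow> \<delta> \<le> d j" unfolding \<delta>_def by (rule Min_le; auto)+
  qed
  show ?thesis
  proof (rule that[OF \<delta>(1)])
    fix s x assume s: "s \<in> {0..1::real}" and x: "norm (x - tip (split c s)) < \<delta>"
    define j where "j = nat \<lfloor>real J * s\<rfloor>"
    have "0 \<le> real J * s" "real J * s \<le> real J * 1" using s by (auto intro!: mult_left_mono simp del: mult_1_right)
    then have j: "j \<le> J" "\<bar>real J * s - real j\<bar> \<le> 1" unfolding j_def by linarith+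
    have "s - real j / real J = (real J * s - real j) / real J" using e by (simp add: diff_divide_distrib)
    then have sj: "\<bar>s - real j / real J\<bar> \<le> 1 / real J" using j e by (simp add: divide_right_mono)
    note C = ext_split_close[OF u c f s node_in[OF j(1)] sj]
    let ?t = "tip (split c s)"
    have pt: "norm (?t - p j) < e" using C(1) by (simp add: p_def)
    have "norm (x - p j) \<le> norm (x - ?t) + norm (?t - p j)" by (rule norm_diff_triangle_le) auto
    then have xp: "norm (x - p j) < 2 * e" using pt x \<delta>(2) by linarith
    have eq: "ext u (split c s) y = ext u (split c (real j / real J)) y" if "norm (y - ?t) < \<delta>" "norm (y - p j) < 2 * e" for y
      using that e \<delta> by (intro C(2)) (auto simp: p_def dist_norm norm_minus_commute)
    have "norm (ext u (split c (real j / real J)) x - ext u (split c (real j / real J)) ?t) < \<epsilon>"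
      using xp pt x \<delta>(3)[OF j(1)] e by (intro d(2) j) (auto simp: dist_norm norm_minus_commute)
    then show "norm (ext u (split c s) x - ext u (split c s) ?t) < \<epsilon>"
      using eq[of x] eq[of ?t] x xp pt e \<delta> by simp
  qed
qed

text \<open>Compare the integral with a Riemann sum: up to \<epsilon> the factors have their values
  at the nodes, where the first point of the part is s x0 and the hypothesis gives b (s x0)^n / n!.
  Averaging s^n over the nodes contributes at most 1 / (n + 1).\<close>

lemma ext_convolution_bound_chain:
  assumes u: "u \<in> germs" "v \<in> germs" and c: "chain c" and B: "b \<ge> 0" "M \<ge> 0"
    and bu: "\<And>a. adm a \<Longrightarrow> length a = length c \<Longrightarrow> norm (ext u a (tip a)) \<le> b * norm (last a) ^ n / fact n"
    and bv: "\<And>a. adm a \<Longrightarrow> length a = length c \<Longrightarrow> norm (ext v a (tip a)) \<le> M"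
  shows "norm (ext (fps_convolution u v) c (tip c)) \<le>
     b * (M * (5/4) ^ length c) * norm (last c) ^ Suc n / fact (Suc n)"
proof -
  define x0 where "x0 = norm (last c)"
  \<comment> \<open>By \<open>split_lipschitz\<close> this bounds the length of the deformed
    contour.\<close>
  define K where "K = (5/4) ^ length c * x0"
  have x0: "x0 > 0" using c by (auto simp: x0_def chain_def)
  then have K: "K > 0" by (simp add: K_def)
  define X where "X = norm (ext (fps_convolution u v) c (tip c))"
  have main: "X \<le> K * (M + \<epsilon>) * (b * x0 ^ n / fact (Suc n) + \<epsilon>)" if \<epsilon>: "\<epsilon> > 0" for \<epsilon>
  proof -
    obtain \<delta>1 where \<delta>1: "\<delta>1 > 0" "\<And>s x. s \<in> {0..1} \<Longrightarrow> norm (x - tip (split c s)) < \<delta>1 \<Longrightarrow>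
       norm (ext u (split c s) x - ext u (split c s) (tip (split c s))) < \<epsilon>"
      using ext_split_equicontinuous[OF u(1) c \<epsilon>] by blast
    obtain \<delta>2 where \<delta>2: "\<delta>2 > 0" "\<And>s x. s \<in> {0..1} \<Longrightarrow> norm (x - tip (split c s)) < \<delta>2 \<Longrightarrow>
       norm (ext v (split c s) x - ext v (split c s) (tip (split c s))) < \<epsilon>"
      using ext_split_equicontinuous[OF u(2) c \<epsilon>] by blast
    \<comment> \<open>A lower bound for J makes every piece of the contour shorter than both
      tolerances.\<close>
    obtain J0 :: nat where J0: "K / min \<delta>1 \<delta>2 < real J0" using reals_Archimedean2 by blast
    obtain e J where f: "mesh e J (length c)" and JJ: "J0 \<le> J" using mesh_exists by blast
    note C = conv_chain_cells[OF u c f]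
    have J: "J > 0" "real J > 0" using C(4) by auto
    have "K / min \<delta>1 \<delta>2 < real J" using J0 JJ by linarith
    then have KJ: "K / real J < min \<delta>1 \<delta>2" using J K \<delta>1(1) \<delta>2(1) by (simp add: field_simps del: min_less_iff_conj)
    define p where "p j = tip (split c (real j / real J))" for j
    define s where "s j = real j / real J" for j :: nat
    have st: "norm (p (Suc j) - p j) \<le> K / real J" if "j < J" for j
    proof -
      have "norm (p (Suc j) - p j) \<le> (5/4) ^ (length c - 1) * x0 * \<bar>real (Suc j) / real J - real j / real J\<bar>"
        unfolding p_def x0_def using split_lipschitz(1) c node_in[of j J] node_in[of "Suc j" J] that by (simp add: chain_def)
      also have "\<bar>real (Suc j) / real J - real j / real J\<bar> = 1 / real J" by (simp flip: diff_divide_distrib)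
      also have "(5/4) ^ (length c - 1) * x0 * (1 / real J) \<le> (5/4) ^ length c * x0 * (1 / real J)"
        using x0 J by (intro mult_right_mono power_increasing) auto
      finally show ?thesis by (simp add: K_def)
    qed
    have piece: "norm (contour_integral (linepath (p j) (p (Suc j))) (\<lambda>x. ext u (split c (s j)) x * ext v (split c (1 - s j)) (tip c - x)))
        \<le> ((b * (s j * x0) ^ n / fact n + \<epsilon>) * (M + \<epsilon>)) * (K / real J)" if j: "j < J" for j
    proof -
      have sj: "s j \<in> {0..1}" "1 - s j \<in> {0..1}" using node_in[of j J] one_minus_in j by (auto simp: s_def)
      have ad: "adm (split c (s j))" "adm (split c (1 - s j))" using split_props(3) c chain_adm sj by blast+
      have tp: "tip (split c (1 - s j)) = tip c - p j" using tip_split_minus[OF c sj(1)] by (simp add: p_def s_def)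
      have b1: "norm (ext u (split c (s j)) (p j)) \<le> b * (s j * x0) ^ n / fact n"
      proof -
        have "norm (last (split c (s j))) = s j * x0"
          using last_split[of c "s j"] c sj by (simp add: chain_def norm_mult x0_def)
        then show ?thesis using bu[OF ad(1)] by (simp add: p_def flip: s_def)
      qed
      have b2: "norm (ext v (split c (1 - s j)) (tip c - p j)) \<le> M"
        using bv[OF ad(2)] tp by simp
      have near: "norm (x - p j) < min \<delta>1 \<delta>2" if "x \<in> closed_segment (p j) (p (Suc j))" for x
      proof -
        have "norm (x - p j) \<le> norm (p (Suc j) - p j)" using segment_bound(1)[OF that] by (simp add: norm_minus_commute)
        then show ?thesis using st[OF j] KJ by linarith
      qed
      have bd: "norm (ext u (split c (s j)) x * ext v (split c (1 - s j)) (tip c - x)) \<le> (b * (s j * x0) ^ n / fact n + \<epsilon>) * (M + \<epsilon>)"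
        if x: "x \<in> closed_segment (p j) (p (Suc j))" for x
      proof -
        have "norm (ext u (split c (s j)) x - ext u (split c (s j)) (p j)) < \<epsilon>"
          using \<delta>1(2)[OF sj(1), of x] near[OF x] by (simp add: p_def s_def)
        then have 1: "norm (ext u (split c (s j)) x) \<le> b * (s j * x0) ^ n / fact n + \<epsilon>"
          using b1 norm_triangle_sub[of "ext u (split c (s j)) x" "ext u (split c (s j)) (p j)"] by linarith
        have "norm (ext v (split c (1 - s j)) (tip c - x) - ext v (split c (1 - s j)) (tip c - p j)) < \<epsilon>"
          using \<delta>2(2)[OF sj(2), of "tip c - x"] near[OF x] unfolding tp by (simp add: norm_minus_commute)
        then have 2: "norm (ext v (split c (1 - s j)) (tip c - x)) \<le> M + \<epsilon>"
          using b2 norm_triangle_sub[of "ext v (split c (1 - s j)) (tip c - x)" "ext v (split c (1 - s j)) (tip c - p j)"] by linarith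
        show ?thesis unfolding norm_mult by (rule mult_mono[OF 1 2]) (use 1 norm_ge_zero order_trans in \<open>blast+\<close>)
      qed
      have sub: "closed_segment (p j) (p (Suc j)) \<subseteq> ball (p j) (10*e)"
        using C(3)[OF j] C(5) by (intro closed_segment_subset) (auto simp: p_def dist_norm norm_minus_commute)
      have "continuous_on (closed_segment (p j) (p (Suc j))) (\<lambda>x. ext u (split c (s j)) x * ext v (split c (1 - s j)) (tip c - x))"
      proof (rule continuous_on_mult)
        show "continuous_on (closed_segment (p j) (p (Suc j))) (ext u (split c (s j)))"
          using continuous_on_subset[OF holomorphic_on_imp_continuous_on[OF C(1)]] sub j by (simp add: p_def s_def)
        show "continuous_on (closed_segment (p j) (p (Suc j))) (\<lambda>x. ext v (split c (1 - s j)) (tip c - x))"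
        proof (rule continuous_on_compose2[OF holomorphic_on_imp_continuous_on[OF C(2)[of j]], folded s_def])
          show "(\<lambda>x. tip c - x) ` closed_segment (p j) (p (Suc j)) \<subseteq> ball (tip c - tip (split c (s j))) (10*e)"
            using sub by (auto simp: p_def s_def dist_norm subset_iff norm_minus_commute)
        qed (use j in \<open>auto intro!: continuous_intros\<close>)
      qed
      then have "norm (contour_integral (linepath (p j) (p (Suc j))) (\<lambda>x. ext u (split c (s j)) x * ext v (split c (1 - s j)) (tip c - x)))
         \<le> ((b * (s j * x0) ^ n / fact n + \<epsilon>) * (M + \<epsilon>)) * norm (p (Suc j) - p j)"
        using B \<epsilon> sj x0 bd by (intro contour_integral_bound_linepath contour_integrable_continuous_linepath) auto
      also have "\<dots> \<le> ((b * (s j * x0) ^ n / fact n + \<epsilon>) * (M + \<epsilon>)) * (K / real J)"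
        using st[OF j] B \<epsilon> sj x0 by (intro mult_left_mono) auto
      finally show ?thesis .
    qed
    have "ext (fps_convolution u v) c (tip c) = (\<Sum>j<J. contour_integral (linepath (p j) (p (Suc j)))
        (\<lambda>x. ext u (split c (s j)) x * ext v (split c (1 - s j)) (tip c - x)))"
      unfolding ext_convolution[OF u c f] conv_chain_def conv_sum_def p_def s_def
      using C(7) by simp
    then have "X \<le> (\<Sum>j<J. ((b * (s j * x0) ^ n / fact n + \<epsilon>) * (M + \<epsilon>)) * (K / real J))"
      unfolding X_def using piece by (auto intro: sum_norm_le)
    also have "\<dots> = K * (M + \<epsilon>) * (\<Sum>j<J. (b * (s j * x0) ^ n / fact n + \<epsilon>) / real J)"
      by (simp add: sum_distrib_left mult_ac)
    also have "(\<Sum>j<J. (b * (s j * x0) ^ n / fact n + \<epsilon>) / real J) =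
        b * x0 ^ n / fact n * ((\<Sum>j<J. real j ^ n) / real J ^ Suc n) + \<epsilon>"
      using J by (simp add: add_divide_distrib sum.distrib s_def power_mult_distrib power_divide
         sum_distrib_left sum_divide_distrib mult_ac)
    also have "b * x0 ^ n / fact n * ((\<Sum>j<J. real j ^ n) / real J ^ Suc n) \<le> b * x0 ^ n / fact n * (1 / real (Suc n))"
      using sum_power_le[of n J] B x0 J by (intro mult_left_mono) (simp_all add: divide_simps mult.commute)
    also have "b * x0 ^ n / fact n * (1 / real (Suc n)) = b * x0 ^ n / fact (Suc n)"
      by (simp add: mult.commute)
    finally show ?thesis using K B \<epsilon> by (simp add: mult_left_mono)
  qed
  \<comment> \<open>\<open>X\<close> does not depend on the mesh, which was chosen for each
    \<epsilon> separately, so \<epsilon> may tend to 0.\<close>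
  have "((\<lambda>\<epsilon>. K * (M + \<epsilon>) * (b * x0 ^ n / fact (Suc n) + \<epsilon>)) \<longlongrightarrow> K * (M + 0) * (b * x0 ^ n / fact (Suc n) + 0)) (at_right 0)"
    by (intro tendsto_intros)
  then have "X \<le> K * (M + 0) * (b * x0 ^ n / fact (Suc n) + 0)"
    by (rule tendsto_lowerbound) (use main in \<open>auto simp: eventually_at_right_less eventually_at_filter intro!: always_eventually\<close>)
  also have "\<dots> = b * (M * (5/4) ^ length c) * norm (last c) ^ Suc n / fact (Suc n)"
    by (simp add: K_def x0_def mult_ac)
  finally show ?thesis by (simp add: X_def)
qed

text \<open>Lists starting at 0 are included so that the result can serve as hypothesis
  \<open>bu\<close> for the next convolution, whose parts include \<open>split c 0\<close>. Such a
  list never leaves 0, where the convolution vanishes.\<close>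

lemma ext_convolution_bound:
  assumes u: "u \<in> germs" "v \<in> germs" and B: "b \<ge> 0" "M \<ge> 0"
    and bu: "\<And>a. adm a \<Longrightarrow> length a = N \<Longrightarrow> norm (ext u a (tip a)) \<le> b * norm (last a) ^ n / fact n"
    and bv: "\<And>a. adm a \<Longrightarrow> length a = N \<Longrightarrow> norm (ext v a (tip a)) \<le> M"
    and c: "adm c" "length c = N"
  shows "norm (ext (fps_convolution u v) c (tip c)) \<le> b * (M * (5/4) ^ N) * norm (last c) ^ Suc n / fact (Suc n)"
proof (cases "chain c")
  case True
  then show ?thesis using ext_convolution_bound_chain[OF u True B] bu bv c by metis
next
  case False
  then have "travel c \<le> 0" using travel_upper[OF c(1)] c(1) by (cases "c = []") (auto simp: chain_def)
  moreover from this have "norm (tip c) \<le> 0" using norm_tip_le_travel[of c] by linarith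
  ultimately have "tip c = 0" "ext (fps_convolution u v) c = eval_fps (fps_convolution u v)"
    using R_pos by (simp_all add: ext_near)
  then have "ext (fps_convolution u v) c (tip c) = 0" by (simp add: eval_fps_at_0 fps_convolution_def)
  then show ?thesis using B by simp
qed

end

section \<open>Series of resurgent functions\<close>

lemma holomorphic_series:
  assumes A: "open A" and hol: "\<And>n. f n holomorphic_on A"
    and bound: "\<And>n x. x \<in> A \<Longrightarrow> norm (f n x) \<le> B n" and B: "summable B"
  shows "(\<lambda>x. \<Sum>n. f n x :: complex) holomorphic_on A"
    and "uniform_limit A (\<lambda>N x. \<Sum>n<N. f n x) (\<lambda>x. \<Sum>n. f n x) sequentially"
proof -
  show ul: "uniform_limit A (\<lambda>N x. \<Sum>n<N. f n x) (\<lambda>x. \<Sum>n. f n x) sequentially"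
    by (rule Weierstrass_m_test[OF _ B]) (use bound in auto)
  show "(\<lambda>x. \<Sum>n. f n x) holomorphic_on A"
  proof (rule holomorphic_uniform_sequence[OF A])
    show "(\<lambda>x. \<Sum>n<N. f n x) holomorphic_on A" for N by (intro holomorphic_intros hol)
    fix x assume "x \<in> A"
    then obtain d where "d > 0" "cball x d \<subseteq> A" using A open_contains_cball by blast
    then show "\<exists>d>0. cball x d \<subseteq> A \<and> uniform_limit (cball x d) (\<lambda>N x. \<Sum>n<N. f n x) (\<lambda>x. \<Sum>n. f n x) sequentially"
      using uniform_limit_on_subset[OF ul] by blast
  qed
qed

text \<open>Uniform convergence lets the derivatives of all orders at 0 pass to the limit, so the
  Taylor coefficients of the analytic sum are those of the formal sum \<open>v\<close>.\<close>

lemma eval_fps_series: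
  fixes U :: "nat \<Rightarrow> complex fps"
  assumes r: "0 < r" and rad: "\<And>n. ereal r \<le> fps_conv_radius (U n)"
    and bound: "\<And>n x. x \<in> ball 0 r \<Longrightarrow> norm (eval_fps (U n) x) \<le> B n" and B: "summable B"
    and coeff: "\<And>k. (\<lambda>n. fps_nth (U n) k) sums fps_nth v k"
  shows "ereal r \<le> fps_conv_radius v" "x \<in> ball 0 r \<Longrightarrow> eval_fps v x = (\<Sum>n. eval_fps (U n) x)"
proof -
  define S where "S x = (\<Sum>n. eval_fps (U n) x)" for x
  have hol: "eval_fps (U n) holomorphic_on ball 0 r" for n
    by (rule holomorphic_on_eval_fps) (use rad[of n] in \<open>force simp: eball_def dist_norm intro: less_le_trans[of _ "ereal r"]\<close>)
  have S: "S holomorphic_on ball 0 r"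
    and ul: "uniform_limit (ball 0 r) (\<lambda>N x. \<Sum>n<N. eval_fps (U n) x) S sequentially"
    unfolding S_def[abs_def] using holomorphic_series[OF open_ball hol bound B] by blast+
  have "S analytic_on {0}" using S r analytic_at_ball by blast
  then have exp: "S has_fps_expansion fps_expansion S 0" by (rule analytic_at_imp_has_fps_expansion_0)
  have "fps_nth (fps_expansion S 0) k = fps_nth v k" for k
  proof -
    have "(\<lambda>N. (deriv ^^ k) (\<lambda>x. \<Sum>n<N. eval_fps (U n) x) 0) \<longlonglongrightarrow> (deriv ^^ k) S 0"
      by (rule higher_deriv_complex_uniform_limit[OF ul]) (use r hol in \<open>auto intro!: holomorphic_on_sum always_eventually\<close>)
    moreover have "(deriv ^^ k) (\<lambda>x. \<Sum>n<N. eval_fps (U n) x) 0 = fact k * (\<Sum>n<N. fps_nth (U n) k)" for N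
    proof -
      have "0 < fps_conv_radius (U n)" for n using rad[of n] r by (auto intro: less_le_trans[of _ "ereal r"])
      then have "(\<lambda>x. \<Sum>n<N. eval_fps (U n) x) has_fps_expansion (\<Sum>n<N. U n)"
        by (induction N) (auto intro!: fps_expansion_intros eval_fps_has_fps_expansion)
      from fps_nth_fps_expansion[OF this, of k] show ?thesis by (simp add: fps_sum_nth field_simps)
    qed
    ultimately have "(\<lambda>N. fact k * (\<Sum>n<N. fps_nth (U n) k)) \<longlonglongrightarrow> (deriv ^^ k) S 0" by simp
    moreover have "(\<lambda>N. fact k * (\<Sum>n<N. fps_nth (U n) k)) \<longlonglongrightarrow> fact k * fps_nth v k"
      using coeff[of k] unfolding sums_def by (intro tendsto_intros)
    ultimately have "(deriv ^^ k) S 0 = fact k * fps_nth v k" using LIMSEQ_unique by blast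
    then show ?thesis using fps_nth_fps_expansion[OF exp, of k] by simp
  qed
  then have "S has_fps_expansion v" using exp by (metis fps_ext)
  then show "ereal r \<le> fps_conv_radius v" "x \<in> ball 0 r \<Longrightarrow> eval_fps v x = (\<Sum>n. eval_fps (U n) x)"
    using holomorphic_on_imp_fps_conv_radius_ge[of S v "ereal r"] has_fps_expansion_imp_eval_fps_eq[of S v x r] S
    by (auto simp: S_def)
qed

context additive_singularities
begin

lemma ext_bound_function:
  assumes "u \<in> germs"
  shows "\<exists>M. \<forall>n. 0 \<le> M n \<and> (\<forall>c. adm c \<and> length c = n \<longrightarrow> norm (ext u c (tip c)) \<le> M n)"
  by (rule choice) (metis ext_bounded[OF assms])

text \<open>The discs on which two branches of \<open>U n\<close> agree are the same for all n, so
  the termwise equalities add up, and the sums \<open>S\<close> form a local family.\<close>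

lemma series_continuable:
  assumes U: "\<And>n. U n \<in> germs" and B: "\<And>N. summable (B N)"
    and bound: "\<And>n c. adm c \<Longrightarrow> c \<noteq> [] \<Longrightarrow> norm (ext (U n) c (tip c)) \<le> B (length c) n"
    and coeff: "\<And>k. (\<lambda>n. fps_nth (U n) k) sums fps_nth v k"
  shows "ereal (R/4) \<le> fps_conv_radius v"
    and "0 < norm z \<Longrightarrow> norm z < R/4 \<Longrightarrow> continuable_off \<Omega> z (eval_fps v)"
proof -
  \<comment> \<open>Every point of this disc, 0 included, is an admissible one-point list on which
    \<open>ext\<close> is the power series.\<close>
  have bound1: "norm (eval_fps (U n) x) \<le> B 1 n" if "x \<in> ball 0 (R/4)" for n x
    using bound[of "[x]" n] that R_pos by (simp add: ext_near)
  have rad: "ereal (R/4) \<le> fps_conv_radius (U n)" for n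
    using U[of n] R_pos by (auto simp: germs_def intro: order_trans[of _ "ereal R"])
  note V = eval_fps_series[OF _ rad bound1 B coeff, simplified]
  show "ereal (R/4) \<le> fps_conv_radius v" using V(1) R_pos by simp
  define S where "S c x = (\<Sum>n. ext (U n) c x)" for c x
  have S_eq: "germ_eq z (S a) (S b)" if "open A" "z \<in> A" "\<And>n w. w \<in> A \<Longrightarrow> ext (U n) a w = ext (U n) b w" for A z a b
    by (rule germ_eqI[OF that(1,2)]) (simp add: S_def that(3))
  have "local_family N (R/4) (eval_fps v) S" for N
    unfolding local_family_def
  proof (intro conjI allI impI)
    fix c assume c: "chain c \<and> length c \<le> N"
    then have ad: "adm c" "c \<noteq> []" and eta: "eta c > 0" using eta_pos by (auto simp: chain_def)
    let ?A = "ball (tip c) (eta c / 4)"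
    have sub: "?A \<subseteq> ball (tip c) (rho c)" using eta_le_rho[of c] eta by auto
    \<comment> \<open>Bounds at tips become bounds on a disc: a point x within
      \<open>eta c / 4\<close> prolongs the chain. This is why \<open>B\<close> is taken at the next
      length.\<close>
    have b: "norm (ext (U n) c x) \<le> B (Suc (length c)) n" if x: "x \<in> ?A" for n x
    proof -
      have ad': "adm (x # c)" using x ad by (simp add: dist_norm norm_minus_commute)
      then have "ext (U n) (x # c) x = ext (U n) c x"
        using tip_in_ball[OF ad'] step_in_ball[OF ad'] by (intro ext_step_eq[OF U ad']) auto
      then show ?thesis using bound[OF ad', of n] by (simp del: ext.simps)
    qed
    have "S c holomorphic_on ?A"
      unfolding S_def[abs_def]
      by (rule holomorphic_series(1)[OF open_ball holomorphic_on_subset[OF ext_holomorphic[OF U ad(1)] sub] b B])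
    then show "S c analytic_on {tip c}" using eta analytic_at_ball[of "S c" "tip c"] by (metis zero_less_divide_iff zero_less_numeral)
  next
    fix z assume z: "chain [z] \<and> norm z < R/4"
    show "germ_eq z (S [z]) (eval_fps v)"
    proof (rule germ_eqI[of "ball 0 (R/4)"])
      fix w :: complex assume "w \<in> ball 0 (R/4)"
      moreover have "ext (U n) [z] = eval_fps (U n)" for n using z R_pos by (intro ext_near) simp
      ultimately show "S [z] w = eval_fps v w" using V(2)[of w] R_pos by (simp add: S_def)
    qed (use z in auto)
  next
    fix c assume c: "chain c \<and> length c < N"
    then have ad: "adm c" "adm (tip c # c)" using chain_adm chain_tip by blast+
    show "germ_eq (tip c) (S (tip c # c)) (S c)"
      using ext_step_eq[OF U ad(2)] tip_in_ball[OF ad(1)] tip_in_ball[OF ad(2)]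
      by (intro S_eq[of "ball (tip c) (rho (tip c # c)) \<inter> ball (tip c) (rho c)"]) auto
  next
    fix z c assume c: "c \<noteq> [] \<and> chain (z # c) \<and> length c < N"
    define k where "k = rho_min (length (z # c)) / 2"
    have k: "k > 0" using rho_min_pos by (simp add: k_def)
    show "\<exists>k>0. \<forall>z'. norm (z' - z) < k \<and> chain (z' # c) \<longrightarrow> germ_eq z' (S (z' # c)) (S (z # c))"
    proof (intro exI[of _ k] conjI allI impI k)
      fix z' assume z': "norm (z' - z) < k \<and> chain (z' # c)"
      have ad: "adm (z # c)" "adm (z' # c)" using c z' chain_adm by blast+
      have cl: "close k (z' # c) (z # c)" using z' close_refl[OF k] by simp
      have "z' \<in> ball z (rho (z # c))"
        using z' rho_min_le_rho[OF ad(1)] k by (simp add: k_def dist_norm norm_minus_commute)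
      then show "germ_eq z' (S (z' # c)) (S (z # c))"
        using ext_close[OF U cl ad(2,1)] tip_in_ball[OF ad(2)]
        by (intro S_eq[of "ball z' (rho (z' # c)) \<inter> ball z (rho (z # c))"]) (auto simp: k_def)
    qed
  qed
  then show "0 < norm z \<Longrightarrow> norm z < R/4 \<Longrightarrow> continuable_off \<Omega> z (eval_fps v)"
    using continuable_off_local_families by blast
qed

lemma germs_0: "0 \<in> germs"
  unfolding germs_def continuable_off_def continuable_along_iff continuation_def
  by (auto intro!: exI[of _ "\<lambda>t w. 0"] simp: eval_fps_0[abs_def])

lemma ext_0: "adm c \<Longrightarrow> w \<in> ball (tip c) (rho c) \<Longrightarrow> ext 0 c w = 0"
  using ext_linear[OF germs_0 germs_0, of "fps_const (-1)" c w] by simp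

lemma germs_mult: "u \<in> germs \<Longrightarrow> fps_conv_radius A = \<infinity> \<Longrightarrow> A * u \<in> germs"
  using germs_linear[OF _ germs_0] by fastforce

lemma ext_mult:
  "u \<in> germs \<Longrightarrow> fps_conv_radius A = \<infinity> \<Longrightarrow> adm c \<Longrightarrow>
     ext (A * u) c (tip c) = eval_fps A (tip c) * ext u c (tip c)"
  using ext_linear[OF _ germs_0, of u A c "tip c"] ext_0 tip_in_ball by simp

lemma minor_const_mult: "minor (fps_const a * f) = fps_const a * minor f"
  by (rule fps_ext) simp

lemma minor_sums:
  assumes "f sums l" shows "(\<lambda>n. fps_nth (minor (f n)) k) sums fps_nth (minor l) k"
proof -
  have "(\<lambda>N. fps_nth (\<Sum>n<N. f n) (Suc k)) \<longlonglongrightarrow> fps_nth l (Suc k)"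
    using assms unfolding sums_def tendsto_fps_iff by (intro tendsto_eventually) blast
  then have "(\<lambda>n. fps_nth (f n) (Suc k)) sums fps_nth l (Suc k)"
    by (simp add: sums_def fps_sum_nth)
  then show ?thesis by (simp add: sums_divide)
qed

lemma resurgentI:
  assumes "\<And>n. minor (f n) \<in> germs" and B: "\<And>N. summable (B N)"
    and "\<And>n c. adm c \<Longrightarrow> c \<noteq> [] \<Longrightarrow> norm (ext (minor (f n)) c (tip c)) \<le> B (length c) n"
    and "f sums l"
  shows "l \<in> resurgent_series \<Omega>"
proof -
  note S = series_continuable[of "\<lambda>n. minor (f n)" B "minor l", OF assms(1) B assms(3) minor_sums[OF assms(4)], simplified]
  have "{\<zeta>. 0 < norm \<zeta> \<and> norm \<zeta> < R/4} \<inter> \<Omega> = {}" using R_le R_pos by force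
  then show ?thesis
    unfolding resurgent_iff continuable_germs_def mem_Collect_eq
    by (intro exI[of _ "R/4"]) (use S R_pos in \<open>auto simp: continuable_off_def\<close>)
qed

text \<open>Since 1 / p! is part of the series, each multiplication by \<phi> may cost a constant
  factor \<open>Q\<close> and each derivative a factor \<open>L\<close>; (Q L)^p / p! remains
  summable.\<close>

lemma resurgent_compose_id_plus:
  assumes \<phi>: "minor \<phi> \<in> germs" and \<psi>: "minor \<psi> \<in> germs"
  shows "compose_id_plus \<psi> \<phi> \<in> resurgent_series \<Omega>"
proof -
  obtain M1 where M1: "\<And>n. M1 n \<ge> 0" "\<And>n c. adm c \<Longrightarrow> length c = n \<Longrightarrow> norm (ext (minor \<phi>) c (tip c)) \<le> M1 n"
    using ext_bound_function[OF \<phi>] by blast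
  obtain M2 where M2: "\<And>n. M2 n \<ge> 0" "\<And>n c. adm c \<Longrightarrow> length c = n \<Longrightarrow> norm (ext (minor \<psi>) c (tip c)) \<le> M2 n"
    using ext_bound_function[OF \<psi>] by blast
  define a where "a = fps_nth \<phi> 0"
  define L where "L N = (5/4) ^ N * (R/4)" for N :: nat
  \<comment> \<open>The constant term of \<phi> multiplies by a; its minor convolves, which costs
    \<open>M1 N\<close> times a contour length of at most \<open>L N\<close>.\<close>
  define Q where "Q N = norm a + M1 N * L N" for N
  have L: "L N \<ge> 0" for N using R_pos by (simp add: L_def)
  have Q: "Q N \<ge> 0" for N using M1(1) L by (simp add: Q_def)
  have lastL: "(5/4) ^ length c * norm (last c) \<le> L (length c)" if "adm c" "c \<noteq> []" for c
    using norm_last_le[OF that] by (auto simp: L_def intro!: mult_left_mono)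
  define X where "X p q = minor (\<phi> ^ q * (dz ^^ p) \<psi>)" for p q
  have A: "fps_conv_radius ((- fps_X) ^ p :: complex fps) = \<infinity>" for p
    using fps_conv_radius_power[of "- fps_X :: complex fps" p] by simp
  have evA: "eval_fps ((- fps_X) ^ p) z = (- z) ^ p" for p and z :: complex
    by (simp add: eval_fps_power eval_fps_minus)
  \<comment> \<open>For p > 0 the factor \<open>(dz ^^ p) \<psi>\<close> has no constant term, so
    \<open>minor_mult\<close> leaves no multiple of \<open>minor \<phi>\<close> alone.\<close>
  have XS: "X p (Suc q) = fps_const a * X p q + fps_convolution (minor \<phi>) (X p q)" if "p > 0" for p q
  proof -
    have "fps_nth (\<phi> ^ q * (dz ^^ p) \<psi>) 0 = 0" using funpow_dz_nth_eq_0[OF that] by simp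
    then show ?thesis by (simp add: X_def minor_mult[of \<phi>] a_def mult.assoc)
  qed
  have X0: "X p 0 \<in> germs" for p using germs_mult[OF \<psi> A] by (simp add: X_def minor_dz_power)
  have X0b: "norm (ext (X p 0) c (tip c)) \<le> L (length c) ^ p * M2 (length c)" if c: "adm c" "c \<noteq> []" for p c
  proof -
    have "norm (tip c) \<le> L (length c)"
      using norm_tip_le_travel[of c] travel_upper[OF c] lastL[OF c] by linarith
    then have "norm (tip c) ^ p * norm (ext (minor \<psi>) c (tip c)) \<le> L (length c) ^ p * M2 (length c)"
      using M2(2)[OF c(1) refl] L by (intro mult_mono power_mono) auto
    then show ?thesis
      by (simp add: X_def minor_dz_power ext_mult[OF \<psi> A c(1)] evA norm_mult norm_power)
  qed
  have X: "X p q \<in> germs \<and> (\<forall>c. adm c \<and> c \<noteq> [] \<longrightarrow>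
      norm (ext (X p q) c (tip c)) \<le> Q (length c) ^ q * (L (length c) ^ p * M2 (length c)))" if p: "p > 0" for p q
  proof (induction q)
    case 0
    then show ?case using X0 X0b by simp
  next
    case (Suc q)
    then have IH: "X p q \<in> germs" by blast
    note conv = germs_convolution[OF \<phi> IH]
    show ?case
    proof (intro conjI allI impI)
      show "X p (Suc q) \<in> germs" unfolding XS[OF p] by (rule germs_linear[OF IH conv]) simp
      fix c assume c: "adm c \<and> c \<noteq> []"
      define b where "b = Q (length c) ^ q * (L (length c) ^ p * M2 (length c))"
      have b0: "b \<ge> 0" using Q L M2(1) by (simp add: b_def)
      have b: "norm (ext (X p q) d (tip d)) \<le> b" if "adm d" "length d = length c" for d
        using Suc that c unfolding b_def by (metis length_0_conv)
      \<comment> \<open>The bound is used with n = 0: no power of the first point is kept, it is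
        absorbed into \<open>L\<close>.\<close>
      have "norm (ext (fps_convolution (minor \<phi>) (X p q)) c (tip c)) \<le>
         M1 (length c) * (b * (5/4) ^ length c) * norm (last c) ^ Suc 0 / fact (Suc 0)"
        by (rule ext_convolution_bound[OF \<phi> IH]) (use M1 b b0 c in auto)
      also have "\<dots> = M1 (length c) * b * ((5/4) ^ length c * norm (last c))" by simp
      also have "\<dots> \<le> M1 (length c) * b * L (length c)"
        using lastL c M1(1) b0 by (intro mult_left_mono) auto
      finally have 1: "norm (ext (fps_convolution (minor \<phi>) (X p q)) c (tip c)) \<le> M1 (length c) * b * L (length c)" .
      have 2: "norm (a * ext (X p q) c (tip c)) \<le> norm a * b"
        unfolding norm_mult using b c by (intro mult_left_mono) auto
      have "ext (X p (Suc q)) c (tip c) = a * ext (X p q) c (tip c) + ext (fps_convolution (minor \<phi>) (X p q)) c (tip c)"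
        unfolding XS[OF p] using ext_linear[OF IH conv, of "fps_const a" c "tip c"] tip_in_ball c by simp
      then have "norm (ext (X p (Suc q)) c (tip c)) \<le> norm a * b + M1 (length c) * b * L (length c)"
        using 1 2 norm_triangle_ineq[of "a * ext (X p q) c (tip c)"] by (smt (verit))
      also have "\<dots> \<le> Q (length c) * b"
        using b0 M1(1) by (simp add: Q_def algebra_simps)
      finally show "norm (ext (X p (Suc q)) c (tip c)) \<le> Q (length c) ^ Suc q * (L (length c) ^ p * M2 (length c))"
        by (simp add: b_def mult.assoc)
    qed
  qed
  \<comment> \<open>Only q = p is needed, and for p = 0 this is \<psi> itself, which may have a
    constant term.\<close>
  have Xpp: "X p p \<in> germs" "\<And>c. adm c \<Longrightarrow> c \<noteq> [] \<Longrightarrow>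
      norm (ext (X p p) c (tip c)) \<le> Q (length c) ^ p * (L (length c) ^ p * M2 (length c))" for p
    using X[of p p] X0[of 0] X0b[of _ 0] by (cases "p = 0"; auto)+
  define f where "f p = fps_const (1 / fact p) * \<phi> ^ p * (dz ^^ p) \<psi>" for p
  have f: "minor (f p) = fps_const (1 / fact p) * X p p" for p
    unfolding f_def X_def mult.assoc by (rule minor_const_mult)
  show ?thesis
  proof (rule resurgentI[where f = f and B = "\<lambda>N p. inverse (fact p) * (Q N * L N) ^ p * M2 N"])
    show "minor (f p) \<in> germs" for p unfolding f by (rule germs_mult[OF Xpp(1)]) simp
    show "summable (\<lambda>p. inverse (fact p) * (Q N * L N) ^ p * M2 N)" for N
      by (intro summable_mult2 summable_exp)
    show "norm (ext (minor (f p)) c (tip c)) \<le> inverse (fact p) * (Q (length c) * L (length c)) ^ p * M2 (length c)"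
      if c: "adm c" "c \<noteq> []" for p c
    proof -
      have "norm (ext (minor (f p)) c (tip c)) = inverse (fact p) * norm (ext (X p p) c (tip c))"
        unfolding f using ext_mult[OF Xpp(1) _ c(1), of "fps_const (1 / fact p)" p]
        by (simp add: norm_mult norm_divide norm_inverse divide_inverse)
      also have "\<dots> \<le> inverse (fact p) * (Q (length c) ^ p * (L (length c) ^ p * M2 (length c)))"
        by (intro mult_left_mono Xpp(2) c) auto
      finally show ?thesis by (simp add: power_mult_distrib mult_ac)
    qed
    show "f sums compose_id_plus \<psi> \<phi>" unfolding f_def[abs_def] by (rule compose_id_plus_sums)
  qed
qed

text \<open>The coefficients of H are bounded only geometrically, so convergence rests on the
  factorials from iterated convolution. Without a constant term, the minor of chi^(n + 1) is a
  convolution of n + 1 equal factors, bounded with 1 / n!.\<close>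

lemma resurgent_compose:
  assumes chi: "minor chi \<in> germs" and chi0: "fps_nth chi 0 = 0" and H: "fps_conv_radius H > 0"
  shows "H oo chi \<in> resurgent_series \<Omega>"
proof -
  obtain M where M: "\<And>n. M n \<ge> 0" "\<And>n c. adm c \<Longrightarrow> length c = n \<Longrightarrow> norm (ext (minor chi) c (tip c)) \<le> M n"
    using ext_bound_function[OF chi] by blast
  obtain r where r: "r > 0" "ereal r < fps_conv_radius H"
    using H ereal_dense2[of 0 "fps_conv_radius H"] by (auto simp: zero_ereal_def)
  then have "summable (\<lambda>n. fps_nth H n * of_real r ^ n)"
    by (intro summable_in_conv_radius) (simp add: fps_conv_radius_def)
  then have "Bseq (\<lambda>n. fps_nth H n * of_real r ^ n)"
    using summable_LIMSEQ_zero convergent_imp_Bseq convergentI by blast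
  then obtain A where A: "A > 0" "\<And>n. norm (fps_nth H n * of_real r ^ n) \<le> A" by (auto simp: Bseq_def)
  have HA: "norm (fps_nth H n) \<le> A / r ^ n" for n
    using A(2)[of n] r by (simp add: norm_mult norm_power field_simps)
  define u where "u n = minor (chi ^ Suc n)" for n
  have uS: "u (Suc n) = fps_convolution (u n) (minor chi)" for n
  proof -
    have "chi ^ Suc (Suc n) = chi ^ Suc n * chi" by (simp add: mult_ac)
    then show ?thesis using chi0 by (simp add: u_def minor_mult[of "chi ^ Suc n"] del: power_Suc)
  qed
  define K where "K N = M N * (5/4) ^ N" for N :: nat
  have K: "K N \<ge> 0" for N using M(1) by (simp add: K_def)
  have u: "u n \<in> germs \<and> (\<forall>c. adm c \<longrightarrow>
      norm (ext (u n) c (tip c)) \<le> M (length c) * K (length c) ^ n * norm (last c) ^ n / fact n)" for n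
  proof (induction n)
    case 0
    then show ?case using chi M by (simp add: u_def)
  next
    case (Suc n)
    then have IH: "u n \<in> germs" by blast
    show ?case
    proof (intro conjI allI impI)
      show "u (Suc n) \<in> germs" unfolding uS by (rule germs_convolution[OF IH chi])
      fix c assume c: "adm c"
      have "norm (ext (u (Suc n)) c (tip c)) \<le> (M (length c) * K (length c) ^ n) * (M (length c) * (5/4) ^ length c) *
          norm (last c) ^ Suc n / fact (Suc n)"
        unfolding uS by (rule ext_convolution_bound[OF IH chi]) (use Suc M K c in \<open>auto simp: mult.assoc\<close>)
      then show "norm (ext (u (Suc n)) c (tip c)) \<le> M (length c) * K (length c) ^ Suc n * norm (last c) ^ Suc n / fact (Suc n)"
        by (simp add: K_def mult_ac)
    qed
  qed
  define f where "f n = fps_const (fps_nth H n) * chi ^ n" for n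
  have f0: "minor (f 0) = 0" by (rule fps_ext) (simp add: f_def)
  have f: "minor (f (Suc n)) = fps_const (fps_nth H (Suc n)) * u n" for n
    unfolding f_def u_def by (rule minor_const_mult)
  \<comment> \<open>A constant has minor 0, whence the entry 0; the others combine \<open>HA\<close>
    with the bound for \<open>u\<close>, the first point having norm at most R/4.\<close>
  define B where "B N n = (case n of 0 \<Rightarrow> 0 | Suc n \<Rightarrow> inverse (fact n) * (K N * (R/4) / r) ^ n * (A / r * M N))" for N n
  show ?thesis
  proof (rule resurgentI[where f = f and B = B])
    show "minor (f n) \<in> germs" for n
    proof (cases n)
      case (Suc m)
      show ?thesis unfolding Suc f by (rule germs_mult) (use u in auto)
    qed (simp add: f0 germs_0)
    show "summable (B N)" for N
    proof -
      have "summable (\<lambda>n. B N (Suc n))" unfolding B_def nat.case by (intro summable_mult2 summable_exp)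
      then show ?thesis by (simp add: summable_Suc_iff)
    qed
    show "norm (ext (minor (f n)) c (tip c)) \<le> B (length c) n" if c: "adm c" "c \<noteq> []" for n c
    proof (cases n)
      case 0
      then show ?thesis using ext_0[OF c(1) tip_in_ball[OF c(1)]] by (simp add: f0 B_def)
    next
      case (Suc m)
      have un: "u m \<in> germs" using u by blast
      have "norm (ext (minor (f n)) c (tip c)) = norm (fps_nth H (Suc m)) * norm (ext (u m) c (tip c))"
        unfolding f Suc using ext_mult[OF un _ c(1), of "fps_const (fps_nth H (Suc m))"] by (simp add: norm_mult)
      also have "\<dots> \<le> (A / r ^ Suc m) * (M (length c) * K (length c) ^ m * norm (last c) ^ m / fact m)"
        using HA[of "Suc m"] u[of m] c M(1) K r A by (intro mult_mono) (auto simp del: power_Suc)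
      also have "\<dots> \<le> (A / r ^ Suc m) * (M (length c) * K (length c) ^ m * (R/4) ^ m / fact m)"
        using M(1) K r A norm_last_le[OF c]
        by (intro mult_left_mono divide_right_mono power_mono) auto
      also have "\<dots> = B (length c) n"
        unfolding Suc B_def nat.case using r by (simp add: power_mult_distrib power_divide field_simps)
      finally show ?thesis .
    qed
    show "f sums (H oo chi)" unfolding f_def[abs_def] by (rule fps_compose_sums[OF chi0])
  qed
qed

end

theorem theorem22p2:
  fixes \<Omega> :: "complex set" and \<phi> \<psi> chi H :: "complex fps"
  assumes "\<Omega> \<noteq> {}" and "closed \<Omega>" and "discrete \<Omega>"
    and "\<And>\<omega> \<omega>'. \<omega> \<in> \<Omega> \<Longrightarrow> \<omega>' \<in> \<Omega> \<Longrightarrow> \<omega> + \<omega>' \<in> \<Omega>"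
    and "\<phi> \<in> resurgent_series \<Omega>" and "\<psi> \<in> resurgent_series \<Omega>" and "chi \<in> resurgent_series \<Omega>"
    and "fps_nth chi 0 = 0"
    and "fps_conv_radius H > 0"
  shows "compose_id_plus \<psi> \<phi> \<in> resurgent_series \<Omega> \<and> H oo chi \<in> resurgent_series \<Omega>"
proof -
  have "\<exists>R>0. ereal R \<le> fps_conv_radius (minor f) \<and> {\<zeta>. 0 < norm \<zeta> \<and> norm \<zeta> < R} \<inter> \<Omega> = {} \<and>
     (\<forall>z. 0 < norm z \<and> norm z < R \<longrightarrow> continuable_off \<Omega> z (eval_fps (minor f)))"
    if "f \<in> resurgent_series \<Omega>" for f
    using that unfolding resurgent_iff continuable_germs_def continuable_off_def by blast
  then obtain r where r: "\<And>f. f \<in> resurgent_series \<Omega> \<Longrightarrow> r f > 0 \<and> ereal (r f) \<le> fps_conv_radius (minor f) \<and>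
     {\<zeta>. 0 < norm \<zeta> \<and> norm \<zeta> < r f} \<inter> \<Omega> = {} \<and>
     (\<forall>z. 0 < norm z \<and> norm z < r f \<longrightarrow> continuable_off \<Omega> z (eval_fps (minor f)))"
    by metis
  \<comment> \<open>A common radius for the three series, so that one instance of the locale holds
    them all.\<close>
  define R where "R = min (r \<phi>) (min (r \<psi>) (r chi))"
  have R: "R > 0" "R \<le> r \<phi>" "R \<le> r \<psi>" "R \<le> r chi"
    using r[OF assms(5)] r[OF assms(6)] r[OF assms(7)] by (auto simp: R_def)
  interpret additive_singularities \<Omega> R
  proof
    show "R \<le> norm w" if "w \<in> \<Omega>" "w \<noteq> 0" for w
      using r[OF assms(5)] R(2) that by (force simp: not_le[symmetric])
  qed (use assms R in auto)
  have "minor f \<in> germs" if "f \<in> resurgent_series \<Omega>" "R \<le> r f" for f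
    using r[OF that(1)] that(2) unfolding germs_def by (auto intro: order_trans[of _ "ereal (r f)"])
  then show ?thesis
    using resurgent_compose_id_plus resurgent_compose assms R by blast
qed

end
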